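(* Let $\omega\in\Omega$ be a code tree and assume that $\overline\sigma<\tfrac12$. Then $$\dim_{\mathrm H}(A_{\mathbf a}^\omega)=\min\{D,d^\omega\}$$ for $\mathcal L^{D\mathcal A}$-almost all $\mathbf a\in\mathbb R^{D\mathcal A}$, where $\dim_{\mathrm H}$ is the Hausdorff dimension, $A_{\mathbf a}^\omega$ is the code tree fractal of $\omega$ with translation vector $\mathbf a$, and $d^\omega$ is the affinity dimension of $\Sigma^\omega$.
   Context: $\mathbb N=\{1,2,\dots\}$, $D\in\mathbb N$. Code trees. Let $\Lambda$ be an index set and for each $\lambda\in\Lambda$ let $M_\lambda\in\mathbb N$, with $M=\sup_\lambda M_\lambda<\infty$. For $\lambda\in\Lambda$, $1\le i\le M_\lambda$ let $T_i^\lambda:\mathbb R^D\to\mathbb R^D$ be a fixed non-singular linear map; $\overline\sigma\in(0,1)$ is a number with $\|T_i^\lambda\|\le\overline\sigma$ for all $\lambda,i$. Let $I=\{1,\dots,M\}$; $I^0$ consists of the empty word $\emptyset$; $|\tau|=k$ for $\tau\in I^k$. For a function $\omega:\bigcup_{k\ge0}I^k\to\Lambda$ let $\Sigma_*^\omega\subset\bigcup_{k\ge0}I^k$ be the unique set such that $\emptyset\in\Sigma_*^\omega$; if $i_1\cdots i_k\in\Sigma_*^\omega$ and $\omega(i_1\cdots i_k)=\lambda$ then $i_1\cdots i_kl\in\Sigma_*^\omega$ if and only if $l\le M_\lambda$; and if $i_1\cdots i_k\notin\Sigma_*^\omega$ then $i_1\cdots i_kl\notin\Sigma_*^\omega$ for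 all $l$. The restriction of $\omega$ to $\Sigma_*^\omega$ is called a code tree; $\Omega$ is the set of all code trees. $\Sigma^\omega=\{\mathbf i=i_1i_2\cdots\in I^{\mathbb N}: i_1\cdots i_n\in\Sigma_*^\omega\ \forall n\}$, with the topology induced by the product topology. $\mathbf i_k=i_1\cdots i_k$, $[\mathbf i_k]=\{\mathbf j\in\Sigma^\omega: j_l=i_l,\ 1\le l\le k\}$, and $T_{\mathbf i_k}^\omega=T_{i_1}^{\omega(\emptyset)}T_{i_2}^{\omega(i_1)}\cdots T_{i_k}^{\omega(i_1\cdots i_{k-1})}$. Translations. The set $\widehat\Lambda=\{(\lambda,i):\lambda\in\Lambda,1\le i\le M_\lambda\}$ carries an equivalence relation $\sim$ with finitely many classes, their number being $\mathcal A$, such that for every $\lambda$, $(\lambda,i)\sim(\lambda,j)$ iff $i=j$. A vector $\mathbf a\in(\mathbb R^D)^{\mathcal A}=\mathbb R^{D\mathcal A}$ assigns a vector in $\mathbb R^D$ to each class; $a_i^\lambda$ is the vector assigned to the class of $(\lambda,i)$, and $f_i^\lambda(x)=T_i^\lambda(x)+a_i^\lambda$. Put $Z_{\mathbf a}^\omega(\mathbf i)=\lim_{k\to\infty}f_{i_1}^{\omega(\emptyset)}\circ f_{i_2}^{\omega(i_1)}\circ\cdots\circ f_{i_k}^{\omega(i_1\cdots i_{k-1})}(0)$ for $\mathbf i\in\Sigma^\omega$ and $A_{\mathbf a}^\omega=\{Z_{\mathbf a}^\omega(\mathbf i):\mathbf i\in\Sigma^\omega\}$. $\mathcal L^{D\mathcal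 A}$ is Lebesgue measure on $\mathbb R^{D\mathcal A}$. Singular value function. For a non-singular linear $T:\mathbb R^D\to\mathbb R^D$ with singular values $\sigma_1\ge\dots\ge\sigma_D>0$ let $\Phi^\alpha(T)=\sigma_1\cdots\sigma_{m-1}\sigma_m^{\alpha-m+1}$ if $0\le\alpha<D$, where $m$ is the integer with $m-1\le\alpha<m$, and $\Phi^\alpha(T)=\sigma_1\cdots\sigma_{D-1}\sigma_D^{\alpha-D+1}$ if $\alpha\ge D$. Affinity dimension. For Borel $E\subset\Sigma^\omega$ let $M_j^\alpha(E)=\inf\{\sum_{\mathbf i_k\in J}\Phi^\alpha(T_{\mathbf i_k}^\omega): J\subset\Sigma_*^\omega,\ E\subset\bigcup_{\mathbf i_k\in J}[\mathbf i_k],\ k\ge j\text{ for all }\mathbf i_k\in J\}$ and $M^\alpha(E)=\lim_{j\to\infty}M_j^\alpha(E)$. Then $d^\omega=\inf\{\alpha\ge 0: M^\alpha(\Sigma^\omega)=0\}$ (which equals $\sup\{\alpha:M^\alpha(\Sigma^\omega)=\infty\}$, with the convention $\sup\emptyset=0$). *)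

theory Defs
  imports "HOL-Analysis.Analysis"
begin

section \<open>Hausdorff dimension\<close>

text \<open>\<^term>\<open>diameter U powr s\<close> with the conventions that the empty set contributes \<open>0\<close> for every
  \<open>s\<close> and that a nonempty set contributes \<open>1\<close> for \<open>s = 0\<close> (whereas \<open>0 powr 0 = 0\<close>).\<close>

definition diam_powr :: "real \<Rightarrow> 'a::metric_space set \<Rightarrow> ennreal" where
  "diam_powr s U = (if U = {} then 0 else if s = 0 then 1 else ennreal (diameter U powr s))"

text \<open>Boundedness is required explicitly because \<^const>\<open>diameter\<close> is unspecified on unbounded sets.\<close>

definition hausdorff_premeasure :: "real \<Rightarrow> real \<Rightarrow> 'a::metric_space set \<Rightarrow> ennreal" where
  "hausdorff_premeasure s \<delta> E =
     Inf {(\<Sum>n. diam_powr s (U n)) | U :: nat \<Rightarrow> 'a set.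
            E \<subseteq> (\<Union>n. U n) \<and> (\<forall>n. bounded (U n) \<and> diameter (U n) \<le> \<delta>)}"

definition hausdorff_measure :: "real \<Rightarrow> 'a::metric_space set \<Rightarrow> ennreal" where
  "hausdorff_measure s E = (SUP \<delta>\<in>{0<..}. hausdorff_premeasure s \<delta> E)"

definition hausdorff_dim :: "'a::metric_space set \<Rightarrow> ereal" where
  "hausdorff_dim E = Inf {ereal s | s. 0 \<le> s \<and> hausdorff_measure s E = 0}"


section \<open>Singular value function\<close>

definition eigenspace :: "('a::real_vector \<Rightarrow> 'a) \<Rightarrow> real \<Rightarrow> 'a set" where
  "eigenspace S \<mu> = {x. S x = \<mu> *\<^sub>R x}"

definition eigenvalues :: "('a::real_vector \<Rightarrow> 'a) \<Rightarrow> real set" where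
  "eigenvalues S = {\<mu>. \<exists>x. x \<noteq> 0 \<and> x \<in> eigenspace S \<mu>}"

text \<open>The square roots of the eigenvalues of \<open>T\<^sup>*T\<close> in decreasing order, each repeated according to
  its multiplicity; \<open>T\<^sup>*T\<close> is self-adjoint, so its geometric and algebraic multiplicities agree.\<close>

definition singular_values :: "('a::euclidean_space \<Rightarrow> 'a) \<Rightarrow> real list" where
  "singular_values T =
     (let S = adjoint T \<circ> T
      in concat (map (\<lambda>\<mu>. replicate (dim (eigenspace S \<mu>)) (sqrt \<mu>))
                     (rev (sorted_list_of_set (eigenvalues S)))))"

definition singular_value :: "('a::euclidean_space \<Rightarrow> 'a) \<Rightarrow> nat \<Rightarrow> real" where
  "singular_value T j = singular_values T ! (j - 1)"

text \<open>For \<open>0 \<le> \<alpha> < D\<close> the integer \<open>m\<close> with \<open>m - 1 \<le> \<alpha> < m\<close> is \<open>\<lfloor>\<alpha>\<rfloor> + 1\<close>; for \<open>\<alpha> \<ge> D\<close> the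
  formula is the same one with \<open>m = D\<close>.\<close>

definition sv_function :: "real \<Rightarrow> ('a::euclidean_space \<Rightarrow> 'a) \<Rightarrow> real" where
  "sv_function \<alpha> T =
     (let m = (if \<alpha> < real DIM('a) then nat \<lfloor>\<alpha>\<rfloor> + 1 else DIM('a))
      in (\<Prod>j = 1..m - 1. singular_value T j) * singular_value T m powr (\<alpha> - real m + 1))"


section \<open>Code trees\<close>

text \<open>The index set \<open>\<Lambda>\<close> is the type \<open>'l\<close>. Finite words are lists and infinite words are functions
  \<open>x :: nat \<Rightarrow> nat\<close>, both over letters starting from \<open>1\<close>; positions count from \<open>0\<close>, so that
  \<open>i\<^sub>1 i\<^sub>2 \<dots>\<close> is \<open>x 0, x 1, \<dots>\<close>. A function \<open>\<omega>\<close> is total on lists, but all notions below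
  depend only on its values on \<open>tree_words M \<omega>\<close>.\<close>

inductive_set tree_words :: "('l \<Rightarrow> nat) \<Rightarrow> (nat list \<Rightarrow> 'l) \<Rightarrow> nat list set"
  for M :: "'l \<Rightarrow> nat" and \<omega> :: "nat list \<Rightarrow> 'l" where
  Nil: "[] \<in> tree_words M \<omega>"
| snoc: "w \<in> tree_words M \<omega> \<Longrightarrow> 1 \<le> l \<Longrightarrow> l \<le> M (\<omega> w) \<Longrightarrow> w @ [l] \<in> tree_words M \<omega>"

lemma tree_words_snoc_iff:
  "w @ [l] \<in> tree_words M \<omega> \<longleftrightarrow> w \<in> tree_words M \<omega> \<and> 1 \<le> l \<and> l \<le> M (\<omega> w)"
  by (auto elim: tree_words.cases intro: tree_words.intros)

definition code_trees :: "('l \<Rightarrow> nat) \<Rightarrow> (nat list \<Rightarrow> 'l) set" where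
  "code_trees M = {restrict \<omega> (tree_words M \<omega>) | \<omega>. True}"

definition prefix_word :: "(nat \<Rightarrow> nat) \<Rightarrow> nat \<Rightarrow> nat list" where
  "prefix_word x k = map x [0..<k]"

definition tree_boundary :: "('l \<Rightarrow> nat) \<Rightarrow> (nat list \<Rightarrow> 'l) \<Rightarrow> (nat \<Rightarrow> nat) set" where
  "tree_boundary M \<omega> = {x. \<forall>n. prefix_word x n \<in> tree_words M \<omega>}"

definition cylinder :: "('l \<Rightarrow> nat) \<Rightarrow> (nat list \<Rightarrow> 'l) \<Rightarrow> nat list \<Rightarrow> (nat \<Rightarrow> nat) set" where
  "cylinder M \<omega> w = {x \<in> tree_boundary M \<omega>. prefix_word x (length w) = w}"

text \<open>The composition of \<open>G (\<omega> \<emptyset>) i\<^sub>1\<close>, \<open>G (\<omega> (i\<^sub>1)) i\<^sub>2\<close>, \<open>\<dots>\<close>, \<open>G (\<omega> (i\<^sub>1 \<dots> i\<^sub>k\<^sub>-\<^sub>1)) i\<^sub>k\<close> along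
  the word \<open>w = i\<^sub>1 \<dots> i\<^sub>k\<close>, the last map being applied first.\<close>

definition tree_comp :: "('l \<Rightarrow> nat \<Rightarrow> 'a \<Rightarrow> 'a) \<Rightarrow> (nat list \<Rightarrow> 'l) \<Rightarrow> nat list \<Rightarrow> 'a \<Rightarrow> 'a" where
  "tree_comp G \<omega> w = foldr (\<circ>) (map (\<lambda>k. G (\<omega> (take k w)) (w ! k)) [0..<length w]) id"


section \<open>Affinity dimension\<close>

definition affinity_premeasure ::
  "('l \<Rightarrow> nat) \<Rightarrow> ('l \<Rightarrow> nat \<Rightarrow> 'a::euclidean_space \<Rightarrow> 'a) \<Rightarrow> (nat list \<Rightarrow> 'l)
     \<Rightarrow> real \<Rightarrow> nat \<Rightarrow> (nat \<Rightarrow> nat) set \<Rightarrow> ennreal" where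
  "affinity_premeasure M T \<omega> \<alpha> j E =
     Inf {(\<Sum>\<^sub>\<infinity>w\<in>J. ennreal (sv_function \<alpha> (tree_comp T \<omega> w))) | J.
            J \<subseteq> tree_words M \<omega> \<and> E \<subseteq> (\<Union>w\<in>J. cylinder M \<omega> w) \<and> (\<forall>w\<in>J. j \<le> length w)}"

definition affinity_measure ::
  "('l \<Rightarrow> nat) \<Rightarrow> ('l \<Rightarrow> nat \<Rightarrow> 'a::euclidean_space \<Rightarrow> 'a) \<Rightarrow> (nat list \<Rightarrow> 'l)
     \<Rightarrow> real \<Rightarrow> (nat \<Rightarrow> nat) set \<Rightarrow> ennreal" where
  "affinity_measure M T \<omega> \<alpha> E = lim (\<lambda>j. affinity_premeasure M T \<omega> \<alpha> j E)"

definition affinity_dim ::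
  "('l \<Rightarrow> nat) \<Rightarrow> ('l \<Rightarrow> nat \<Rightarrow> 'a::euclidean_space \<Rightarrow> 'a) \<Rightarrow> (nat list \<Rightarrow> 'l) \<Rightarrow> ereal" where
  "affinity_dim M T \<omega> =
     Inf {ereal \<alpha> | \<alpha>. 0 \<le> \<alpha> \<and> affinity_measure M T \<omega> \<alpha> (tree_boundary M \<omega>) = 0}"


section \<open>Translations and code tree fractals\<close>

definition map_indices :: "('l \<Rightarrow> nat) \<Rightarrow> ('l \<times> nat) set" where
  "map_indices M = {(l, i). 1 \<le> i \<and> i \<le> M l}"

text \<open>A translation vector \<open>a\<close> is a function on the set of equivalence classes
  \<^term>\<open>map_indices M // R\<close>.\<close>

definition tree_map ::
  "('l \<times> nat) rel \<Rightarrow> ('l \<Rightarrow> nat \<Rightarrow> 'a \<Rightarrow> 'a) \<Rightarrow> (('l \<times> nat) set \<Rightarrow> 'a) \<Rightarrow> 'l \<Rightarrow> nat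
     \<Rightarrow> 'a::euclidean_space \<Rightarrow> 'a" where
  "tree_map R T a l i y = T l i y + a (R `` {(l, i)})"

definition tree_point ::
  "('l \<times> nat) rel \<Rightarrow> ('l \<Rightarrow> nat \<Rightarrow> 'a \<Rightarrow> 'a) \<Rightarrow> (nat list \<Rightarrow> 'l) \<Rightarrow> (('l \<times> nat) set \<Rightarrow> 'a)
     \<Rightarrow> (nat \<Rightarrow> nat) \<Rightarrow> 'a::euclidean_space" where
  "tree_point R T \<omega> a x = lim (\<lambda>k. tree_comp (tree_map R T a) \<omega> (prefix_word x k) 0)"

definition code_tree_fractal ::
  "('l \<Rightarrow> nat) \<Rightarrow> ('l \<times> nat) rel \<Rightarrow> ('l \<Rightarrow> nat \<Rightarrow> 'a \<Rightarrow> 'a) \<Rightarrow> (nat list \<Rightarrow> 'l)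
     \<Rightarrow> (('l \<times> nat) set \<Rightarrow> 'a) \<Rightarrow> 'a::euclidean_space set" where
  "code_tree_fractal M R T \<omega> a = tree_point R T \<omega> a ` tree_boundary M \<omega>"

text \<open>Lebesgue measure on \<open>(\<real>\<^sup>D)\<^sup>\<A>\<close>, the coordinates being indexed by the classes themselves.
  Passing to the completion would not change the null sets in the sense of \<^const>\<open>almost_everywhere\<close>.\<close>

definition translation_measure ::
  "('l \<Rightarrow> nat) \<Rightarrow> ('l \<times> nat) rel \<Rightarrow> (('l \<times> nat) set \<Rightarrow> 'a::euclidean_space) measure" where
  "translation_measure M R = PiM (map_indices M // R) (\<lambda>_. lborel)"

end

theory Submission
  imports Defs
begin

text \<open>The upper bound holds for every translation vector: a cylinder is mapped into an ellipsoid with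
  semi-axes proportional to the singular values, and cutting it into cubes of side \<open>\<sigma>\<^sub>m\<close> turns a
  cover of the tree into a cover of the fractal. For the lower bound, max-flow min-cut on the tree gives
  a Frostman measure with \<open>\<mu>[w] \<le> \<Phi>\<^sup>s(T\<^sub>w)\<close>. If \<open>x\<close> and \<open>y\<close> branch at \<open>w\<close>, the difference of the
  two points is \<open>T\<^sub>w\<close> applied to a map of the translation vector that is expanding in one of its
  coordinates, so \<open>|Z\<^sub>a(x) - Z\<^sub>a(y)| \<le> r\<close> has measure \<open>O(r\<^sup>t / \<Phi>\<^sup>t(T\<^sub>w))\<close>. Integrating
  this against \<open>\<mu> \<times> \<mu>\<close> for \<open>t < s\<close> makes the energies of all exponents below \<open>t\<close> finite
  for almost every \<open>a\<close>.\<close>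

section \<open>Singular value decomposition\<close>

text \<open>The three exponents \<open>t' < t < s\<close> serve two different sums. Going from
  \<open>s\<close> to \<open>t\<close> gains a factor that is geometric in the word length, so the
  sum over branching levels converges; going from \<open>t\<close> to \<open>t'\<close> makes the
  sum over dyadic scales converge. Transversality expands in one coordinate only, and which one
  depends on the pair of points. The other coordinates are therefore confined to balls and
  integrated out, with a constant common to all pairs; balls of growing radius then exhaust the
  translation vectors. The Frostman measure is realised as Lebesgue measure on an interval in which
  every word owns a subinterval of length equal to its flow, so no measure on infinite words has to
  be extended from cylinders. Both bounds use the singular value function only below the dimension
  of the space. There it is a product of powers of the singular values, with exponents in [0,1] that
  add up to the parameter. Larger parameters fall under the trivial bound for bounded sets.\<close>

lemma quadratic_form_maximizer_eigenvector:
  fixes S :: "'a::euclidean_space \<Rightarrow> 'a"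
  assumes lin: "linear S" and sym: "\<And>x y. S x \<bullet> y = x \<bullet> S y"
    and V: "subspace V" "S ` V \<subseteq> V" and x: "x \<in> V" "norm x = 1"
    and max: "\<And>y. y \<in> V \<Longrightarrow> norm y = 1 \<Longrightarrow> S y \<bullet> y \<le> S x \<bullet> x"
  shows "S x = (S x \<bullet> x) *\<^sub>R x"
proof -
  let ?l = "S x \<bullet> x"
  interpret linear S by (rule lin)
  have hom: "S y \<bullet> y \<le> ?l * (norm y)^2" if "y \<in> V" for y
  proof (cases "y = 0")
    case False
    let ?u = "y /\<^sub>R norm y"
    have "S ?u \<bullet> ?u \<le> ?l" using that False V(1) by (intro max) (auto simp: subspace_scale)
    then show ?thesis using False
      by (simp add: scaleR power2_eq_square field_simps)
  qed (simp add: zero)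
  define h where "h = S x - ?l *\<^sub>R x"
  have hV: "h \<in> V" unfolding h_def using V x by (intro subspace_diff subspace_scale) auto
  have hx: "h \<bullet> x = 0" using x(2) by (simp add: h_def inner_diff_left dot_square_norm)
  have "S x = h + ?l *\<^sub>R x" by (simp add: h_def)
  then have "S x \<bullet> h = h \<bullet> h" using hx by (metis (no_types) inner_add_left inner_commute inner_scaleR_left mult_zero_right add_0_right)
  \<comment> \<open>\<open>h\<close> is the part of \<open>S x\<close> orthogonal to
    \<open>x\<close>. Moving from \<open>x\<close> in direction \<open>h\<close> changes the form to
    first order in \<open>t\<close>, while the squared norm changes only to second order.\<close>
  have key: "2 * t * (h \<bullet> h) \<le> t^2 * (?l * (h \<bullet> h) - S h \<bullet> h)" for t
  proof -
    have "S (x + t *\<^sub>R h) \<bullet> (x + t *\<^sub>R h) \<le> ?l * (norm (x + t *\<^sub>R h))^2"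
      using hV x V(1) by (intro hom subspace_add subspace_scale)
    moreover have "(norm (x + t *\<^sub>R h))^2 = 1 + t^2 * (h \<bullet> h)"
      using x(2) hx unfolding power2_norm_eq_inner
      by (simp add: inner_add_left inner_add_right inner_commute power2_eq_square norm_eq_1)
    moreover have "S (x + t *\<^sub>R h) \<bullet> (x + t *\<^sub>R h) = ?l + 2 * t * (h \<bullet> h) + t^2 * (S h \<bullet> h)"
      using \<open>S x \<bullet> h = h \<bullet> h\<close> sym[of h x]
      by (simp add: add scaleR inner_add_left inner_add_right inner_commute power2_eq_square algebra_simps)
    ultimately show ?thesis by (simp add: algebra_simps)
  qed
  have "h \<bullet> h = 0"
  proof (rule ccontr)
    assume "h \<bullet> h \<noteq> 0"
    then have pos: "h \<bullet> h > 0" by simp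
    let ?c = "?l * (h \<bullet> h) - S h \<bullet> h"
    \<comment> \<open>Small enough that the quadratic term is at most half of the linear one; the 1
      keeps the denominator positive.\<close>
    define t where "t = (h \<bullet> h) / (\<bar>?c\<bar> + 1)"
    have t: "t > 0" using pos by (simp add: t_def)
    have "2 * (h \<bullet> h) \<le> t * ?c" using key[of t] t by (simp add: power2_eq_square)
    also have "\<dots> \<le> t * (\<bar>?c\<bar> + 1)" using t by (intro mult_left_mono) auto
    also have "\<dots> = h \<bullet> h" by (simp add: t_def)
    finally show False using pos by simp
  qed
  then show ?thesis by (simp add: h_def)
qed

text \<open>Relativising to an invariant subspace makes the induction on \<open>dim V\<close> work:
  a maximiser of the form on the unit sphere of \<open>V\<close> is an eigenvector, and symmetry of
  \<open>S\<close> keeps its orthogonal complement in \<open>V\<close> invariant.\<close>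

lemma spectral_theorem_subspace:
  fixes S :: "'a::euclidean_space \<Rightarrow> 'a"
  assumes lin: "linear S" and sym: "\<And>x y. S x \<bullet> y = x \<bullet> S y"
    and "subspace V" "S ` V \<subseteq> V"
  shows "\<exists>B ev. B \<subseteq> V \<and> pairwise orthogonal B \<and> (\<forall>b\<in>B. norm b = 1) \<and> span B = V \<and>
           (\<forall>b\<in>B. S b = ev b *\<^sub>R b)"
  using assms(3,4)
proof (induction "dim V" arbitrary: V rule: less_induct)
  case less
  show ?case
  proof (cases "V = {0}")
    case True
    then show ?thesis by (intro exI[of _ "{}"]) auto
  next
    case False
    then obtain v where v: "v \<in> V" "v \<noteq> 0"
      using less.prems(1) subspace_0 by blast
    have "v /\<^sub>R norm v \<in> V \<inter> sphere 0 1" using v less.prems(1) by (auto simp: subspace_scale)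
    then have ne: "V \<inter> sphere 0 1 \<noteq> {}" by blast
    have comp: "compact (V \<inter> sphere 0 1)"
      by (intro closed_Int_compact closed_subspace less.prems) auto
    have cont: "continuous_on (V \<inter> sphere 0 1) (\<lambda>x. S x \<bullet> x)"
      by (intro continuous_intros linear_continuous_on_compose[OF _ lin])
    then obtain x where x: "x \<in> V" "norm x = 1" and max: "\<And>y. y \<in> V \<Longrightarrow> norm y = 1 \<Longrightarrow> S y \<bullet> y \<le> S x \<bullet> x"
      using continuous_attains_sup[OF comp ne cont] by auto
    have ev: "S x = (S x \<bullet> x) *\<^sub>R x"
      by (rule quadratic_form_maximizer_eigenvector[OF lin sym less.prems x max])
    define W where "W = V \<inter> {y. x \<bullet> y = 0}"
    have W: "subspace W" 
      using less.prems(1) subspace_hyperplane[of x] by (simp add: W_def subspace_inter)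
    have "S ` W \<subseteq> W"
    proof safe
      fix y assume y: "y \<in> W"
      have "x \<bullet> S y = S x \<bullet> y" by (simp add: sym)
      also have "\<dots> = 0" using ev y by (metis (mono_tags) IntD2 W_def inner_scaleR_left mem_Collect_eq mult_zero_right)
      finally show "S y \<in> W" using y less.prems(2) by (auto simp: W_def)
    qed
    have "x \<notin> W" using x by (auto simp: W_def)
    moreover have "W \<subseteq> V" by (simp add: W_def)
    ultimately have "W \<subset> V" using x by blast
    then have "dim W < dim V"
      by (intro dim_psubset) (simp add: W less.prems(1) span_eq_iff[THEN iffD2])
    from less.hyps[OF this W \<open>S ` W \<subseteq> W\<close>] obtain B ev' where B: "B \<subseteq> W" "pairwise orthogonal B"
      "\<forall>b\<in>B. norm b = 1" "span B = W" "\<forall>b\<in>B. S b = ev' b *\<^sub>R b" by blast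
    have "x \<notin> B" using \<open>x \<notin> W\<close> B(1) by blast
    have 1: "span (insert x B) = V"
    proof
      show "span (insert x B) \<subseteq> V"
        using B(1) x(1) less.prems(1) by (intro span_minimal) (auto simp: W_def)
      show "V \<subseteq> span (insert x B)"
      proof
        fix v assume v: "v \<in> V"
        have "v - (x \<bullet> v) *\<^sub>R x \<in> W"
          using v x less.prems(1) by (auto simp: W_def subspace_diff subspace_scale inner_diff_right dot_square_norm)
        then have "v - (x \<bullet> v) *\<^sub>R x \<in> span B" using B(4) by simp
        then show "v \<in> span (insert x B)" by (auto simp: span_insert)
      qed
    qed
    have 2: "pairwise orthogonal (insert x B)"
      using B(1,2) by (auto simp: pairwise_insert orthogonal_def W_def inner_commute)
    have 3: "\<forall>b\<in>insert x B. S b = (if b = x then S x \<bullet> x else ev' b) *\<^sub>R b"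
      using ev B(5) \<open>x \<notin> B\<close> by auto
    show ?thesis
      using 1 2 3 B(1,3) x
      by (intro exI[of _ "insert x B"] exI[of _ "\<lambda>b. if b = x then S x \<bullet> x else ev' b"])
        (auto simp: W_def)
  qed
qed

text \<open>Indexed from 1 to the dimension, so that the i-th vector belongs to
  \<open>singular_value T i\<close>.\<close>

definition orthonormal_family :: "(nat \<Rightarrow> 'a::euclidean_space) \<Rightarrow> bool" where
  "orthonormal_family e \<longleftrightarrow>
     (\<forall>i\<in>{1..DIM('a)}. \<forall>j\<in>{1..DIM('a)}. e i \<bullet> e j = (if i = j then 1 else 0))"

lemma sorted_wrt_ge_concat_replicate:
  assumes "sorted_wrt (\<ge>) ms"
  shows "sorted_wrt (\<ge>) (concat (map (\<lambda>\<mu>. replicate (n \<mu>) (sqrt \<mu>)) ms))"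
  using assms
proof (induction ms)
  case (Cons \<mu> ms)
  have "sorted_wrt (\<ge>) (replicate (n \<mu>) (sqrt \<mu>))"
    by (auto simp: sorted_wrt_iff_nth_less)
  then show ?case using Cons by (auto simp: sorted_wrt_append)
qed simp

lemma adjoint_comp_self_symmetric:
  fixes T :: "'a::euclidean_space \<Rightarrow> 'a"
  assumes "linear T"
  shows "(adjoint T \<circ> T) x \<bullet> y = T x \<bullet> T y" "x \<bullet> (adjoint T \<circ> T) y = T x \<bullet> T y"
  using adjoint_works[OF assms, of y "T x"] adjoint_works[OF assms, of x "T y"]
  by (auto simp: inner_commute)

text \<open>\<open>singular_values\<close> counts dimensions of eigenspaces, so an orthonormal
  eigenbasis has to be listed in the matching order. The eigenspace of \<mu> is spanned by the basis
  vectors with eigenvalue \<mu>, hence \<open>sqrt\<close> \<mu> occurs once for each of them. The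
  images \<open>T (e i)\<close> stay unnormalised, which allows vanishing singular values.\<close>

theorem singular_value_decomposition:
  fixes T :: "'a::euclidean_space \<Rightarrow> 'a"
  assumes lin: "linear T"
  obtains e where "orthonormal_family e"
    "\<And>i j. i \<in> {1..DIM('a)} \<Longrightarrow> j \<in> {1..DIM('a)} \<Longrightarrow>
       T (e i) \<bullet> T (e j) = (if i = j then (singular_value T i)\<^sup>2 else 0)"
    "\<And>i. i \<in> {1..DIM('a)} \<Longrightarrow> 0 \<le> singular_value T i"
    "\<And>i j. 1 \<le> i \<Longrightarrow> i \<le> j \<Longrightarrow> j \<le> DIM('a) \<Longrightarrow> singular_value T j \<le> singular_value T i"
proof -
  define S where "S = adjoint T \<circ> T"
  have linS: "linear S" unfolding S_def by (intro linear_compose lin adjoint_linear)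
  have S1: "S x \<bullet> y = T x \<bullet> T y" for x y
    unfolding S_def by (rule adjoint_comp_self_symmetric[OF lin])
  have symS: "S x \<bullet> y = x \<bullet> S y" for x y
    by (simp only: S_def adjoint_comp_self_symmetric[OF lin])
  from spectral_theorem_subspace[OF linS symS subspace_UNIV subset_UNIV]
  obtain B ev where B: "pairwise orthogonal B" "\<And>b. b \<in> B \<Longrightarrow> norm b = 1" "span B = UNIV"
    "\<And>b. b \<in> B \<Longrightarrow> S b = ev b *\<^sub>R b" by blast
  have indep: "independent B" using B(1,2) by (intro pairwise_orthogonal_independent) force+
  have finB: "finite B" using indep by (rule finiteI_independent)
  have cardB: "card B = DIM('a)"
    using indep B(3) by (metis dim_UNIV dim_eq_card_independent dim_span)
  have evT: "ev b = T b \<bullet> T b" if "b \<in> B" for b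
    using S1[of b b] B(2,4)[OF that] by (simp add: dot_square_norm)
  have expand: "(\<Sum>b\<in>B. (x \<bullet> b) *\<^sub>R b) = x" for x
    using B(1,2,3) finB by (intro orthonormal_basis_expand) auto
  define Bm where "Bm \<mu> = {b\<in>B. ev b = \<mu>}" for \<mu>
  have eig: "eigenspace S \<mu> = span (Bm \<mu>)" for \<mu>
  proof
    show "eigenspace S \<mu> \<subseteq> span (Bm \<mu>)"
    proof
      fix x assume "x \<in> eigenspace S \<mu>"
      then have "S x = \<mu> *\<^sub>R x" by (simp add: eigenspace_def)
      \<comment> \<open>By symmetry of \<open>S\<close>, the coordinate along \<open>b\<close> is
        multiplied both by \<mu> and by \<open>ev b\<close>.\<close>
      have "x \<bullet> b = 0" if "b \<in> B" "ev b \<noteq> \<mu>" for b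
      proof -
        have "\<mu> * (x \<bullet> b) = ev b * (x \<bullet> b)"
          using symS[of x b] \<open>S x = \<mu> *\<^sub>R x\<close> B(4)[OF that(1)] by simp
        then show ?thesis using that by simp
      qed
      then have "(\<Sum>b\<in>B. (x \<bullet> b) *\<^sub>R b) \<in> span (Bm \<mu>)"
        by (intro span_sum) (metis (mono_tags, lifting) Bm_def mem_Collect_eq scale_zero_left span_base span_scale span_zero)
      then show "x \<in> span (Bm \<mu>)" by (simp add: expand)
    qed
    have "subspace (eigenspace S \<mu>)"
      using linS unfolding eigenspace_def
      by (auto simp: subspace_def linear_0 linear_add linear_scale scaleR_add_right)
    moreover have "Bm \<mu> \<subseteq> eigenspace S \<mu>" using B(4) by (auto simp: Bm_def eigenspace_def)
    ultimately show "span (Bm \<mu>) \<subseteq> eigenspace S \<mu>" by (intro span_minimal)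
  qed
  have dim_eig: "dim (eigenspace S \<mu>) = card (Bm \<mu>)" for \<mu>
  proof -
    have "independent (Bm \<mu>)" using indep by (rule independent_mono) (auto simp: Bm_def)
    then show ?thesis by (simp add: eig dim_eq_card_independent)
  qed
  have evs: "eigenvalues S = ev ` B"
  proof safe
    fix b assume "b \<in> B"
    then show "ev b \<in> eigenvalues S"
      using B(2)[of b] B(4)[of b] by (auto simp: eigenvalues_def eigenspace_def intro!: exI[of _ b])
  next
    fix \<mu> assume "\<mu> \<in> eigenvalues S"
    then obtain x where x: "x \<noteq> 0" "x \<in> span (Bm \<mu>)" by (auto simp: eigenvalues_def eig)
    then have "Bm \<mu> \<noteq> {}" by auto
    then show "\<mu> \<in> ev ` B" by (auto simp: Bm_def)
  qed
  define ms where "ms = rev (sorted_list_of_set (ev ` B))"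
  \<comment> \<open>An arbitrary enumeration of each eigenvalue block; concatenated by decreasing
    eigenvalue, the blocks list \<open>B\<close> in step with
    \<open>singular_values T\<close>.\<close>
  define bl where "bl \<mu> = (SOME xs. set xs = Bm \<mu> \<and> distinct xs)" for \<mu>
  have bl: "set (bl \<mu>) = Bm \<mu>" "distinct (bl \<mu>)" for \<mu>
    using someI_ex[OF finite_distinct_list[of "Bm \<mu>"]] finB by (auto simp: bl_def Bm_def)
  have lbl: "length (bl \<mu>) = card (Bm \<mu>)" for \<mu> using distinct_card[OF bl(2)[of \<mu>]] bl(1) by simp
  define L where "L = concat (map bl ms)"
  have sv: "singular_values T = map (\<lambda>b. sqrt (ev b)) L"
  proof -
    have "map (\<lambda>b. sqrt (ev b)) (bl \<mu>) = replicate (dim (eigenspace S \<mu>)) (sqrt \<mu>)" for \<mu>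
      unfolding dim_eig lbl[symmetric] using bl(1)[of \<mu>]
      by (intro replicate_eqI) (auto simp: Bm_def)
    then show ?thesis
      unfolding singular_values_def Let_def S_def[symmetric] evs ms_def[symmetric] L_def map_concat
      by (simp add: comp_def)
  qed
  have setL: "set L = B" using finB by (auto simp: L_def bl ms_def Bm_def)
  have distL: "distinct L"
    unfolding L_def
  proof (rule distinct_concat)
    have "distinct ms" by (simp add: ms_def)
    \<comment> \<open>Restricted to eigenvalues that occur: the blocks of all other numbers are
      empty and may coincide.\<close>
    moreover have "inj_on bl (set ms)"
    proof (rule inj_onI)
      fix x y assume "x \<in> set ms" "y \<in> set ms" "bl x = bl y"
      then have "Bm x = Bm y" "Bm x \<noteq> {}"
        using bl(1)[of x] bl(1)[of y] finB by (auto simp: ms_def Bm_def)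
      then show "x = y" by (auto simp: Bm_def)
    qed
    ultimately show "distinct (map bl ms)" by (simp add: distinct_map)
  qed (use bl in \<open>auto simp: Bm_def\<close>)
  have lenL: "length L = DIM('a)" using distinct_card[OF distL] setL cardB by simp
  define e where "e i = L ! (i - 1)" for i
  have eB: "e i \<in> B" if "i \<in> {1..DIM('a)}" for i
    using that lenL setL by (auto simp: e_def intro!: nth_mem)
  have svi: "singular_value T i = sqrt (ev (e i))" if "i \<in> {1..DIM('a)}" for i
    using that lenL by (auto simp: singular_value_def sv e_def)
  have evpos: "ev b \<ge> 0" if "b \<in> B" for b using evT[OF that] by simp
  have e_inj: "e i = e j \<longleftrightarrow> i = j" if "i \<in> {1..DIM('a)}" "j \<in> {1..DIM('a)}" for i j
    using that lenL distL by (auto simp: e_def nth_eq_iff_index_eq)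
  show ?thesis
  proof
    have orth: "e i \<bullet> e j = (if i = j then 1 else 0)"
      if "i \<in> {1..DIM('a)}" "j \<in> {1..DIM('a)}" for i j
      using eB[OF that(1)] eB[OF that(2)] e_inj[OF that] B(1,2)
      by (auto simp: pairwise_def orthogonal_def dot_square_norm)
    then show "orthonormal_family e" by (simp add: orthonormal_family_def)
    show "T (e i) \<bullet> T (e j) = (if i = j then (singular_value T i)\<^sup>2 else 0)"
      if "i \<in> {1..DIM('a)}" "j \<in> {1..DIM('a)}" for i j
      using S1[of "e i" "e j"] B(4)[OF eB[OF that(1)]] orth[OF that] svi[OF that(1)]
        evpos[OF eB[OF that(1)]] by auto
    show "0 \<le> singular_value T i" if "i \<in> {1..DIM('a)}" for i
      using svi[OF that] evpos[OF eB[OF that]] by simp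
    have "sorted_wrt (\<ge>) ms" by (simp add: ms_def sorted_wrt_rev)
    then have srt: "sorted_wrt (\<ge>) (singular_values T)"
      unfolding singular_values_def Let_def S_def[symmetric] evs ms_def[symmetric]
      by (rule sorted_wrt_ge_concat_replicate)
    show "singular_value T j \<le> singular_value T i" if "1 \<le> i" "i \<le> j" "j \<le> DIM('a)" for i j
    proof (cases "i = j")
      case False
      have len: "length (singular_values T) = DIM('a)" by (simp add: sv lenL)
      have "singular_values T ! (i - 1) \<ge> singular_values T ! (j - 1)"
        using that False len by (intro sorted_wrt_nth_less[OF srt]) auto
      then show ?thesis by (simp add: singular_value_def)
    qed simp
  qed
qed

section \<open>Coordinates in an orthonormal family\<close>

lemma orthonormal_family_inner:
  fixes e :: "nat \<Rightarrow> 'a::euclidean_space"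
  assumes "orthonormal_family e" "i \<in> {1..DIM('a)}" "j \<in> {1..DIM('a)}"
  shows "e i \<bullet> e j = (if i = j then 1 else 0)"
  using assms by (auto simp: orthonormal_family_def)

lemma orthonormal_family_expand:
  fixes e :: "nat \<Rightarrow> 'a::euclidean_space"
  assumes e: "orthonormal_family e"
  shows "(\<Sum>i=1..DIM('a). (x \<bullet> e i) *\<^sub>R e i) = x"
proof -
  have inj: "inj_on e {1..DIM('a)}"
  proof (rule inj_onI)
    fix i j assume ij: "i \<in> {1..DIM('a)}" "j \<in> {1..DIM('a)}" and eq: "e i = e j"
    show "i = j"
      using orthonormal_family_inner[OF e ij] orthonormal_family_inner[OF e ij(1) ij(1)] eq
      by (auto split: if_splits)
  qed
  let ?B = "e ` {1..DIM('a)}"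
  have orth: "pairwise orthogonal ?B"
    using orthonormal_family_inner[OF e] by (force simp: pairwise_def orthogonal_def)
  have norm: "norm b = 1" if "b \<in> ?B" for b
    using that orthonormal_family_inner[OF e] by (auto simp: norm_eq_1)
  have indep: "independent ?B" using orth norm by (intro pairwise_orthogonal_independent) force+
  have "card ?B = DIM('a)" using inj by (simp add: card_image)
  then have "span ?B = UNIV"
    using indep by (metis card_eq_dim dim_UNIV finite_imageI finite_atLeastAtMost le_refl subset_UNIV top.extremum_unique)
  then have "(\<Sum>b\<in>?B. (x \<bullet> b) *\<^sub>R b) = x"
    using orth norm by (intro orthonormal_basis_expand) auto
  then show ?thesis unfolding sum.reindex[OF inj] by (simp add: comp_def)
qed

lemma orthonormal_family_norm_sq:
  fixes e :: "nat \<Rightarrow> 'a::euclidean_space"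
  assumes e: "orthonormal_family e"
  shows "(norm x)\<^sup>2 = (\<Sum>i=1..DIM('a). (x \<bullet> e i)\<^sup>2)"
proof -
  have "(norm x)\<^sup>2 = x \<bullet> (\<Sum>i=1..DIM('a). (x \<bullet> e i) *\<^sub>R e i)"
    by (simp only: orthonormal_family_expand[OF e] power2_norm_eq_inner)
  also have "\<dots> = (\<Sum>i=1..DIM('a). (x \<bullet> e i)\<^sup>2)" by (simp add: inner_sum_right power2_eq_square)
  finally show ?thesis .
qed

lemma orthonormal_family_exists:
  obtains e :: "nat \<Rightarrow> 'a::euclidean_space" where "orthonormal_family e"
  by (rule singular_value_decomposition[OF linear_id])

section \<open>Covering boxes by cubes\<close>

text \<open>The axes are free so that boxes can be aligned with the singular directions of a map;
  \<open>p\<close> holds the coordinates of the centre and \<open>s\<close> the half-sides.\<close>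

definition basis_box :: "(nat \<Rightarrow> 'a::euclidean_space) \<Rightarrow> (nat \<Rightarrow> real) \<Rightarrow> (nat \<Rightarrow> real) \<Rightarrow> 'a set" where
  "basis_box e p s = {y. \<forall>i\<in>{1..DIM('a)}. \<bar>y \<bullet> e i - p i\<bar> \<le> s i}"

lemma dist_le_orthonormal_family:
  fixes e :: "nat \<Rightarrow> 'a::euclidean_space"
  assumes e: "orthonormal_family e" and "0 \<le> \<epsilon>"
    and "\<And>i. i \<in> {1..DIM('a)} \<Longrightarrow> \<bar>x \<bullet> e i - y \<bullet> e i\<bar> \<le> \<epsilon>"
  shows "dist x y \<le> sqrt (real DIM('a)) * \<epsilon>"
proof -
  have "(norm (x - y))\<^sup>2 = (\<Sum>i=1..DIM('a). ((x - y) \<bullet> e i)\<^sup>2)"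
    by (rule orthonormal_family_norm_sq[OF e])
  also have "\<dots> \<le> (\<Sum>i=1..DIM('a). \<epsilon>\<^sup>2)"
    using assms(2,3) by (intro sum_mono abs_le_square_iff[THEN iffD1]) (simp add: inner_diff_left)
  also have "\<dots> = (sqrt (real DIM('a)) * \<epsilon>)\<^sup>2" by (simp add: power_mult_distrib)
  finally have "(norm (x - y))\<^sup>2 \<le> (sqrt (real DIM('a)) * \<epsilon>)\<^sup>2" .
  moreover have "0 \<le> sqrt (real DIM('a)) * \<epsilon>" using assms(2) by (intro mult_nonneg_nonneg) auto
  ultimately show ?thesis unfolding dist_norm by (rule power2_le_imp_le)
qed

text \<open>A grid of cubes of side \<epsilon>: an axis needs at most 2 \<open>s i\<close> /
  \<epsilon> + 1 of them, and \<epsilon> \<le> \<open>s i\<close> absorbs the 1 into the factor 3.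
  Sizes are bounded through distances of pairs, which yields boundedness as well as a bound on
  \<open>diameter\<close>.\<close>

lemma basis_box_cover:
  fixes e :: "nat \<Rightarrow> 'a::euclidean_space"
  assumes e: "orthonormal_family e" and \<epsilon>: "0 < \<epsilon>"
    and s: "\<And>i. i \<in> {1..DIM('a)} \<Longrightarrow> \<epsilon> \<le> s i"
  obtains \<U> where "finite \<U>" "real (card \<U>) \<le> (\<Prod>i=1..DIM('a). 3 * s i / \<epsilon>)"
    "basis_box e p s \<subseteq> \<Union>\<U>"
    "\<forall>U\<in>\<U>. \<forall>x\<in>U. \<forall>y\<in>U. dist x y \<le> sqrt (real DIM('a)) * \<epsilon>"
proof -
  \<comment> \<open>The 1 is there because the grid index can equal the floor itself, near the far
    face.\<close>
  define n where "n i = nat \<lfloor>2 * s i / \<epsilon>\<rfloor> + 1" for i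
  define Q where "Q k = {y. \<forall>i\<in>{1..DIM('a)}. p i - s i + real (k i) * \<epsilon> \<le> y \<bullet> e i \<and>
                           y \<bullet> e i \<le> p i - s i + (real (k i) + 1) * \<epsilon>}" for k :: "nat \<Rightarrow> nat"
  define K where "K = PiE {1..DIM('a)} (\<lambda>i. {..<n i})"
  have finK: "finite K" unfolding K_def by (intro finite_PiE) auto
  have n_le: "real (n i) \<le> 3 * s i / \<epsilon>" if "i \<in> {1..DIM('a)}" for i
  proof -
    have "1 \<le> s i / \<epsilon>" using s[OF that] \<epsilon> by simp
    moreover have "real (nat \<lfloor>2 * s i / \<epsilon>\<rfloor>) \<le> 2 * s i / \<epsilon>"
      using \<open>1 \<le> s i / \<epsilon>\<close> by (intro of_nat_floor) auto
    moreover have "2 * s i / \<epsilon> = 2 * (s i / \<epsilon>)" "3 * s i / \<epsilon> = 3 * (s i / \<epsilon>)" by simp_all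
    ultimately show ?thesis unfolding n_def of_nat_add of_nat_1 by linarith
  qed
  show ?thesis
  proof
    show "finite (Q ` K)" using finK by simp
    have "card (Q ` K) \<le> card K" by (intro card_image_le finK)
    also have "card K = (\<Prod>i=1..DIM('a). n i)" by (simp add: K_def card_PiE)
    finally have "real (card (Q ` K)) \<le> (\<Prod>i=1..DIM('a). real (n i))"
      by (metis of_nat_le_iff of_nat_prod)
    also have "\<dots> \<le> (\<Prod>i=1..DIM('a). 3 * s i / \<epsilon>)" by (intro prod_mono) (use n_le in auto)
    finally show "real (card (Q ` K)) \<le> (\<Prod>i=1..DIM('a). 3 * s i / \<epsilon>)" .
    show "basis_box e p s \<subseteq> \<Union>(Q ` K)"
    proof
      fix y assume y: "y \<in> basis_box e p s"
      define k where "k = restrict (\<lambda>i. nat \<lfloor>(y \<bullet> e i - (p i - s i)) / \<epsilon>\<rfloor>) {1..DIM('a)}"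
      have "k \<in> K"
        unfolding K_def
      proof (rule PiE_I)
        fix i assume i: "i \<in> {1..DIM('a)}"
        have "y \<bullet> e i - (p i - s i) \<le> 2 * s i" using y i by (auto simp: basis_box_def abs_le_iff)
        then have "\<lfloor>(y \<bullet> e i - (p i - s i)) / \<epsilon>\<rfloor> \<le> \<lfloor>2 * s i / \<epsilon>\<rfloor>"
          using \<epsilon> by (intro floor_mono divide_right_mono) auto
        then show "k i \<in> {..<n i}" using i by (simp add: k_def n_def le_imp_less_Suc nat_mono)
      qed (auto simp: k_def restrict_def)
      moreover have "y \<in> Q k"
      proof -
        have "p i - s i + real (k i) * \<epsilon> \<le> y \<bullet> e i \<and> y \<bullet> e i \<le> p i - s i + (real (k i) + 1) * \<epsilon>"
          if i: "i \<in> {1..DIM('a)}" for i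
        proof -
          let ?z = "(y \<bullet> e i - (p i - s i)) / \<epsilon>"
          have z: "0 \<le> ?z" using y i \<epsilon> by (auto simp: basis_box_def abs_le_iff field_simps)
          then have "real (k i) = of_int \<lfloor>?z\<rfloor>" using i by (simp add: k_def)
          then have "real (k i) \<le> ?z" "?z \<le> real (k i) + 1" by linarith+
          then show ?thesis using \<epsilon> by (simp add: field_simps)
        qed
        then show ?thesis by (auto simp: Q_def)
      qed
      ultimately show "y \<in> \<Union>(Q ` K)" by blast
    qed
    show "\<forall>U\<in>Q ` K. \<forall>x\<in>U. \<forall>y\<in>U. dist x y \<le> sqrt (real DIM('a)) * \<epsilon>"
    proof (intro ballI)
      fix U x y assume "U \<in> Q ` K" and xy: "x \<in> U" "y \<in> U"
      then obtain k where "U = Q k" by blast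
      have "\<bar>x \<bullet> e i - y \<bullet> e i\<bar> \<le> \<epsilon>" if i: "i \<in> {1..DIM('a)}" for i
      proof -
        have "p i - s i + real (k i) * \<epsilon> \<le> z \<bullet> e i \<and> z \<bullet> e i \<le> p i - s i + real (k i) * \<epsilon> + \<epsilon>"
          if "z \<in> U" for z
          using that i unfolding \<open>U = Q k\<close> Q_def by (auto simp: distrib_right add.assoc)
        from this[OF xy(1)] this[OF xy(2)] show ?thesis by linarith
      qed
      then show "dist x y \<le> sqrt (real DIM('a)) * \<epsilon>"
        using \<epsilon> by (intro dist_le_orthonormal_family[OF e]) auto
    qed
  qed
qed

section \<open>Hausdorff dimension\<close>

lemma diam_powr_le:
  assumes "bounded U" "diameter U \<le> b" "0 < b" "0 \<le> s"
  shows "diam_powr s U \<le> ennreal (b powr s)"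
  using assms diameter_ge_0[OF assms(1)]
  by (auto simp: diam_powr_def intro!: ennreal_leI powr_mono2)

lemma hausdorff_premeasure_le_countable:
  fixes U :: "'i::countable \<Rightarrow> 'a::metric_space set"
  assumes E: "E \<subseteq> \<Union>(range U)" and U: "\<And>i. bounded (U i)" "\<And>i. diameter (U i) \<le> \<delta>" and "0 \<le> \<delta>"
  shows "hausdorff_premeasure s \<delta> E \<le> (\<integral>\<^sup>+i. diam_powr s (U i) \<partial>count_space UNIV)"
proof -
  define V where "V n = (if n \<in> range (to_nat :: 'i \<Rightarrow> nat) then U (from_nat n) else {})" for n
  have V: "V (to_nat i) = U i" for i by (simp add: V_def)
  have "hausdorff_premeasure s \<delta> E \<le> (\<Sum>n. diam_powr s (V n))"
    unfolding hausdorff_premeasure_def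
  proof (intro Inf_lower CollectI exI[of _ V] conjI refl allI)
    show "E \<subseteq> \<Union>(range V)"
    proof
      fix x assume "x \<in> E"
      then obtain i where "x \<in> U i" using E by blast
      then have "x \<in> V (to_nat i)" by (simp add: V)
      then show "x \<in> \<Union>(range V)" by blast
    qed
    show "bounded (V n)" "diameter (V n) \<le> \<delta>" for n
      using U \<open>0 \<le> \<delta>\<close> by (auto simp: V_def)
  qed
  also have "(\<Sum>n. diam_powr s (V n)) = (\<integral>\<^sup>+n. diam_powr s (V n) \<partial>count_space UNIV)"
    by (simp add: nn_integral_count_space_nat)
  also have "\<dots> = (\<integral>\<^sup>+n. diam_powr s (V n) \<partial>count_space (range (to_nat :: 'i \<Rightarrow> nat)))"
    by (rule nn_integral_count_space_eq) (auto simp: V_def diam_powr_def)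
  also have "\<dots> = (\<integral>\<^sup>+i. diam_powr s (V (to_nat i)) \<partial>count_space (UNIV :: 'i set))"
    by (rule nn_integral_bij_count_space[symmetric]) (simp add: inj_on_imp_bij_betw)
  finally show ?thesis by (simp add: V)
qed

text \<open>Each word may contribute a finite family, enumerated by pairs. Positivity of
  \<open>b w\<close> matters for \<open>s = 0\<close>, where a nonempty set counts as 1 but
  \<open>0 powr 0\<close> is 0.\<close>

lemma hausdorff_premeasure_le_cover:
  fixes J :: "'i::countable set" and F :: "'i \<Rightarrow> 'a::metric_space set set"
  assumes E: "E \<subseteq> (\<Union>w\<in>J. \<Union>(F w))"
    and fin: "\<And>w. w \<in> J \<Longrightarrow> finite (F w)" and card: "\<And>w. w \<in> J \<Longrightarrow> real (card (F w)) \<le> N w"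
    and diam: "\<And>w U x y. w \<in> J \<Longrightarrow> U \<in> F w \<Longrightarrow> x \<in> U \<Longrightarrow> y \<in> U \<Longrightarrow> dist x y \<le> b w"
    and b: "\<And>w. w \<in> J \<Longrightarrow> 0 < b w" "\<And>w. w \<in> J \<Longrightarrow> b w \<le> \<delta>" and "0 \<le> \<delta>" "0 \<le> s"
  shows "hausdorff_premeasure s \<delta> E \<le> (\<integral>\<^sup>+w. ennreal (N w * b w powr s) \<partial>count_space J)"
proof -
  define h where "h w = (SOME h. bij_betw h {0..<card (F w)} (F w))" for w
  have h: "bij_betw (h w) {0..<card (F w)} (F w)" if "w \<in> J" for w
    unfolding h_def using ex_bij_betw_nat_finite[OF fin[OF that]] by (rule someI_ex)
  define U where "U = (\<lambda>(w, n). if w \<in> J \<and> n < card (F w) then h w n else {})"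
  have UF: "h w n \<in> F w" if "w \<in> J" "n < card (F w)" for w n
    using h[OF that(1)] that(2) by (auto simp: bij_betw_def)
  have bd: "bounded A \<and> diameter A \<le> b w" if "w \<in> J" "A \<in> F w" for A w
  proof
    show "bounded A"
    proof (cases "A = {}")
      case False
      then obtain x where "x \<in> A" by blast
      then show ?thesis using diam[OF that] by (auto simp: bounded_def)
    qed simp
    show "diameter A \<le> b w"
      using diam[OF that] b(1)[OF that(1)] unfolding diameter_def by (auto intro!: cSUP_least)
  qed
  have "hausdorff_premeasure s \<delta> E \<le> (\<integral>\<^sup>+i. diam_powr s (U i) \<partial>count_space UNIV)"
  proof (rule hausdorff_premeasure_le_countable)
    show "E \<subseteq> \<Union>(range U)"
    proof
      fix x assume "x \<in> E"
      then obtain w A where "w \<in> J" "A \<in> F w" "x \<in> A" using E by blast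
      moreover have "A \<in> h w ` {0..<card (F w)}"
        using h[OF \<open>w \<in> J\<close>] \<open>A \<in> F w\<close> by (simp add: bij_betw_def)
      then obtain n where "n < card (F w)" "A = h w n" by auto
      ultimately have "x \<in> U (w, n)" by (simp add: U_def)
      then show "x \<in> \<Union>(range U)" by blast
    qed
    show "bounded (U i)" "diameter (U i) \<le> \<delta>" for i
      using bd[OF _ UF] b(2) \<open>0 \<le> \<delta>\<close> by (auto simp: U_def split: prod.split intro: order_trans)
  qed fact
  also have "\<dots> = (\<integral>\<^sup>+w. \<integral>\<^sup>+n. diam_powr s (U (w, n)) \<partial>count_space UNIV \<partial>count_space UNIV)"
    by (rule nn_integral_fst_count_space[symmetric])
  also have "\<dots> \<le> (\<integral>\<^sup>+w. ennreal (N w * b w powr s) * indicator J w \<partial>count_space UNIV)"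
  proof (rule nn_integral_mono)
    fix w
    show "(\<integral>\<^sup>+n. diam_powr s (U (w, n)) \<partial>count_space UNIV) \<le> ennreal (N w * b w powr s) * indicator J w"
    proof (cases "w \<in> J")
      case True
      have "(\<integral>\<^sup>+n. diam_powr s (U (w, n)) \<partial>count_space UNIV) = (\<Sum>n<card (F w). diam_powr s (U (w, n)))"
        by (rule nn_integral_count_space') (auto simp: U_def diam_powr_def)
      also have "\<dots> \<le> (\<Sum>n<card (F w). ennreal (b w powr s))"
        using bd[OF True UF[OF True]] b(1)[OF True] \<open>0 \<le> s\<close> True
        by (intro sum_mono diam_powr_le) (auto simp: U_def)
      also have "\<dots> = ennreal (real (card (F w)) * b w powr s)"
        by (simp add: ennreal_mult ennreal_of_nat_eq_real_of_nat)
      also have "\<dots> \<le> ennreal (N w * b w powr s)"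
        using card[OF True] by (intro ennreal_leI mult_right_mono) auto
      finally show ?thesis using True by simp
    next
      case False
      then show ?thesis by (simp add: U_def diam_powr_def)
    qed
  qed
  also have "\<dots> = (\<integral>\<^sup>+w. ennreal (N w * b w powr s) \<partial>count_space J)"
    by (simp add: nn_integral_restrict_space[symmetric] restrict_count_space)
  finally show ?thesis .
qed

section \<open>Dimension bounds from measures and energies\<close>

lemma hausdorff_dim_le:
  assumes "hausdorff_measure s E = 0" "0 \<le> s"
  shows "hausdorff_dim E \<le> ereal s"
  unfolding hausdorff_dim_def using assms by (intro Inf_lower) auto

lemma hausdorff_dim_nonneg: "0 \<le> hausdorff_dim E"
  unfolding hausdorff_dim_def by (intro Inf_greatest) auto

lemma hausdorff_measure_eq_0I:
  assumes "\<And>\<delta>. 0 < \<delta> \<Longrightarrow> hausdorff_premeasure s \<delta> E = 0"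
  shows "hausdorff_measure s E = 0"
  unfolding hausdorff_measure_def using assms by simp

lemma (in sigma_finite_measure) hausdorff_dim_ge_energy:
  fixes g :: "'a \<Rightarrow> 'b::euclidean_space"
  assumes g [measurable]: "g \<in> borel_measurable M" and A: "g ` space M \<subseteq> A" and t: "0 < t"
    and pos: "emeasure M (space M) > 0"
    and fin: "(\<integral>\<^sup>+u. (\<Sum>k. ennreal (2 powr (real k * t)) *
                 emeasure M {v\<in>space M. dist (g u) (g v) \<le> (1/2)^k}) \<partial>M) < \<infinity>"
  shows "ereal t \<le> hausdorff_dim A"
proof -
  define \<phi> where "\<phi> u = (\<Sum>k. ennreal (2 powr (real k * t)) *
                 emeasure M {v\<in>space M. dist (g u) (g v) \<le> (1/2)^k})" for u
  have meas1: "(\<lambda>u. emeasure M {v\<in>space M. dist (g u) (g v) \<le> r}) \<in> borel_measurable M" for r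
  proof -
    let ?Q = "{x \<in> space (M \<Otimes>\<^sub>M M). dist (g (fst x)) (g (snd x)) \<le> r}"
    have "?Q \<in> sets (M \<Otimes>\<^sub>M M)" by measurable
    from measurable_emeasure_Pair[OF this]
    show ?thesis
      by (rule measurable_cong[THEN iffD1, rotated])
         (auto simp: space_pair_measure intro!: arg_cong[where f="emeasure M"])
  qed
  have \<phi> [measurable]: "\<phi> \<in> borel_measurable M"
    unfolding \<phi>_def[abs_def] using meas1[measurable] by measurable
  have "AE u in M. \<phi> u \<noteq> \<infinity>"
    using fin unfolding \<phi>_def[symmetric] by (intro nn_integral_PInf_AE \<phi>) auto
  \<comment> \<open>If all sublevel sets were null, \<phi> would be infinite almost everywhere on a
    space of positive mass.\<close>
  have "\<exists>n::nat. emeasure M {u\<in>space M. \<phi> u \<le> of_nat n} > 0"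
  proof (rule ccontr)
    assume "\<not> ?thesis"
    then have null: "{u\<in>space M. \<phi> u \<le> of_nat n} \<in> null_sets M" for n :: nat
      by (intro null_setsI) (auto simp: not_less)
    have "AE u in M. \<not> \<phi> u \<le> of_nat n" for n :: nat
      by (rule AE_I'[OF null[of n]]) auto
    then have "AE u in M. \<forall>n::nat. \<not> \<phi> u \<le> of_nat n"
      unfolding AE_all_countable by blast
    then have "AE u in M. False"
      using \<open>AE u in M. \<phi> u \<noteq> \<infinity>\<close>
    proof eventually_elim
      case (elim u)
      then obtain n where "\<phi> u < of_nat n" using ennreal_Ex_less_of_nat[of "\<phi> u"] by (auto simp: less_top)
      then show ?case using elim by (meson less_imp_le)
    qed
    then have "emeasure M (space M) = 0"
      using AE_iff_measurable[of "space M" M "\<lambda>_. False"] by simp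
    then show False using pos by simp
  qed
  then obtain n0 :: nat where n0: "emeasure M {u\<in>space M. \<phi> u \<le> of_nat n0} > 0" by blast
  define F where "F = {u\<in>space M. \<phi> u \<le> of_nat n0}"
  have F [measurable]: "F \<in> sets M" unfolding F_def by measurable
  have ball: "emeasure M {v\<in>space M. dist (g u) (g v) \<le> (1/2)^k} \<le> ennreal (n0 * 2 powr (- real k * t))"
    if "u \<in> F" for u k
  proof -
    let ?m = "emeasure M {v\<in>space M. dist (g u) (g v) \<le> (1/2)^k}"
    have "ennreal (2 powr (real k * t)) * ?m \<le> \<phi> u"
      using sum_le_suminf[of "\<lambda>k. ennreal (2 powr (real k * t)) *
                 emeasure M {v\<in>space M. dist (g u) (g v) \<le> (1/2)^k}" "{k}"]
      by (simp add: \<phi>_def)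
    also have "\<dots> \<le> of_nat n0" using that by (simp add: F_def)
    finally have "ennreal (2 powr (real k * t)) * ?m \<le> ennreal n0" by (simp add: ennreal_of_nat_eq_real_of_nat)
    then have "ennreal (2 powr (- real k * t)) * (ennreal (2 powr (real k * t)) * ?m)
        \<le> ennreal (2 powr (- real k * t)) * ennreal n0" by (rule mult_left_mono) simp
    moreover have "ennreal (2 powr (- real k * t)) * (ennreal (2 powr (real k * t)) * ?m) = ?m"
      by (simp add: mult.assoc[symmetric] ennreal_mult[symmetric] powr_add[symmetric])
    ultimately show ?thesis by (simp add: ennreal_mult[symmetric] mult.commute)
  qed
  \<comment> \<open>\<open>2 powr t\<close> pays for enlarging a diameter to a dyadic radius;
    \<open>n0 + 1\<close> keeps \<open>C\<close> positive.\<close>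
  define C where "C = (n0 + 1) * 2 powr t"
  have C: "C > 0" by (simp add: C_def)
  have cov: "\<exists>B\<in>sets M. {u\<in>F. g u \<in> U} \<subseteq> B \<and> emeasure M B \<le> ennreal C * diam_powr s U"
    if U: "bounded U" "diameter U \<le> 1" and s: "0 \<le> s" "s \<le> t" for U s
  proof (cases "\<exists>u\<in>F. g u \<in> U")
    case False
    then show ?thesis by (intro bexI[of _ "{}"]) auto
  next
    case True
    then obtain u where u: "u \<in> F" "g u \<in> U" by blast
    let ?d = "diameter U"
    let ?B = "{v\<in>space M. dist (g u) (g v) \<le> ?d}"
    have "?d \<ge> 0" using U(1) by (rule diameter_ge_0)
    have sub: "{u\<in>F. g u \<in> U} \<subseteq> ?B"
      using diameter_bounded_bound[OF U(1) u(2)] by (auto simp: F_def)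
    have "emeasure M ?B \<le> ennreal (C * ?d powr t)"
    proof (cases "?d = 0")
      \<comment> \<open>No dyadic radius is comparable to 0; instead the masses of the dyadic balls
        around the point tend to 0.\<close>
      case True
      have le: "emeasure M ?B \<le> ennreal (n0 * (2 powr - t) ^ k)" for k
      proof -
        have "emeasure M ?B \<le> emeasure M {v\<in>space M. dist (g u) (g v) \<le> (1/2)^k}"
        proof (rule emeasure_mono)
          show "?B \<subseteq> {v\<in>space M. dist (g u) (g v) \<le> (1/2)^k}" using True by auto
        qed measurable
        also have "\<dots> \<le> ennreal (n0 * 2 powr (- real k * t))" by (rule ball[OF u(1)])
        also have "2 powr (- real k * t) = (2 powr - t) ^ k" by (simp add: powr_power mult.commute)
        finally show ?thesis .
      qed
      have "(\<lambda>k. n0 * (2 powr - t) ^ k) \<longlonglongrightarrow> real n0 * 0"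
        using t by (intro tendsto_intros LIMSEQ_realpow_zero) (auto simp: powr_less_one)
      then have "(\<lambda>k. ennreal (n0 * (2 powr - t) ^ k)) \<longlonglongrightarrow> ennreal 0"
        by (intro tendsto_ennrealI) simp
      then have "emeasure M ?B \<le> ennreal 0"
        by (rule tendsto_lowerbound) (use le in auto)
      then show ?thesis by simp
    next
      case False
      then have d: "0 < ?d" using \<open>?d \<ge> 0\<close> by simp
      obtain k where k: "(1/2)^(Suc k) < ?d" "?d \<le> (1/2)^k"
      proof -
        define k where "k = (LEAST k. (1/2)^(Suc k) < ?d)"
        have ex: "\<exists>k. (1/2)^(Suc k) < ?d"
        proof -
          obtain k where "(1/2)^k < ?d" using real_arch_pow_inv[OF d, of "1/2"] by auto
          then have "(1/2)^(Suc k) < ?d" by (rule le_less_trans[rotated]) simp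
          then show ?thesis ..
        qed
        then have 1: "(1/2)^(Suc k) < ?d" unfolding k_def by (rule LeastI_ex)
        have 2: "?d \<le> (1/2)^k"
        proof (cases k)
          case (Suc j)
          have "\<not> (1/2)^(Suc j) < ?d" using not_less_Least[of j "\<lambda>k. (1/2)^(Suc k) < ?d"] Suc by (simp add: k_def)
          then show ?thesis using Suc by simp
        qed (use U in simp)
        show ?thesis using that 1 2 by blast
      qed
      have "emeasure M ?B \<le> emeasure M {v\<in>space M. dist (g u) (g v) \<le> (1/2)^k}"
      proof (rule emeasure_mono)
        show "?B \<subseteq> {v\<in>space M. dist (g u) (g v) \<le> (1/2)^k}" using k by auto
      qed measurable
      also have "\<dots> \<le> ennreal (n0 * 2 powr (- real k * t))" by (rule ball[OF u(1)])
      also have "\<dots> \<le> ennreal (C * ?d powr t)"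
      proof (rule ennreal_leI)
        have "(1/2::real)^k = 2 powr (- real k)"
          by (simp add: powr_minus powr_realpow power_one_over inverse_eq_divide)
        then have "2 powr (- real k * t) = ((1/2)^k) powr t" by (simp add: powr_powr)
        also have "\<dots> = 2 powr t * ((1/2)^(Suc k)) powr t"
          by (simp add: powr_mult[symmetric])
        also have "\<dots> \<le> 2 powr t * ?d powr t"
          using k t by (intro mult_left_mono powr_mono2) auto
        finally have "n0 * 2 powr (- real k * t) \<le> n0 * (2 powr t * ?d powr t)"
          by (intro mult_left_mono) auto
        also have "\<dots> \<le> C * ?d powr t" by (simp add: C_def algebra_simps)
        finally show "n0 * 2 powr (- real k * t) \<le> C * ?d powr t" .
      qed
      finally show ?thesis .
    qed
    also have "\<dots> = ennreal C * ennreal (?d powr t)" using C by (simp add: ennreal_mult)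
    also have "\<dots> \<le> ennreal C * diam_powr s U"
    proof (rule mult_left_mono)
      show "ennreal (?d powr t) \<le> diam_powr s U"
      proof (cases "s = 0")
        case True
        have "?d powr t \<le> 1 powr t" using \<open>?d \<ge> 0\<close> U t by (intro powr_mono2) auto
        then show ?thesis using True u by (auto simp: diam_powr_def ennreal_le_1)
      next
        case False
        then show ?thesis using u \<open>?d \<ge> 0\<close> U s
          by (auto simp: diam_powr_def intro!: ennreal_leI powr_mono')
      qed
    qed simp
    finally have "emeasure M ?B \<le> ennreal C * diam_powr s U" .
    moreover have "?B \<in> sets M" by measurable
    ultimately show ?thesis using sub by blast
  qed
  have "t \<le> s" if s: "0 \<le> s" "hausdorff_measure s A = 0" for s
  proof (rule ccontr)
    assume "\<not> t \<le> s"
    then have st: "s \<le> t" by simp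
    \<comment> \<open>Scale 1 suffices, since the premeasure at any scale is a lower bound for the
      measure.\<close>
    have "emeasure M F * ennreal (1 / C) \<le> hausdorff_premeasure s 1 A"
      unfolding hausdorff_premeasure_def
    proof (rule Inf_greatest, clarify)
      fix U :: "nat \<Rightarrow> 'b set"
      assume AU: "A \<subseteq> \<Union>(range U)" and U: "\<forall>n. bounded (U n) \<and> diameter (U n) \<le> 1"
      have "\<forall>n. \<exists>B\<in>sets M. {u\<in>F. g u \<in> U n} \<subseteq> B \<and> emeasure M B \<le> ennreal C * diam_powr s (U n)"
        using cov U s st by blast
      then obtain B where B: "\<And>n. B n \<in> sets M" "\<And>n. {u\<in>F. g u \<in> U n} \<subseteq> B n"
        "\<And>n. emeasure M (B n) \<le> ennreal C * diam_powr s (U n)" by metis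
      have "F \<subseteq> (\<Union>n. B n)"
      proof
        fix u assume "u \<in> F"
        then have "g u \<in> A" using A by (auto simp: F_def)
        then obtain n where "g u \<in> U n" using AU by blast
        then show "u \<in> (\<Union>n. B n)" using B(2)[of n] \<open>u \<in> F\<close> by blast
      qed
      then have "emeasure M F \<le> emeasure M (\<Union>n. B n)" using B(1) by (intro emeasure_mono) auto
      also have "\<dots> \<le> (\<Sum>n. emeasure M (B n))" using B(1) by (intro emeasure_subadditive_countably) auto
      also have "\<dots> \<le> (\<Sum>n. ennreal C * diam_powr s (U n))" by (intro suminf_le B(3)) auto
      also have "\<dots> = ennreal C * (\<Sum>n. diam_powr s (U n))" by simp
      finally have "emeasure M F * ennreal (1 / C) \<le> ennreal C * (\<Sum>n. diam_powr s (U n)) * ennreal (1 / C)"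
        by (rule mult_right_mono) simp
      also have "\<dots> = (ennreal C * ennreal (1 / C)) * (\<Sum>n. diam_powr s (U n))" by (simp add: ac_simps)
      also have "ennreal C * ennreal (1 / C) = 1" using C by (simp add: ennreal_mult[symmetric])
      finally show "emeasure M F * ennreal (1 / C) \<le> (\<Sum>n. diam_powr s (U n))" by simp
    qed
    also have "\<dots> \<le> hausdorff_measure s A"
      unfolding hausdorff_measure_def by (intro SUP_upper) auto
    finally have "emeasure M F * ennreal (1 / C) = 0" using s by simp
    then show False using n0 C by (auto simp: F_def)
  qed
  then show ?thesis unfolding hausdorff_dim_def by (intro Inf_greatest) auto
qed

section \<open>Points of code tree fractals\<close>

lemma prefix_word_0 [simp]: "prefix_word x 0 = []"
  and prefix_word_Suc: "prefix_word x (Suc k) = prefix_word x k @ [x k]"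
  and length_prefix_word [simp]: "length (prefix_word x k) = k"
  by (simp_all add: prefix_word_def)

lemma prefix_word_add: "prefix_word x (k + n) = prefix_word x k @ prefix_word (\<lambda>i. x (k + i)) n"
  by (induction n) (simp_all add: prefix_word_Suc)

lemma prefix_word_cong: "prefix_word x k = prefix_word y k \<longleftrightarrow> (\<forall>i<k. x i = y i)"
  by (auto simp: prefix_word_def)

lemma tree_comp_Nil [simp]: "tree_comp G \<omega> [] = id"
  by (simp add: tree_comp_def)

lemma tree_comp_snoc: "tree_comp G \<omega> (w @ [l]) = tree_comp G \<omega> w \<circ> G (\<omega> w) l"
proof -
  have foldr: "foldr (\<circ>) fs g = foldr (\<circ>) fs id \<circ> g" for fs :: "('a \<Rightarrow> 'a) list" and g
    by (induction fs) (auto simp: comp_assoc)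
  have "map (\<lambda>k. G (\<omega> (take k (w @ [l]))) ((w @ [l]) ! k)) [0..<length w] =
        map (\<lambda>k. G (\<omega> (take k w)) (w ! k)) [0..<length w]"
    by (intro map_cong) (auto simp: nth_append)
  moreover have "[0..<length (w @ [l])] = [0..<length w] @ [length w]" by simp
  ultimately show ?thesis
    unfolding tree_comp_def by (simp only: map_append foldr_append) (simp add: foldr[of _ "G (\<omega> w) l"])
qed

lemma tree_comp_append:
  "tree_comp G \<omega> (w @ v) = tree_comp G \<omega> w \<circ> tree_comp G (\<lambda>u. \<omega> (w @ u)) v"
proof (induction v rule: rev_induct)
  case (snoc l v)
  have "tree_comp G \<omega> ((w @ v) @ [l]) = tree_comp G \<omega> (w @ v) \<circ> G (\<omega> (w @ v)) l"
    by (rule tree_comp_snoc)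
  then show ?case by (simp add: snoc tree_comp_snoc comp_assoc)
qed simp

lemma tree_words_append_iff:
  "w @ v \<in> tree_words M \<omega> \<longleftrightarrow> w \<in> tree_words M \<omega> \<and> v \<in> tree_words M (\<lambda>u. \<omega> (w @ u))"
proof (induction v rule: rev_induct)
  case (snoc l v)
  have "(w @ v) @ [l] \<in> tree_words M \<omega> \<longleftrightarrow> w @ v \<in> tree_words M \<omega> \<and> 1 \<le> l \<and> l \<le> M (\<omega> (w @ v))"
    by (rule tree_words_snoc_iff)
  then show ?case by (simp add: snoc tree_words_snoc_iff)
qed (simp add: tree_words.Nil)

lemma tree_boundary_letter:
  assumes "x \<in> tree_boundary M \<omega>"
  shows "(\<omega> (prefix_word x n), x n) \<in> map_indices M"
proof -
  have "prefix_word x (Suc n) \<in> tree_words M \<omega>" using assms by (simp add: tree_boundary_def del: length_prefix_word)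
  then show ?thesis by (simp add: prefix_word_Suc tree_words_snoc_iff map_indices_def)
qed

lemma tree_boundary_shift:
  assumes "x \<in> tree_boundary M \<omega>"
  shows "(\<lambda>i. x (k + i)) \<in> tree_boundary M (\<lambda>u. \<omega> (prefix_word x k @ u))"
proof -
  have "prefix_word x (k + n) \<in> tree_words M \<omega>" for n using assms by (auto simp: tree_boundary_def)
  then show ?thesis by (simp add: prefix_word_add tree_words_append_iff tree_boundary_def)
qed

text \<open>The coordinate of the translation vector that enters at depth \<open>n\<close> along
  \<open>x\<close>.\<close>

definition class_at :: "('l \<times> nat) rel \<Rightarrow> (nat list \<Rightarrow> 'l) \<Rightarrow> (nat \<Rightarrow> nat) \<Rightarrow> nat \<Rightarrow> ('l \<times> nat) set" where
  "class_at R \<omega> x n = R `` {(\<omega> (prefix_word x n), x n)}"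

text \<open>The tree \<omega> is kept out of the locale: below a word \<open>w\<close> the tree
  continues as \<open>\<lambda>u. \<omega> (w @ u)\<close>, and the results are applied to these
  subtrees too.\<close>

locale affine_code_tree =
  fixes M :: "'l \<Rightarrow> nat" and T :: "'l \<Rightarrow> nat \<Rightarrow> 'a::euclidean_space \<Rightarrow> 'a"
    and R :: "('l \<times> nat) rel" and \<sigma> :: real
  assumes M_bdd: "bdd_above (range M)"
    and T_linear: "\<And>l i. (l, i) \<in> map_indices M \<Longrightarrow> linear (T l i)"
    and T_bij: "\<And>l i. (l, i) \<in> map_indices M \<Longrightarrow> bij (T l i)"
    and T_onorm: "\<And>l i. (l, i) \<in> map_indices M \<Longrightarrow> onorm (T l i) \<le> \<sigma>"
    and sigma: "0 < \<sigma>" "\<sigma> < 1 / 2"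
    and R_equiv: "equiv (map_indices M) R" and classes_finite: "finite (map_indices M // R)"
    and R_sep: "\<And>l i j. (l, i) \<in> map_indices M \<Longrightarrow> (l, j) \<in> map_indices M \<Longrightarrow>
           ((l, i), (l, j)) \<in> R \<longleftrightarrow> i = j"
begin

lemma tree_comp_linear_bound:
  assumes "w \<in> tree_words M \<omega>"
  shows "linear (tree_comp T \<omega> w)" "bij (tree_comp T \<omega> w)"
    "norm (tree_comp T \<omega> w y) \<le> \<sigma> ^ length w * norm y"
proof -
  have "linear (tree_comp T \<omega> w) \<and> bij (tree_comp T \<omega> w) \<and>
    (\<forall>y. norm (tree_comp T \<omega> w y) \<le> \<sigma> ^ length w * norm y)"
    using assms
  proof (induction w rule: rev_induct)
    case (snoc l w)
    then have w: "w \<in> tree_words M \<omega>" and l: "(\<omega> w, l) \<in> map_indices M"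
      by (auto simp: tree_words_snoc_iff map_indices_def)
    note IH = snoc.IH[OF w]
    have "norm (tree_comp T \<omega> (w @ [l]) y) \<le> \<sigma> ^ length (w @ [l]) * norm y" for y
    proof -
      have "norm (tree_comp T \<omega> (w @ [l]) y) \<le> \<sigma> ^ length w * norm (T (\<omega> w) l y)"
        using IH by (simp add: tree_comp_snoc)
      also have "norm (T (\<omega> w) l y) \<le> onorm (T (\<omega> w) l) * norm y"
        using T_linear[OF l] by (intro onorm) (simp add: linear_conv_bounded_linear)
      also have "\<dots> \<le> \<sigma> * norm y" using T_onorm[OF l] by (intro mult_right_mono) auto
      finally show ?thesis using sigma by (simp add: mult.assoc mult.left_commute)
    qed
    moreover have "linear (tree_comp T \<omega> (w @ [l]))"
      unfolding tree_comp_snoc using IH T_linear[OF l] by (intro linear_compose) auto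
    moreover have "bij (tree_comp T \<omega> (w @ [l]))"
      unfolding tree_comp_snoc using IH T_bij[OF l] by (intro bij_comp) auto
    ultimately show ?case by blast
  qed (auto simp: linear_id bij_id)
  then show "linear (tree_comp T \<omega> w)" "bij (tree_comp T \<omega> w)"
    "norm (tree_comp T \<omega> w y) \<le> \<sigma> ^ length w * norm y" by auto
qed

lemma tree_comp_bounded_linear:
  "w \<in> tree_words M \<omega> \<Longrightarrow> bounded_linear (tree_comp T \<omega> w)"
  using tree_comp_linear_bound(1) by (simp add: linear_conv_bounded_linear)

lemma tree_comp_tree_map:
  "w \<in> tree_words M \<omega> \<Longrightarrow>
     tree_comp (tree_map R T a) \<omega> w y = tree_comp (tree_map R T a) \<omega> w 0 + tree_comp T \<omega> w y"
proof (induction w arbitrary: y rule: rev_induct)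
  case (snoc l w)
  then have w: "w \<in> tree_words M \<omega>" and l: "(\<omega> w, l) \<in> map_indices M"
    by (auto simp: tree_words_snoc_iff map_indices_def)
  have lin: "linear (tree_comp T \<omega> w)" "linear (T (\<omega> w) l)"
    using tree_comp_linear_bound(1)[OF w] T_linear[OF l] by auto
  have tm: "tree_map R T a (\<omega> w) l u = T (\<omega> w) l u + a (R `` {(\<omega> w, l)})" for u
    by (simp add: tree_map_def)
  show ?case
    using snoc.IH[OF w, of "T (\<omega> w) l y + a (R `` {(\<omega> w, l)})"]
      snoc.IH[OF w, of "T (\<omega> w) l 0 + a (R `` {(\<omega> w, l)})"]
    by (simp add: tree_comp_snoc tm linear_add[OF lin(1)] linear_0[OF lin(1)] linear_0[OF lin(2)])
qed simp

text \<open>Unfolding the affine maps turns the point of \<open>x\<close> into the series of these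
  terms, each linear in \<open>a\<close>.\<close>

definition point_term :: "(nat list \<Rightarrow> 'l) \<Rightarrow> (('l \<times> nat) set \<Rightarrow> 'a) \<Rightarrow> (nat \<Rightarrow> nat) \<Rightarrow> nat \<Rightarrow> 'a" where
  "point_term \<omega> a x n = tree_comp T \<omega> (prefix_word x n) (a (class_at R \<omega> x n))"

lemma class_at_in: "x \<in> tree_boundary M \<omega> \<Longrightarrow> class_at R \<omega> x n \<in> map_indices M // R"
  unfolding class_at_def by (intro quotientI tree_boundary_letter)

lemma boundary_words: "x \<in> tree_boundary M \<omega> \<Longrightarrow> prefix_word x n \<in> tree_words M \<omega>"
  by (simp add: tree_boundary_def)

lemma tree_comp_tree_map_prefix:
  assumes x: "x \<in> tree_boundary M \<omega>"
  shows "tree_comp (tree_map R T a) \<omega> (prefix_word x k) 0 = (\<Sum>n<k. point_term \<omega> a x n)"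
proof (induction k)
  case (Suc k)
  have l: "(\<omega> (prefix_word x k), x k) \<in> map_indices M" by (rule tree_boundary_letter[OF x])
  have tm: "tree_map R T a (\<omega> (prefix_word x k)) (x k) 0 = a (class_at R \<omega> x k)"
    by (simp add: tree_map_def class_at_def linear_0[OF T_linear[OF l]])
  show ?case
    using Suc tree_comp_tree_map[OF boundary_words[OF x, of k], of a "a (class_at R \<omega> x k)"]
    by (simp add: prefix_word_Suc tree_comp_snoc tm) (simp add: point_term_def)
qed simp

lemma norm_point_term_le:
  assumes x: "x \<in> tree_boundary M \<omega>"
  shows "norm (point_term \<omega> a x n) \<le> \<sigma> ^ n * norm (a (class_at R \<omega> x n))"
  using tree_comp_linear_bound(3)[OF boundary_words[OF x, of n]] by (simp add: point_term_def)

lemma norm_point_term_le_bound: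
  assumes x: "x \<in> tree_boundary M \<omega>" and a: "\<And>c. c \<in> map_indices M // R \<Longrightarrow> norm (a c) \<le> B"
  shows "norm (point_term \<omega> a x n) \<le> \<sigma> ^ n * B"
proof -
  have "norm (point_term \<omega> a x n) \<le> \<sigma> ^ n * norm (a (class_at R \<omega> x n))"
    by (rule norm_point_term_le[OF x])
  also have "\<dots> \<le> \<sigma> ^ n * B" using sigma by (intro mult_left_mono a class_at_in[OF x]) auto
  finally show ?thesis .
qed

lemma translations_bounded:
  fixes a :: "('l \<times> nat) set \<Rightarrow> 'a"
  obtains B where "\<And>c. c \<in> map_indices M // R \<Longrightarrow> norm (a c) \<le> B"
  using that[of "\<Sum>c\<in>map_indices M // R. norm (a c)"] classes_finite
  by (meson member_le_sum norm_ge_zero)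

lemma geometric: "summable (\<lambda>n. \<sigma> ^ n * B)" "(\<Sum>n. \<sigma> ^ n * B) = B / (1 - \<sigma>)"
  using sigma by (auto intro!: summable_mult2 summable_geometric simp: suminf_mult2[symmetric] suminf_geometric)

lemma point_term_summable:
  assumes x: "x \<in> tree_boundary M \<omega>"
  shows "summable (point_term \<omega> a x)"
proof -
  obtain B where B: "\<And>c. c \<in> map_indices M // R \<Longrightarrow> norm (a c) \<le> B" 
    using translations_bounded[of a] by blast
  show ?thesis
    by (rule summable_comparison_test[OF _ geometric(1)[of B]])
       (use norm_point_term_le_bound[OF x B] in auto)
qed

lemma tree_point_sums:
  assumes x: "x \<in> tree_boundary M \<omega>"
  shows "point_term \<omega> a x sums tree_point R T \<omega> a x"
proof -
  have "(\<lambda>k. tree_comp (tree_map R T a) \<omega> (prefix_word x k) 0) = (\<lambda>k. \<Sum>n<k. point_term \<omega> a x n)"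
    by (simp add: tree_comp_tree_map_prefix[OF x])
  moreover have "(\<lambda>k. \<Sum>n<k. point_term \<omega> a x n) \<longlonglongrightarrow> suminf (point_term \<omega> a x)"
    using point_term_summable[OF x] summable_sums sums_def by blast
  ultimately show ?thesis
    by (metis limI sums_def tree_point_def)
qed

lemma norm_tree_point_le:
  assumes x: "x \<in> tree_boundary M \<omega>" and a: "\<And>c. c \<in> map_indices M // R \<Longrightarrow> norm (a c) \<le> B"
  shows "norm (tree_point R T \<omega> a x) \<le> B / (1 - \<sigma>)"
proof -
  have "norm (suminf (point_term \<omega> a x)) \<le> (\<Sum>n. \<sigma> ^ n * B)"
    by (intro norm_suminf_le norm_point_term_le_bound[OF x a] geometric)
  then show ?thesis using sums_unique[OF tree_point_sums[OF x, of a]] by (simp add: geometric)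
qed

lemma point_term_shift:
  "point_term \<omega> a x (n + k) = tree_comp T \<omega> (prefix_word x k)
     (point_term (\<lambda>u. \<omega> (prefix_word x k @ u)) a (\<lambda>i. x (k + i)) n)"
  by (simp add: point_term_def class_at_def add.commute[of n] prefix_word_add tree_comp_append)

text \<open>Self-affinity along a prefix. The upper bound uses it to place a cylinder in an
  ellipsoid, the lower bound to pull the common linear part out of the difference of two
  points.\<close>

lemma tree_point_shift:
  assumes x: "x \<in> tree_boundary M \<omega>"
  shows "tree_point R T \<omega> a x = tree_comp (tree_map R T a) \<omega> (prefix_word x k) 0 +
    tree_comp T \<omega> (prefix_word x k)
      (tree_point R T (\<lambda>u. \<omega> (prefix_word x k @ u)) a (\<lambda>i. x (k + i)))"
proof -
  let ?\<omega> = "\<lambda>u. \<omega> (prefix_word x k @ u)" and ?x = "\<lambda>i. x (k + i)"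
  have x': "?x \<in> tree_boundary M ?\<omega>" by (rule tree_boundary_shift[OF x])
  have "(\<lambda>n. point_term \<omega> a x (n + k)) sums tree_comp T \<omega> (prefix_word x k) (tree_point R T ?\<omega> a ?x)"
    unfolding point_term_shift
    by (rule bounded_linear.sums[OF tree_comp_bounded_linear[OF boundary_words[OF x]] tree_point_sums[OF x']])
  moreover have "(\<lambda>n. point_term \<omega> a x (n + k)) sums (tree_point R T \<omega> a x - (\<Sum>n<k. point_term \<omega> a x n))"
    using tree_point_sums[OF x] by (rule sums_split_initial_segment)
  ultimately have "tree_comp T \<omega> (prefix_word x k) (tree_point R T ?\<omega> a ?x) =
      tree_point R T \<omega> a x - (\<Sum>n<k. point_term \<omega> a x n)"
    by (rule sums_unique2)
  then show ?thesis by (simp add: tree_comp_tree_map_prefix[OF x])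
qed

section \<open>Transversality\<close>

text \<open>A Lipschitz constant, in the coordinate \<open>c\<close>, for the series without its
  first term.\<close>

definition later_weight :: "(nat list \<Rightarrow> 'l) \<Rightarrow> (nat \<Rightarrow> nat) \<Rightarrow> ('l \<times> nat) set \<Rightarrow> real" where
  "later_weight \<omega> x c = (\<Sum>n. \<sigma> ^ Suc n * of_bool (class_at R \<omega> x (Suc n) = c))"

lemma later_weight_summable: "summable (\<lambda>n. \<sigma> ^ Suc n * of_bool (class_at R \<omega> x (Suc n) = c))"
proof (rule summable_comparison_test[OF _ geometric(1)[of \<sigma>]])
  show "\<exists>N. \<forall>n\<ge>N. norm (\<sigma> ^ Suc n * of_bool (class_at R \<omega> x (Suc n) = c)) \<le> \<sigma> ^ n * \<sigma>"
    using sigma by (auto simp: mult.commute)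
qed

text \<open>Each depth carries a single class, so two distinct classes share one geometric
  series.\<close>

lemma later_weight_add_le:
  assumes "c \<noteq> c'"
  shows "later_weight \<omega> x c + later_weight \<omega> x c' \<le> \<sigma> / (1 - \<sigma>)"
proof -
  have "later_weight \<omega> x c + later_weight \<omega> x c' =
      (\<Sum>n. \<sigma> ^ Suc n * of_bool (class_at R \<omega> x (Suc n) = c) + \<sigma> ^ Suc n * of_bool (class_at R \<omega> x (Suc n) = c'))"
    unfolding later_weight_def by (intro suminf_add later_weight_summable)
  also have "\<dots> \<le> (\<Sum>n. \<sigma> ^ n * \<sigma>)"
    using assms sigma
    by (intro suminf_le summable_add later_weight_summable geometric) (auto simp: mult.commute)
  finally show ?thesis by (simp add: geometric)
qed

text \<open>Only terms of class \<open>c\<close> react to the change. The first term carries the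
  identity, so its share is exact; later ones are contracted by powers of \<sigma>.\<close>

lemma tree_point_update:
  assumes x: "x \<in> tree_boundary M \<omega>"
  shows "norm (tree_point R T \<omega> (a(c := z)) x - tree_point R T \<omega> (a(c := z')) x -
           (if class_at R \<omega> x 0 = c then z - z' else 0)) \<le> later_weight \<omega> x c * norm (z - z')"
proof -
  let ?t = "\<lambda>n. point_term \<omega> (a(c := z)) x n - point_term \<omega> (a(c := z')) x n"
  have eq: "?t n = tree_comp T \<omega> (prefix_word x n) (if class_at R \<omega> x n = c then z - z' else 0)" for n
    using tree_comp_linear_bound(1)[OF boundary_words[OF x, of n]]
    by (simp add: point_term_def linear_diff linear_0)
  have le: "norm (?t (Suc n)) \<le> \<sigma> ^ Suc n * of_bool (class_at R \<omega> x (Suc n) = c) * norm (z - z')" for n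
    using tree_comp_linear_bound(3)[OF boundary_words[OF x, of "Suc n"], of "z - z'"]
      linear_0[OF tree_comp_linear_bound(1)[OF boundary_words[OF x, of "Suc n"]]] unfolding eq
    by (cases "class_at R \<omega> x (Suc n) = c") (simp_all del: power_Suc)
  have s: "?t sums (tree_point R T \<omega> (a(c := z)) x - tree_point R T \<omega> (a(c := z')) x)"
    by (intro sums_diff tree_point_sums x)
  have "(\<lambda>n. ?t (Suc n)) sums (tree_point R T \<omega> (a(c := z)) x - tree_point R T \<omega> (a(c := z')) x - ?t 0)"
    using s by (subst sums_Suc_iff) simp
  moreover have "?t 0 = (if class_at R \<omega> x 0 = c then z - z' else 0)" by (simp add: eq)
  ultimately have "(\<lambda>n. ?t (Suc n)) sums (tree_point R T \<omega> (a(c := z)) x - tree_point R T \<omega> (a(c := z')) x -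
           (if class_at R \<omega> x 0 = c then z - z' else 0))" by simp
  moreover have "norm (\<Sum>n. ?t (Suc n)) \<le> (\<Sum>n. \<sigma> ^ Suc n * of_bool (class_at R \<omega> x (Suc n) = c) * norm (z - z'))"
    by (intro norm_suminf_le le summable_mult2 later_weight_summable)
  ultimately show ?thesis
    using suminf_mult2[OF later_weight_summable[of \<omega> x c], of "norm (z - z')"]
    by (simp add: sums_iff later_weight_def del: power_Suc)
qed

text \<open>This is where \<open>\<sigma> < 1 / 2\<close> enters. Two distinct classes \<open>c\<close>, \<open>c'\<close> occur in
  first position, and all later terms contribute at most \<open>2 \<sigma> / (1 - \<sigma>) < 2\<close> to their two coefficients
  together. So for one of the two classes the leading coefficient \<open>\<plusminus>1\<close> dominates.\<close>

lemma transversality: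
  assumes x: "x \<in> tree_boundary M \<omega>" and y: "y \<in> tree_boundary M \<omega>" and "x 0 \<noteq> y 0"
  obtains c where "c \<in> map_indices M // R"
    "\<And>a z z'. (1 - \<sigma> / (1 - \<sigma>)) * norm (z - z') \<le>
       norm ((tree_point R T \<omega> (a(c := z)) x - tree_point R T \<omega> (a(c := z)) y) -
             (tree_point R T \<omega> (a(c := z')) x - tree_point R T \<omega> (a(c := z')) y))"
proof -
  let ?c = "class_at R \<omega> x 0" and ?c' = "class_at R \<omega> y 0"
  have "?c \<noteq> ?c'"
  proof
    assume "?c = ?c'"
    then have "((\<omega> [], x 0), (\<omega> [], y 0)) \<in> R"
      using eq_equiv_class[OF _ R_equiv] tree_boundary_letter[OF y, of 0] by (auto simp: class_at_def)
    then show False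
      using R_sep tree_boundary_letter[OF x, of 0] tree_boundary_letter[OF y, of 0] \<open>x 0 \<noteq> y 0\<close> by auto
  qed
  then have "\<exists>c. c \<in> {?c, ?c'} \<and> later_weight \<omega> x c + later_weight \<omega> y c \<le> \<sigma> / (1 - \<sigma>)"
    using later_weight_add_le[of ?c ?c' \<omega> x] later_weight_add_le[of ?c ?c' \<omega> y]
    by (smt (verit) insertCI)
  then obtain c where c: "c \<in> {?c, ?c'}" "later_weight \<omega> x c + later_weight \<omega> y c \<le> \<sigma> / (1 - \<sigma>)" by blast
  show ?thesis
  proof (rule that)
    show "c \<in> map_indices M // R" using c(1) class_at_in[OF x] class_at_in[OF y] by auto
    fix a and z z' :: 'a
    let ?p = "\<lambda>z x. tree_point R T \<omega> (a(c := z)) x"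
    let ?u = "if ?c = c then z - z' else 0" and ?v = "if ?c' = c then z - z' else 0"
    \<comment> \<open>Exactly one of the two leading classes is \<open>c\<close>.\<close>
    have "norm (?u - ?v) = norm (z - z')"
      using c(1) \<open>?c \<noteq> ?c'\<close> by (auto simp: norm_minus_commute)
    moreover have "norm (?u - ?v) \<le> norm ((?p z x - ?p z y) - (?p z' x - ?p z' y)) +
        norm (?p z x - ?p z' x - ?u) + norm (?p z y - ?p z' y - ?v)"
    proof -
      have "?u - ?v = ((?p z x - ?p z y) - (?p z' x - ?p z' y)) - (?p z x - ?p z' x - ?u) + (?p z y - ?p z' y - ?v)"
        by (simp add: algebra_simps)
      then show ?thesis by (metis norm_triangle_le norm_triangle_ineq4 add_right_mono)
    qed
    moreover have "norm (?p z x - ?p z' x - ?u) + norm (?p z y - ?p z' y - ?v) \<le> 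
        (later_weight \<omega> x c + later_weight \<omega> y c) * norm (z - z')"
      unfolding distrib_right by (intro add_mono tree_point_update x y)
    moreover have "\<dots> \<le> \<sigma> / (1 - \<sigma>) * norm (z - z')" using c(2) by (intro mult_right_mono) auto
    ultimately show "(1 - \<sigma> / (1 - \<sigma>)) * norm (z - z') \<le> norm ((?p z x - ?p z y) - (?p z' x - ?p z' y))"
      by (simp add: left_diff_distrib)
  qed
qed

end

section \<open>The singular value function\<close>

text \<open>The power with which the j-th singular value enters the singular value function: 1, then
  one fractional exponent, then 0. This replaces the case distinction on m and allows estimates
  factor by factor.\<close>

definition sv_exponent :: "real \<Rightarrow> nat \<Rightarrow> real" where
  "sv_exponent \<alpha> j = max 0 (min 1 (\<alpha> - real j + 1))"

lemma sv_exponent_bounds: "0 \<le> sv_exponent \<alpha> j" "sv_exponent \<alpha> j \<le> 1"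
  by (auto simp: sv_exponent_def)

lemma sv_exponent_mono: "\<alpha> \<le> \<beta> \<Longrightarrow> sv_exponent \<alpha> j \<le> sv_exponent \<beta> j"
  by (auto simp: sv_exponent_def)

context
  fixes \<alpha> :: real and D m :: nat
  assumes \<alpha>: "0 \<le> \<alpha>" "\<alpha> < real D" and m: "m = nat \<lfloor>\<alpha>\<rfloor> + 1"
begin

lemma sv_index: "1 \<le> m" "m \<le> D" "real m - 1 \<le> \<alpha>" "\<alpha> < real m"
proof -
  have "real (nat \<lfloor>\<alpha>\<rfloor>) = of_int \<lfloor>\<alpha>\<rfloor>" using \<alpha> by simp
  then show "real m - 1 \<le> \<alpha>" "\<alpha> < real m" unfolding m of_nat_add of_nat_1 by linarith+
  then show "1 \<le> m" "m \<le> D" using \<alpha> m by linarith+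
qed

lemma sv_exponent_cases:
  "j < m \<Longrightarrow> sv_exponent \<alpha> j = 1" "sv_exponent \<alpha> m = \<alpha> - real m + 1" "m < j \<Longrightarrow> sv_exponent \<alpha> j = 0"
  using sv_index by (auto simp: sv_exponent_def)

lemma sv_index_split: "{1..D} = {1..m - 1} \<union> {m} \<union> {m + 1..D}"
  using sv_index by auto

lemma sum_sv_exponent: "(\<Sum>j=1..D. sv_exponent \<alpha> j) = \<alpha>"
proof -
  have "(\<Sum>j=1..D. sv_exponent \<alpha> j) =
      (\<Sum>j=1..m - 1. sv_exponent \<alpha> j) + sv_exponent \<alpha> m + (\<Sum>j=m + 1..D. sv_exponent \<alpha> j)"
    unfolding sv_index_split using sv_index by (subst sum.union_disjoint, auto)+
  also have "(\<Sum>j=1..m - 1. sv_exponent \<alpha> j) = (\<Sum>j=1..m - 1. 1)"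
    using sv_index by (intro sum.cong sv_exponent_cases(1)) auto
  also have "(\<Sum>j=m + 1..D. sv_exponent \<alpha> j) = 0" by (intro sum.neutral) (auto simp: sv_exponent_cases)
  finally show ?thesis using sv_index by (simp add: sv_exponent_cases of_nat_diff)
qed

text \<open>Positivity lets an exponent 0 give the factor 1, as \<open>0 powr 0\<close> is
  0.\<close>

lemma prod_powr_sv_exponent:
  fixes f :: "nat \<Rightarrow> real"
  assumes "\<And>j. j \<in> {1..D} \<Longrightarrow> 0 < f j"
  shows "(\<Prod>j=1..D. f j powr sv_exponent \<alpha> j) = (\<Prod>j=1..m - 1. f j) * f m powr (\<alpha> - real m + 1)"
proof -
  have "(\<Prod>j=1..D. f j powr sv_exponent \<alpha> j) =
      (\<Prod>j=1..m - 1. f j powr sv_exponent \<alpha> j) * f m powr sv_exponent \<alpha> m *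
      (\<Prod>j=m + 1..D. f j powr sv_exponent \<alpha> j)"
    unfolding sv_index_split using sv_index by (subst prod.union_disjoint, auto)+
  also have "(\<Prod>j=1..m - 1. f j powr sv_exponent \<alpha> j) = (\<Prod>j=1..m - 1. f j)"
  proof (rule prod.cong)
    fix j assume "j \<in> {1..m - 1}"
    then have "j < m" "j \<in> {1..D}" using sv_index by auto
    then show "f j powr sv_exponent \<alpha> j = f j" using assms[of j] by (simp add: sv_exponent_cases)
  qed simp
  also have "(\<Prod>j=m + 1..D. f j powr sv_exponent \<alpha> j) = 1"
  proof (rule prod.neutral, safe)
    fix j assume "j \<in> {m + 1..D}"
    then have "m < j" "j \<in> {1..D}" by auto
    then show "f j powr sv_exponent \<alpha> j = 1" using assms[of j] by (simp add: sv_exponent_cases)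
  qed
  finally show ?thesis by (simp add: sv_exponent_cases)
qed

end

section \<open>Estimates for singular values\<close>

lemma singular_value_basis:
  fixes T :: "'a::euclidean_space \<Rightarrow> 'a"
  assumes lin: "linear T"
  obtains e where "orthonormal_family e"
    "\<And>i j. i \<in> {1..DIM('a)} \<Longrightarrow> j \<in> {1..DIM('a)} \<Longrightarrow>
       T (e i) \<bullet> T (e j) = (if i = j then (singular_value T i)\<^sup>2 else 0)"
proof (rule singular_value_decomposition[OF lin])
  fix e assume "orthonormal_family e"
    "\<And>i j. i \<in> {1..DIM('a)} \<Longrightarrow> j \<in> {1..DIM('a)} \<Longrightarrow>
       T (e i) \<bullet> T (e j) = (if i = j then (singular_value T i)\<^sup>2 else 0)"
  then show thesis by (rule that)
qed

lemma singular_value_antimono: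
  fixes T :: "'a::euclidean_space \<Rightarrow> 'a"
  assumes lin: "linear T" and "1 \<le> i" "i \<le> j" "j \<le> DIM('a)"
  shows "singular_value T j \<le> singular_value T i"
proof (rule singular_value_decomposition[OF lin])
  fix e :: "nat \<Rightarrow> 'a"
  assume "\<And>i j. 1 \<le> i \<Longrightarrow> i \<le> j \<Longrightarrow> j \<le> DIM('a) \<Longrightarrow> singular_value T j \<le> singular_value T i"
  then show ?thesis using assms(2-4) by blast
qed

lemma singular_value_pos:
  fixes T :: "'a::euclidean_space \<Rightarrow> 'a"
  assumes lin: "linear T" and inj: "inj T" and i: "i \<in> {1..DIM('a)}"
  shows "0 < singular_value T i"
proof (rule singular_value_decomposition[OF lin])
  fix e assume e: "orthonormal_family e"
    and T: "\<And>i j. i \<in> {1..DIM('a)} \<Longrightarrow> j \<in> {1..DIM('a)} \<Longrightarrow>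
       T (e i) \<bullet> T (e j) = (if i = j then (singular_value T i)\<^sup>2 else 0)"
    and nn: "\<And>i. i \<in> {1..DIM('a)} \<Longrightarrow> 0 \<le> singular_value T i"
  have "e i \<noteq> 0" using orthonormal_family_inner[OF e i i] by auto
  then have "T (e i) \<noteq> 0" using inj lin by (metis inj_eq linear_0)
  then have "singular_value T i \<noteq> 0" using T[OF i i] by auto
  then show ?thesis using nn[OF i] by simp
qed

lemma singular_value_le:
  fixes T :: "'a::euclidean_space \<Rightarrow> 'a"
  assumes lin: "linear T" and q: "\<And>y. norm (T y) \<le> q * norm y" and i: "i \<in> {1..DIM('a)}"
  shows "singular_value T i \<le> q"
proof (rule singular_value_decomposition[OF lin])
  fix e assume e: "orthonormal_family e"
    and T: "\<And>i j. i \<in> {1..DIM('a)} \<Longrightarrow> j \<in> {1..DIM('a)} \<Longrightarrow>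
       T (e i) \<bullet> T (e j) = (if i = j then (singular_value T i)\<^sup>2 else 0)"
    and nn: "\<And>i. i \<in> {1..DIM('a)} \<Longrightarrow> 0 \<le> singular_value T i"
  have "norm (e i) = 1" using orthonormal_family_inner[OF e i i] by (simp add: norm_eq_1)
  then have "norm (T (e i)) \<le> q" using q[of "e i"] by simp
  moreover have "norm (T (e i)) = singular_value T i"
    using T[OF i i] nn[OF i] by (simp add: norm_eq_sqrt_inner)
  ultimately show ?thesis by simp
qed

lemma sv_function_eq_prod:
  fixes T :: "'a::euclidean_space \<Rightarrow> 'a"
  assumes "linear T" "inj T" "0 \<le> \<alpha>" "\<alpha> < real DIM('a)"
  shows "sv_function \<alpha> T = (\<Prod>j=1..DIM('a). singular_value T j powr sv_exponent \<alpha> j)"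
  using prod_powr_sv_exponent[OF assms(3,4) refl singular_value_pos[OF assms(1,2)]] assms(4)
  by (simp add: sv_function_def)

lemma sv_function_pos:
  fixes T :: "'a::euclidean_space \<Rightarrow> 'a"
  assumes "linear T" "inj T" "0 \<le> \<alpha>" "\<alpha> < real DIM('a)"
  shows "0 < sv_function \<alpha> T"
proof -
  have "singular_value T j powr sv_exponent \<alpha> j > 0" if "j \<in> {1..DIM('a)}" for j
    using singular_value_pos[OF assms(1,2) that] by simp
  then show ?thesis unfolding sv_function_eq_prod[OF assms] by (intro prod_pos) blast
qed

text \<open>Raising the exponent distributes the total \<open>s - t\<close> over singular values
  that are each at most \<open>q\<close>. With \<open>q\<close> a power of \<sigma> this is a
  geometric gain in the word length.\<close>

lemma sv_function_le:
  fixes T :: "'a::euclidean_space \<Rightarrow> 'a"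
  assumes T: "linear T" "inj T" and q: "0 < q" "\<And>y. norm (T y) \<le> q * norm y"
    and ts: "0 \<le> t" "t \<le> s" "s < real DIM('a)"
  shows "sv_function s T \<le> sv_function t T * q powr (s - t)"
proof -
  have t: "t < real DIM('a)" and s: "0 \<le> s" using ts by auto
  let ?d = "\<lambda>j. sv_exponent s j - sv_exponent t j"
  have "sv_function s T \<le> (\<Prod>j=1..DIM('a). singular_value T j powr sv_exponent t j * q powr ?d j)"
    unfolding sv_function_eq_prod[OF T s ts(3)]
  proof (rule prod_mono, safe)
    fix j assume j: "j \<in> {1..DIM('a)}"
    have "singular_value T j powr sv_exponent s j = singular_value T j powr sv_exponent t j * singular_value T j powr ?d j"
      by (simp add: powr_add[symmetric])
    also have "\<dots> \<le> singular_value T j powr sv_exponent t j * q powr ?d j"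
      using singular_value_le[OF T(1) q(2) j] singular_value_pos[OF T j] sv_exponent_mono[OF ts(2)]
      by (intro mult_left_mono powr_mono2) auto
    finally show "singular_value T j powr sv_exponent s j \<le> singular_value T j powr sv_exponent t j * q powr ?d j" .
  qed simp
  also have "\<dots> = sv_function t T * (\<Prod>j=1..DIM('a). q powr ?d j)"
    unfolding sv_function_eq_prod[OF T ts(1) t] by (rule prod.distrib)
  also have "(\<Prod>j=1..DIM('a). q powr ?d j) = q powr (\<Sum>j=1..DIM('a). ?d j)"
    using q by (subst powr_sum) auto
  also have "(\<Sum>j=1..DIM('a). ?d j) = s - t"
    unfolding sum_subtractf sum_sv_exponent[OF s ts(3) refl] sum_sv_exponent[OF ts(1) t refl] ..
  finally show ?thesis .
qed

text \<open>The image lies in a box with half-sides \<rho> times the singular values. Sides shorter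
  than the m-th are enlarged to it, so the number of cubes is governed by the product of
  \<open>?sv i / ?sv m\<close> over i < m. Multiplying by the power \<alpha> of the m-th singular
  value leaves the singular value function.\<close>

lemma image_ball_cover:
  fixes T :: "'a::euclidean_space \<Rightarrow> 'a"
  assumes T: "linear T" "inj T" and q: "\<And>y. norm (T y) \<le> q * norm y"
    and \<alpha>: "0 \<le> \<alpha>" "\<alpha> < real DIM('a)" and \<rho>: "0 < \<rho>"
  obtains \<U> b N where "finite \<U>" "real (card \<U>) \<le> N" "(\<lambda>y. p + T y) ` cball 0 \<rho> \<subseteq> \<Union>\<U>"
    "\<forall>U\<in>\<U>. \<forall>x\<in>U. \<forall>y\<in>U. dist x y \<le> b"
    "0 < b" "b \<le> sqrt (real DIM('a)) * \<rho> * q"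
    "N * b powr \<alpha> = 3 ^ DIM('a) * (sqrt (real DIM('a)) * \<rho>) powr \<alpha> * sv_function \<alpha> T"
proof -
  define m where "m = nat \<lfloor>\<alpha>\<rfloor> + 1"
  note m = sv_index[OF \<alpha> m_def]
  let ?D = "DIM('a)" and ?sv = "singular_value T"
  have sv: "0 < ?sv i" if "i \<in> {1..?D}" for i by (rule singular_value_pos[OF T that])
  have svm: "0 < ?sv m" using m by (intro sv) auto
  obtain e where e: "orthonormal_family e"
    and Te: "\<And>i j. i \<in> {1..?D} \<Longrightarrow> j \<in> {1..?D} \<Longrightarrow> T (e i) \<bullet> T (e j) = (if i = j then (?sv i)\<^sup>2 else 0)"
    using singular_value_basis[OF T(1)] by blast
  \<comment> \<open>The axes of the ellipsoid; normalising is possible because no singular value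
    vanishes.\<close>
  define g where "g i = T (e i) /\<^sub>R ?sv i" for i
  have g: "orthonormal_family g"
    unfolding orthonormal_family_def
  proof (intro ballI)
    fix i j assume ij: "i \<in> {1..?D}" "j \<in> {1..?D}"
    show "g i \<bullet> g j = (if i = j then 1 else 0)"
      using sv[OF ij(1)] Te[OF ij] by (cases "i = j") (simp_all add: g_def power2_eq_square field_simps)
  qed
  have Tg: "T x \<bullet> g i = ?sv i * (x \<bullet> e i)" if i: "i \<in> {1..?D}" for x i
  proof -
    have "T x = T (\<Sum>j=1..?D. (x \<bullet> e j) *\<^sub>R e j)" by (simp only: orthonormal_family_expand[OF e])
    also have "\<dots> = (\<Sum>j=1..?D. (x \<bullet> e j) *\<^sub>R T (e j))"
      using T(1) by (simp only: linear_sum linear_scale)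
    finally have "T x \<bullet> g i = (\<Sum>j=1..?D. (x \<bullet> e j) * (T (e j) \<bullet> T (e i) / ?sv i))"
      by (simp only: inner_sum_left g_def inner_scaleR_left inner_scaleR_right) (simp add: divide_inverse sum_distrib_left mult_ac)
    also have "\<dots> = (\<Sum>j=1..?D. if j = i then ?sv i * (x \<bullet> e i) else 0)"
      using Te[OF _ i] sv[OF i] by (intro sum.cong) (auto simp: power2_eq_square)
    also have "\<dots> = ?sv i * (x \<bullet> e i)" using i by simp
    finally show ?thesis .
  qed
  define \<epsilon> where "\<epsilon> = ?sv m * \<rho>"
  define s where "s i = max (?sv i) (?sv m) * \<rho>" for i
  have \<epsilon>: "0 < \<epsilon>" using svm \<rho> by (simp add: \<epsilon>_def)
  have s_ge: "\<epsilon> \<le> s i" if "i \<in> {1..?D}" for i using \<rho> by (simp add: s_def \<epsilon>_def)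
  obtain \<U> where U:
    "finite \<U>" "real (card \<U>) \<le> (\<Prod>i=1..?D. 3 * s i / \<epsilon>)" "basis_box g (\<lambda>i. p \<bullet> g i) s \<subseteq> \<Union>\<U>"
    "\<forall>U\<in>\<U>. \<forall>x\<in>U. \<forall>y\<in>U. dist x y \<le> sqrt (real ?D) * \<epsilon>"
    by (rule basis_box_cover[OF g \<epsilon> s_ge, where p="\<lambda>i. p \<bullet> g i"])
  let ?b = "sqrt (real ?D) * \<epsilon>"
  have ratio: "(\<Prod>i=1..?D. 3 * s i / \<epsilon>) = 3 ^ ?D * (\<Prod>i=1..m - 1. ?sv i / ?sv m)"
  proof -
    have "(\<Prod>i=1..?D. 3 * s i / \<epsilon>) = (\<Prod>i=1..?D. 3 * (max (?sv i) (?sv m) / ?sv m))"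
      using \<rho> by (intro prod.cong) (auto simp: s_def \<epsilon>_def)
    also have "\<dots> = 3 ^ ?D * (\<Prod>i=1..?D. max (?sv i) (?sv m) / ?sv m)"
      unfolding prod.distrib by simp
    also have "(\<Prod>i=1..?D. max (?sv i) (?sv m) / ?sv m) = (\<Prod>i=1..m - 1. max (?sv i) (?sv m) / ?sv m)"
    proof (rule prod.mono_neutral_right)
      show "\<forall>i\<in>{1..?D} - {1..m - 1}. max (?sv i) (?sv m) / ?sv m = 1"
      proof
        fix i assume "i \<in> {1..?D} - {1..m - 1}"
        then have "?sv i \<le> ?sv m" using m by (intro singular_value_antimono[OF T(1)]) auto
        then show "max (?sv i) (?sv m) / ?sv m = 1" using svm by (simp add: max_absorb2)
      qed
    qed (use m in auto)
    also have "\<dots> = (\<Prod>i=1..m - 1. ?sv i / ?sv m)"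
    proof (rule prod.cong)
      fix i assume "i \<in> {1..m - 1}"
      then have "?sv m \<le> ?sv i" using m by (intro singular_value_antimono[OF T(1)]) auto
      then show "max (?sv i) (?sv m) / ?sv m = ?sv i / ?sv m" by (simp add: max_absorb1)
    qed simp
    finally show ?thesis .
  qed
  show ?thesis
  proof (rule that[OF U(1,2) _ U(4)])
    show "(\<lambda>y. p + T y) ` cball 0 \<rho> \<subseteq> \<Union>\<U>"
    proof (rule order_trans[OF _ U(3)], safe)
      fix y :: 'a assume y: "y \<in> cball 0 \<rho>"
      have "\<bar>(p + T y) \<bullet> g i - p \<bullet> g i\<bar> \<le> s i" if i: "i \<in> {1..?D}" for i
      proof -
        have "norm (e i) = 1" using orthonormal_family_inner[OF e i i] by (simp add: norm_eq_1)
        then have "\<bar>y \<bullet> e i\<bar> \<le> \<rho>" using Cauchy_Schwarz_ineq2[of y "e i"] y by simp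
        then have "?sv i * \<bar>y \<bullet> e i\<bar> \<le> max (?sv i) (?sv m) * \<rho>"
          using sv[OF i] by (intro mult_mono) auto
        moreover have "\<bar>(p + T y) \<bullet> g i - p \<bullet> g i\<bar> = ?sv i * \<bar>y \<bullet> e i\<bar>"
          using sv[OF i] by (simp add: inner_add_left Tg[OF i] abs_mult)
        ultimately show ?thesis by (simp add: s_def)
      qed
      then show "p + T y \<in> basis_box g (\<lambda>i. p \<bullet> g i) s" by (simp add: basis_box_def)
    qed
    show "0 < ?b" using \<epsilon> by simp
    have "?sv m \<le> q" using m by (intro singular_value_le[OF T(1) q]) auto
    then have "?sv m * (sqrt (real ?D) * \<rho>) \<le> q * (sqrt (real ?D) * \<rho>)"
      using \<rho> by (intro mult_right_mono) auto
    then show "?b \<le> sqrt (real ?D) * \<rho> * q" by (simp add: \<epsilon>_def mult_ac)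
    have "?b powr \<alpha> = (sqrt (real ?D) * \<rho>) powr \<alpha> * ?sv m powr \<alpha>"
      using svm \<rho> by (simp add: \<epsilon>_def powr_mult mult_ac)
    also have "?sv m powr \<alpha> = ?sv m ^ (m - 1) * ?sv m powr (\<alpha> - real m + 1)"
      using svm m by (simp add: powr_realpow[symmetric] powr_add[symmetric] of_nat_diff)
    finally have b: "?b powr \<alpha> = (sqrt (real ?D) * \<rho>) powr \<alpha> * (?sv m ^ (m - 1) * ?sv m powr (\<alpha> - real m + 1))" .
    have sf: "sv_function \<alpha> T = (\<Prod>i=1..m - 1. ?sv i) * ?sv m powr (\<alpha> - real m + 1)"
      using \<alpha>(2) by (simp only: sv_function_def Let_def if_True m_def)
    have quot: "(\<Prod>i=1..m - 1. ?sv i / ?sv m) * ?sv m ^ (m - 1) = (\<Prod>i=1..m - 1. ?sv i)"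
      using svm by (simp add: prod_dividef)
    show "(\<Prod>i=1..?D. 3 * s i / \<epsilon>) * ?b powr \<alpha> =
        3 ^ ?D * (sqrt (real ?D) * \<rho>) powr \<alpha> * sv_function \<alpha> T"
      unfolding ratio b sf quot[symmetric] by (simp only: mult_ac)
  qed
qed

section \<open>Flows on trees\<close>

text \<open>The least capacity of a cut separating \<open>w\<close> from depth \<open>n\<close> below it.\<close>

primrec cut_value :: "('l \<Rightarrow> nat) \<Rightarrow> (nat list \<Rightarrow> 'l) \<Rightarrow> (nat list \<Rightarrow> real) \<Rightarrow> nat \<Rightarrow> nat list \<Rightarrow> real" where
  "cut_value M \<omega> c 0 w = c w"
| "cut_value M \<omega> c (Suc n) w = min (c w) (\<Sum>l=1..M (\<omega> w). cut_value M \<omega> c n (w @ [l]))"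

lemma sum_UN_nonneg_le:
  fixes f :: "'a \<Rightarrow> real"
  assumes "finite I" "\<And>i. i \<in> I \<Longrightarrow> finite (A i)" "\<And>i x. i \<in> I \<Longrightarrow> x \<in> A i \<Longrightarrow> 0 \<le> f x"
  shows "sum f (\<Union>i\<in>I. A i) \<le> (\<Sum>i\<in>I. sum f (A i))"
  using assms
proof (induction I rule: finite_induct)
  case (insert i I)
  have "sum f (A i \<union> (\<Union>i\<in>I. A i)) + sum f (A i \<inter> (\<Union>i\<in>I. A i)) = sum f (A i) + sum f (\<Union>i\<in>I. A i)"
    using insert by (intro sum.union_inter) auto
  moreover have "0 \<le> sum f (A i \<inter> (\<Union>i\<in>I. A i))" using insert.prems by (intro sum_nonneg) auto
  moreover have "sum f (\<Union>i\<in>I. A i) \<le> (\<Sum>i\<in>I. sum f (A i))" using insert by auto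
  ultimately show ?case using insert.hyps by simp
qed simp

lemma tree_words_child: "w \<in> tree_words M \<omega> \<Longrightarrow> l \<in> {1..M (\<omega> w)} \<Longrightarrow> w @ [l] \<in> tree_words M \<omega>"
  by (simp add: tree_words_snoc_iff)

lemma cylinder_children:
  "cylinder M \<omega> w \<subseteq> (\<Union>l\<in>{1..M (\<omega> w)}. cylinder M \<omega> (w @ [l]))"
proof
  fix x assume x: "x \<in> cylinder M \<omega> w"
  then have "prefix_word x (Suc (length w)) \<in> tree_words M \<omega>"
    by (auto simp: cylinder_def tree_boundary_def simp del: length_prefix_word)
  then have "x (length w) \<in> {1..M (\<omega> w)}" "prefix_word x (Suc (length w)) = w @ [x (length w)]"
    using x by (auto simp: prefix_word_Suc cylinder_def tree_words_snoc_iff)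
  then show "x \<in> (\<Union>l\<in>{1..M (\<omega> w)}. cylinder M \<omega> (w @ [l]))"
    using x by (auto simp: cylinder_def)
qed

lemma cylinder_Nil: "cylinder M \<omega> [] = tree_boundary M \<omega>"
  by (auto simp: cylinder_def)

context
  fixes M :: "'l \<Rightarrow> nat" and \<omega> :: "nat list \<Rightarrow> 'l" and c :: "nat list \<Rightarrow> real"
  assumes c_pos: "\<And>w. w \<in> tree_words M \<omega> \<Longrightarrow> 0 < c w"
begin

lemma cut_value_nonneg: "w \<in> tree_words M \<omega> \<Longrightarrow> 0 \<le> cut_value M \<omega> c n w"
proof (induction n arbitrary: w)
  case (Suc n)
  then show ?case
    by (auto intro!: sum_nonneg simp: c_pos less_imp_le tree_words_child)
qed (simp add: c_pos less_imp_le)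

lemma cut_value_le: "cut_value M \<omega> c n w \<le> c w"
  by (cases n) auto

lemma cut_value_decseq: "cut_value M \<omega> c (Suc n) w \<le> cut_value M \<omega> c n w"
proof (induction n arbitrary: w)
  case (Suc n)
  have "(\<Sum>l=1..M (\<omega> w). cut_value M \<omega> c (Suc n) (w @ [l])) \<le> (\<Sum>l=1..M (\<omega> w). cut_value M \<omega> c n (w @ [l]))"
    by (intro sum_mono Suc.IH)
  then show ?case
    unfolding cut_value.simps(2)[of M \<omega> c "Suc n"] cut_value.simps(2)[of M \<omega> c n w] by (rule min.mono[OF order_refl])
qed simp

text \<open>Unrolls the minimum: stopping at a word contributes its cylinder, continuing contributes
  the covers of its children. Lower bounds for covers thus become lower bounds for cut values at
  every depth.\<close>

lemma cut_value_cover: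
  "w \<in> tree_words M \<omega> \<Longrightarrow> \<exists>J. finite J \<and> J \<subseteq> tree_words M \<omega> \<and>
     cylinder M \<omega> w \<subseteq> (\<Union>v\<in>J. cylinder M \<omega> v) \<and> sum c J \<le> cut_value M \<omega> c n w"
proof (induction n arbitrary: w)
  case 0
  then show ?case by (intro exI[of _ "{w}"]) auto
next
  case (Suc n)
  show ?case
  proof (cases "cut_value M \<omega> c (Suc n) w = c w")
    case True
    then show ?thesis using Suc.prems by (intro exI[of _ "{w}"]) auto
  next
    case False
    then have eq: "cut_value M \<omega> c (Suc n) w = (\<Sum>l=1..M (\<omega> w). cut_value M \<omega> c n (w @ [l]))"
      by (auto simp: min_def)
    have "\<forall>l\<in>{1..M (\<omega> w)}. \<exists>J. finite J \<and> J \<subseteq> tree_words M \<omega> \<and>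
     cylinder M \<omega> (w @ [l]) \<subseteq> (\<Union>v\<in>J. cylinder M \<omega> v) \<and> sum c J \<le> cut_value M \<omega> c n (w @ [l])"
      using Suc.IH tree_words_child[OF Suc.prems] by blast
    from bchoice[OF this] obtain J where J: "\<And>l. l \<in> {1..M (\<omega> w)} \<Longrightarrow> finite (J l)"
      "\<And>l. l \<in> {1..M (\<omega> w)} \<Longrightarrow> J l \<subseteq> tree_words M \<omega>"
      "\<And>l. l \<in> {1..M (\<omega> w)} \<Longrightarrow> cylinder M \<omega> (w @ [l]) \<subseteq> (\<Union>v\<in>J l. cylinder M \<omega> v)"
      "\<And>l. l \<in> {1..M (\<omega> w)} \<Longrightarrow> sum c (J l) \<le> cut_value M \<omega> c n (w @ [l])" by blast
    let ?J = "\<Union>l\<in>{1..M (\<omega> w)}. J l"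
    have "sum c ?J \<le> (\<Sum>l=1..M (\<omega> w). sum c (J l))"
      using J(1,2) c_pos by (intro sum_UN_nonneg_le) (auto simp: less_imp_le subset_iff)
    also have "\<dots> \<le> cut_value M \<omega> c (Suc n) w" unfolding eq by (intro sum_mono J(4))
    finally have "sum c ?J \<le> cut_value M \<omega> c (Suc n) w" .
    moreover have "cylinder M \<omega> w \<subseteq> (\<Union>v\<in>?J. cylinder M \<omega> v)"
      using cylinder_children[of M \<omega> w] J(3) by blast
    moreover have "finite ?J" using J(1) by simp
    moreover have "?J \<subseteq> tree_words M \<omega>" using J(2) by blast
    ultimately show ?thesis by (intro exI[of _ ?J] conjI)
  qed
qed

text \<open>Cut values decrease with the depth, so this is their infimum over all finite
  depths.\<close>

definition cut_limit :: "nat list \<Rightarrow> real" where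
  "cut_limit w = lim (\<lambda>n. cut_value M \<omega> c n w)"

lemma cut_limit: 
  assumes "w \<in> tree_words M \<omega>"
  shows "(\<lambda>n. cut_value M \<omega> c n w) \<longlonglongrightarrow> cut_limit w"
proof -
  have "convergent (\<lambda>n. cut_value M \<omega> c n w)"
  proof (rule Bseq_monoseq_convergent)
    show "Bseq (\<lambda>n. cut_value M \<omega> c n w)"
      using cut_value_nonneg[OF assms] cut_value_le[of _ w]
      by (intro BseqI'[of _ "c w"]) (auto simp: abs_le_iff intro: order_trans[OF _ cut_value_nonneg[OF assms]])
    show "monoseq (\<lambda>n. cut_value M \<omega> c n w)"
      using cut_value_decseq by (intro decseq_imp_monoseq decseq_SucI) auto
  qed
  then show ?thesis by (simp add: convergent_LIMSEQ_iff cut_limit_def)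
qed

lemma cut_limit_nonneg: "w \<in> tree_words M \<omega> \<Longrightarrow> 0 \<le> cut_limit w"
  using cut_limit by (rule LIMSEQ_le_const) (auto intro: cut_value_nonneg)

lemma cut_limit_le: "w \<in> tree_words M \<omega> \<Longrightarrow> cut_limit w \<le> c w"
  using cut_limit by (rule LIMSEQ_le_const2) (auto intro: cut_value_le)

text \<open>Drop the capacity of \<open>w\<close> from the minimum; the limit commutes with the
  finite sum over children.\<close>

lemma cut_limit_le_children:
  assumes w: "w \<in> tree_words M \<omega>"
  shows "cut_limit w \<le> (\<Sum>l=1..M (\<omega> w). cut_limit (w @ [l]))"
proof (rule LIMSEQ_le)
  show "(\<lambda>n. cut_value M \<omega> c (Suc n) w) \<longlonglongrightarrow> cut_limit w"
    by (rule LIMSEQ_Suc[OF cut_limit[OF w]])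
  show "(\<lambda>n. \<Sum>l=1..M (\<omega> w). cut_value M \<omega> c n (w @ [l])) \<longlonglongrightarrow> (\<Sum>l=1..M (\<omega> w). cut_limit (w @ [l]))"
    by (intro tendsto_sum cut_limit tree_words_child[OF w])
qed simp

text \<open>\<open>cut_limit\<close> satisfies only an inequality between a word and its children,
  so it is not yet a flow. Each word hands its amount to its children in proportion to their limits.
  The amount never exceeds the sum of these limits, so every child receives at most its own limit,
  hence at most its capacity.\<close>

lemma tree_flow_exists:
  assumes "0 < \<beta>" and \<beta>: "\<And>n. \<beta> \<le> cut_value M \<omega> c n []"
  obtains \<theta> where "0 < \<theta> []" "\<And>w. w \<in> tree_words M \<omega> \<Longrightarrow> 0 \<le> \<theta> w"
    "\<And>w. w \<in> tree_words M \<omega> \<Longrightarrow> \<theta> w \<le> c w"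
    "\<And>w. w \<in> tree_words M \<omega> \<Longrightarrow> \<theta> w = (\<Sum>l=1..M (\<omega> w). \<theta> (w @ [l]))"
proof -
  define S where "S w = (\<Sum>l=1..M (\<omega> w). cut_limit (w @ [l]))" for w
  \<comment> \<open>The product of the splitting ratios along the word. On tree words where
    \<open>S\<close> is 0 the incoming flow is 0 as well, so the default value of division by 0 does
    no harm.\<close>
  define \<theta> where "\<theta> w = cut_limit [] * (\<Prod>k<length w. cut_limit (take (Suc k) w) / S (take k w))" for w
  have snoc: "\<theta> (w @ [l]) = \<theta> w * cut_limit (w @ [l]) / S w" for w l
    by (simp add: \<theta>_def)
  have Sn: "0 \<le> S w" "cut_limit w \<le> S w" if "w \<in> tree_words M \<omega>" for w
    unfolding S_def using that by (intro sum_nonneg cut_limit_nonneg tree_words_child cut_limit_le_children; simp)+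
  have bounds: "0 \<le> \<theta> w \<and> \<theta> w \<le> cut_limit w" if "w \<in> tree_words M \<omega>" for w
    using that
  proof (induction w rule: rev_induct)
    case Nil
    then show ?case using cut_limit_nonneg by (simp add: \<theta>_def)
  next
    case (snoc l w)
    then have w: "w \<in> tree_words M \<omega>" by (simp add: tree_words_snoc_iff)
    note IH = snoc.IH[OF w] and S = Sn[OF w] and v = cut_limit_nonneg[OF snoc.prems]
    have "\<theta> w / S w \<le> 1" using IH S by (cases "S w = 0") (auto simp: divide_le_eq_1)
    then have "\<theta> w / S w * cut_limit (w @ [l]) \<le> 1 * cut_limit (w @ [l])" by (intro mult_right_mono v)
    moreover have "0 \<le> \<theta> w / S w * cut_limit (w @ [l])" using IH S v by (intro mult_nonneg_nonneg) auto
    ultimately show ?case by (simp add: \<open>\<And>w l. \<theta> (w @ [l]) = \<theta> w * cut_limit (w @ [l]) / S w\<close>)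
  qed
  show ?thesis
  proof (rule that)
    have "\<beta> \<le> cut_limit []"
      using cut_limit[OF tree_words.Nil] \<beta> by (intro LIMSEQ_le_const) auto
    then show "0 < \<theta> []" using \<open>0 < \<beta>\<close> by (simp add: \<theta>_def)
    fix w assume w: "w \<in> tree_words M \<omega>"
    show "0 \<le> \<theta> w" using bounds[OF w] by simp
    show "\<theta> w \<le> c w" using bounds[OF w] cut_limit_le[OF w] by simp
    have "(\<Sum>l=1..M (\<omega> w). \<theta> (w @ [l])) = \<theta> w * S w / S w"
      unfolding snoc by (simp add: S_def sum_distrib_left sum_divide_distrib)
    also have "\<dots> = \<theta> w" using bounds[OF w] Sn[OF w] by (cases "S w = 0") auto
    finally show "\<theta> w = (\<Sum>l=1..M (\<omega> w). \<theta> (w @ [l]))" ..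
  qed
qed

end

section \<open>Representing a flow by nested intervals\<close>

text \<open>The flow through all words that leave the path of \<open>w\<close> to the left; siblings
  thus lie side by side in the order of their letters.\<close>

definition interval_start :: "(nat list \<Rightarrow> real) \<Rightarrow> nat list \<Rightarrow> real" where
  "interval_start \<theta> w = (\<Sum>k<length w. \<Sum>l=1..<w ! k. \<theta> (take k w @ [l]))"

text \<open>Half-open, so that the children's intervals are disjoint and together fill the parent's;
  a word without flow gets the empty set.\<close>

definition word_interval :: "(nat list \<Rightarrow> real) \<Rightarrow> nat list \<Rightarrow> real set" where
  "word_interval \<theta> w = {interval_start \<theta> w..<interval_start \<theta> w + \<theta> w}"

lemma interval_start_snoc: "interval_start \<theta> (w @ [l]) = interval_start \<theta> w + (\<Sum>i=1..<l. \<theta> (w @ [i]))"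
  by (simp add: interval_start_def nth_append)

context
  fixes M :: "'l \<Rightarrow> nat" and \<omega> :: "nat list \<Rightarrow> 'l" and \<theta> :: "nat list \<Rightarrow> real"
  assumes nonneg: "\<And>w. w \<in> tree_words M \<omega> \<Longrightarrow> 0 \<le> \<theta> w"
    and flow: "\<And>w. w \<in> tree_words M \<omega> \<Longrightarrow> \<theta> w = (\<Sum>l=1..M (\<omega> w). \<theta> (w @ [l]))"
begin

lemma word_interval_child_subset:
  assumes "w @ [l] \<in> tree_words M \<omega>"
  shows "word_interval \<theta> (w @ [l]) \<subseteq> word_interval \<theta> w"
proof -
  have w: "w \<in> tree_words M \<omega>" and l: "1 \<le> l" "l \<le> M (\<omega> w)" using assms by (auto simp: tree_words_snoc_iff)
  have nn: "0 \<le> \<theta> (w @ [i])" if "i \<in> {1..M (\<omega> w)}" for i using that w by (intro nonneg tree_words_child)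
  have "(\<Sum>i=1..<l. \<theta> (w @ [i])) + \<theta> (w @ [l]) = (\<Sum>i=1..l. \<theta> (w @ [i]))"
    using l by (simp add: sum.last_plus add.commute)
  also have "\<dots> \<le> \<theta> w" unfolding flow[OF w] using l nn by (intro sum_mono2) auto
  finally have "(\<Sum>i=1..<l. \<theta> (w @ [i])) + \<theta> (w @ [l]) \<le> \<theta> w" .
  moreover have "0 \<le> (\<Sum>i=1..<l. \<theta> (w @ [i]))" using l nn by (intro sum_nonneg) auto
  ultimately show ?thesis by (auto simp: word_interval_def interval_start_snoc)
qed

lemma word_interval_child_exists:
  assumes w: "w \<in> tree_words M \<omega>" and u: "u \<in> word_interval \<theta> w"
  shows "\<exists>l. w @ [l] \<in> tree_words M \<omega> \<and> u \<in> word_interval \<theta> (w @ [l])"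
proof -
  define S where "S k = interval_start \<theta> w + (\<Sum>i=1..k. \<theta> (w @ [i]))" for k
  have SM: "u < S (M (\<omega> w))" using u flow[OF w] by (simp add: S_def word_interval_def)
  have S0: "\<not> u < S 0" using u by (simp add: S_def word_interval_def)
  \<comment> \<open>The first partial sum exceeding \<open>u\<close>; index 0 is excluded by
    \<open>S0\<close>, in accordance with letters starting from 1.\<close>
  define l where "l = (LEAST k. u < S k)"
  have l1: "u < S l" unfolding l_def using SM by (rule LeastI)
  have l2: "l \<le> M (\<omega> w)" unfolding l_def using SM by (rule Least_le)
  obtain j where j: "l = Suc j" using l1 S0 by (cases l) auto
  have "\<not> u < S j" using not_less_Least[of j "\<lambda>k. u < S k"] j by (simp add: l_def)
  then have "u \<in> word_interval \<theta> (w @ [l])"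
    using l1 by (simp add: j word_interval_def interval_start_snoc S_def atLeastLessThanSuc_atLeastAtMost)
  then show ?thesis using w l2 j by (intro exI[of _ l]) (simp add: tree_words_snoc_iff)
qed

lemma word_interval_child_unique:
  assumes "w @ [l] \<in> tree_words M \<omega>" "u \<in> word_interval \<theta> (w @ [l])"
    and "w @ [l'] \<in> tree_words M \<omega>" "u \<in> word_interval \<theta> (w @ [l'])"
  shows "l = l'"
proof -
  have False if "l < l'" "w @ [l] \<in> tree_words M \<omega>" "w @ [l'] \<in> tree_words M \<omega>" 
    "u \<in> word_interval \<theta> (w @ [l])" "u \<in> word_interval \<theta> (w @ [l'])" for l l'
  proof -
    have w: "w \<in> tree_words M \<omega>" "1 \<le> l" "l' \<le> M (\<omega> w)" using that by (auto simp: tree_words_snoc_iff)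
    have "(\<Sum>i=1..<l. \<theta> (w @ [i])) + \<theta> (w @ [l]) = (\<Sum>i=1..l. \<theta> (w @ [i]))"
      using w by (simp add: sum.last_plus add.commute)
    also have "\<dots> \<le> (\<Sum>i=1..<l'. \<theta> (w @ [i]))"
      using that(1) w by (intro sum_mono2 nonneg tree_words_child) auto
    finally show False using that(4,5) by (simp add: word_interval_def interval_start_snoc)
  qed
  then show ?thesis using assms by (metis linorder_neqE_nat)
qed

text \<open>The address of \<open>u\<close>: at each step the letter whose interval contains
  \<open>u\<close>. Inside \<open>{0..<\<theta> []}\<close> such a letter exists and is
  unique.\<close>

primrec interval_word :: "real \<Rightarrow> nat \<Rightarrow> nat list" where
  "interval_word u 0 = []"
| "interval_word u (Suc n) = interval_word u n @
     [SOME l. interval_word u n @ [l] \<in> tree_words M \<omega> \<and> u \<in> word_interval \<theta> (interval_word u n @ [l])]"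

definition interval_point :: "real \<Rightarrow> nat \<Rightarrow> nat" where
  "interval_point u n = last (interval_word u (Suc n))"

lemma prefix_interval_point: "prefix_word (interval_point u) n = interval_word u n"
  by (induction n) (simp_all add: prefix_word_Suc interval_point_def)

lemma interval_word:
  assumes u: "u \<in> {0..<\<theta> []}"
  shows "interval_word u n \<in> tree_words M \<omega> \<and> u \<in> word_interval \<theta> (interval_word u n)"
proof (induction n)
  case 0
  then show ?case using u by (simp add: word_interval_def interval_start_def tree_words.Nil)
next
  case (Suc n)
  then have "\<exists>l. interval_word u n @ [l] \<in> tree_words M \<omega> \<and> u \<in> word_interval \<theta> (interval_word u n @ [l])"
    using word_interval_child_exists by blast
  from someI_ex[OF this] show ?case by simp
qed

lemma interval_point_boundary: "u \<in> {0..<\<theta> []} \<Longrightarrow> interval_point u \<in> tree_boundary M \<omega>"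
  using interval_word by (simp add: tree_boundary_def prefix_interval_point)

lemma interval_word_eq:
  "w \<in> tree_words M \<omega> \<Longrightarrow> u \<in> word_interval \<theta> w \<Longrightarrow> interval_word u (length w) = w"
proof (induction w rule: rev_induct)
  case (snoc l w)
  then have w: "w \<in> tree_words M \<omega>" by (simp add: tree_words_snoc_iff)
  have eq: "interval_word u (length w) = w"
    using snoc.IH[OF w] word_interval_child_subset[OF snoc.prems(1)] snoc.prems(2) by blast
  have "(SOME l. w @ [l] \<in> tree_words M \<omega> \<and> u \<in> word_interval \<theta> (w @ [l])) = l"
    using snoc.prems word_interval_child_unique by (intro some_equality) auto
  then show ?case by (simp add: eq)
qed simp

lemma word_interval_subset: "w \<in> tree_words M \<omega> \<Longrightarrow> word_interval \<theta> w \<subseteq> {0..<\<theta> []}"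
proof (induction w rule: rev_induct)
  case (snoc l w)
  then show ?case using word_interval_child_subset[OF snoc.prems] by (auto simp: tree_words_snoc_iff)
qed (simp add: word_interval_def interval_start_def)

text \<open>Cylinders pull back to intervals of length \<open>\<theta> w\<close>, so Lebesgue
  measure on \<open>{0..<\<theta> []}\<close> has the flow as its cylinder masses.\<close>

lemma interval_point_cylinder:
  assumes w: "w \<in> tree_words M \<omega>"
  shows "{u \<in> {0..<\<theta> []}. prefix_word (interval_point u) (length w) = w} = word_interval \<theta> w"
  using interval_word interval_word_eq[OF w] word_interval_subset[OF w]
  by (auto simp: prefix_interval_point) metis

end

section \<open>The upper bound\<close>

text \<open>The number of cubes of side \<epsilon> grows like \<epsilon> to the power
  -\<open>DIM('a)\<close>, so for larger exponents the sums tend to 0.\<close>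

lemma hausdorff_dim_bounded_le:
  fixes E :: "'a::euclidean_space set"
  assumes "bounded E"
  shows "hausdorff_dim E \<le> ereal (real DIM('a))"
proof (rule dense_ge)
  fix z assume z: "ereal (real DIM('a)) < z"
  let ?D = "DIM('a)"
  obtain r where r: "0 < r" "\<And>x. x \<in> E \<Longrightarrow> norm x \<le> r" using assms by (auto simp: bounded_pos)
  obtain e :: "nat \<Rightarrow> 'a" where e: "orthonormal_family e" by (rule orthonormal_family_exists)
  have box: "E \<subseteq> basis_box e (\<lambda>_. 0) (\<lambda>_. r)"
  proof
    fix x assume x: "x \<in> E"
    have "\<bar>x \<bullet> e i - 0\<bar> \<le> r" if i: "i \<in> {1..?D}" for i
    proof -
      have "norm (e i) = 1" using orthonormal_family_inner[OF e i i] by (simp add: norm_eq_1)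
      then show ?thesis using Cauchy_Schwarz_ineq2[of x "e i"] r(2)[OF x] by simp
    qed
    then show "x \<in> basis_box e (\<lambda>_. 0) (\<lambda>_. r)" by (simp add: basis_box_def)
  qed
  have dim: "hausdorff_dim E \<le> ereal \<alpha>" if \<alpha>: "real ?D < \<alpha>" for \<alpha>
  proof (rule hausdorff_dim_le[OF hausdorff_measure_eq_0I])
    fix \<delta> :: real assume \<delta>: "0 < \<delta>"
    define C where "C = (3 * r) ^ ?D * sqrt (real ?D) powr \<alpha>"
    have "hausdorff_premeasure \<alpha> \<delta> E \<le> ennreal (C * \<epsilon> powr (\<alpha> - real ?D))"
      if \<epsilon>: "0 < \<epsilon>" "\<epsilon> < min r (\<delta> / sqrt (real ?D))" for \<epsilon>
    proof -
      have le: "\<epsilon> \<le> r" if "i \<in> {1..?D}" for i :: nat using \<epsilon> by simp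
      obtain \<U> where U: "finite \<U>" "real (card \<U>) \<le> (\<Prod>i=1..?D. 3 * r / \<epsilon>)"
        "basis_box e (\<lambda>_. 0) (\<lambda>_. r) \<subseteq> \<Union>\<U>"
        "\<forall>U\<in>\<U>. \<forall>x\<in>U. \<forall>y\<in>U. dist x y \<le> sqrt (real ?D) * \<epsilon>"
        by (rule basis_box_cover[OF e \<epsilon>(1) le, where p="\<lambda>_. 0"])
      have "sqrt (real ?D) * \<epsilon> \<le> \<delta>" using \<epsilon> by (simp add: field_simps)
      \<comment> \<open>A one-point index set carries the whole family of cubes.\<close>
      then have "hausdorff_premeasure \<alpha> \<delta> E \<le>
         (\<integral>\<^sup>+w. ennreal ((3 * r / \<epsilon>) ^ ?D * (sqrt (real ?D) * \<epsilon>) powr \<alpha>) \<partial>count_space {()})"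
        using U box \<epsilon> \<delta> \<alpha> by (intro hausdorff_premeasure_le_cover[where F="\<lambda>_. \<U>"]) auto
      also have "\<dots> = ennreal ((3 * r / \<epsilon>) ^ ?D * (sqrt (real ?D) * \<epsilon>) powr \<alpha>)"
        by (simp add: nn_integral_count_space_finite)
      also have "(3 * r / \<epsilon>) ^ ?D * (sqrt (real ?D) * \<epsilon>) powr \<alpha> = C * \<epsilon> powr (\<alpha> - real ?D)"
        using \<epsilon> by (simp add: C_def powr_mult powr_diff powr_realpow power_divide)
      finally show ?thesis .
    qed
    then have "eventually (\<lambda>\<epsilon>. hausdorff_premeasure \<alpha> \<delta> E \<le> ennreal (C * \<epsilon> powr (\<alpha> - real ?D))) (at_right 0)"
      using r(1) \<delta> unfolding eventually_at_right_field
      by (intro exI[of _ "min r (\<delta> / sqrt (real ?D))"]) auto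
    moreover have "((\<lambda>\<epsilon>. ennreal (C * \<epsilon> powr (\<alpha> - real ?D))) \<longlongrightarrow> ennreal (C * 0)) (at_right 0)"
      using \<alpha> by (intro tendsto_ennrealI tendsto_mult tendsto_const tendsto_zero_powrI)
        (auto simp: eventually_at_right_field intro!: exI[of _ 1])
    ultimately have "hausdorff_premeasure \<alpha> \<delta> E \<le> ennreal (C * 0)"
      by (intro tendsto_lowerbound[OF _ _ trivial_limit_at_right_real])
    then show "hausdorff_premeasure \<alpha> \<delta> E = 0" by simp
  qed (use \<alpha> in linarith)
  show "hausdorff_dim E \<le> z"
    using z dim by (cases z) auto
qed

text \<open>Passes from the integral in the cover estimate to the unordered sum in the affinity
  premeasure.\<close>

lemma nn_integral_count_space_le_infsum:
  fixes f :: "'i::countable \<Rightarrow> ennreal"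
  shows "(\<integral>\<^sup>+i. f i \<partial>count_space J) \<le> (\<Sum>\<^sub>\<infinity>i\<in>J. f i)"
proof -
  have le: "sum f F \<le> (\<Sum>\<^sub>\<infinity>i\<in>J. f i)" if "finite F" "F \<subseteq> J" for F
    using that by (subst nonneg_infsum_complete) (auto intro!: SUP_upper)
  show ?thesis
  proof (cases "finite J")
    case True
    then show ?thesis by (simp add: nn_integral_count_space_finite)
  next
    case False
    then have bij: "bij_betw (from_nat_into J) UNIV J" by (intro bij_betw_from_nat_into) auto
    have "(\<integral>\<^sup>+i. f i \<partial>count_space J) = (\<Sum>n. f (from_nat_into J n))"
      using nn_integral_bij_count_space[OF bij, of f] by (simp add: nn_integral_count_space_nat)
    also have "\<dots> = (SUP n. \<Sum>i<n. f (from_nat_into J i))" by (rule suminf_eq_SUP)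
    also have "\<dots> \<le> (\<Sum>\<^sub>\<infinity>i\<in>J. f i)"
    proof (rule SUP_least)
      fix n
      have "(\<Sum>i<n. f (from_nat_into J i)) = sum f (from_nat_into J ` {..<n})"
        using bij by (subst sum.reindex) (auto simp: bij_betw_def intro: inj_on_subset)
      also have "\<dots> \<le> (\<Sum>\<^sub>\<infinity>i\<in>J. f i)" using bij by (intro le) (auto simp: bij_betw_def)
      finally show "(\<Sum>i<n. f (from_nat_into J i)) \<le> (\<Sum>\<^sub>\<infinity>i\<in>J. f i)" .
    qed
    finally show ?thesis .
  qed
qed

text \<open>Larger \<open>j\<close> leaves fewer admissible covers, so the infima increase and the
  limit is a supremum.\<close>

lemma affinity_measure_eq_SUP:
  "affinity_measure M T \<omega> \<alpha> E = (SUP j. affinity_premeasure M T \<omega> \<alpha> j E)"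
proof -
  have "incseq (\<lambda>j. affinity_premeasure M T \<omega> \<alpha> j E)"
    unfolding incseq_def affinity_premeasure_def
    by (intro allI impI Inf_superset_mono) (blast intro: order_trans)
  from LIMSEQ_SUP[OF this] show ?thesis unfolding affinity_measure_def by (rule limI)
qed

context affine_code_tree
begin

lemma code_tree_fractal_bounded: "bounded (code_tree_fractal M R T \<omega> a)"
proof -
  obtain B where B: "\<And>c. c \<in> map_indices M // R \<Longrightarrow> norm (a c) \<le> B" using translations_bounded[of a] by blast
  have "norm (tree_point R T \<omega> a x) \<le> B / (1 - \<sigma>)" if "x \<in> tree_boundary M \<omega>" for x
    by (rule norm_tree_point_le[OF that]) (rule B)
  then show ?thesis by (auto simp: code_tree_fractal_def bounded_iff)
qed

text \<open>Covers of the tree by long words become covers of the fractal of mesh \<delta>, at the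
  price of a constant \<open>C\<close> that does not depend on \<delta>. So every premeasure
  vanishes with the affinity measure.\<close>

lemma hausdorff_dim_le_affinity:
  assumes \<alpha>: "0 \<le> \<alpha>" "\<alpha> < real DIM('a)"
    and zero: "affinity_measure M T \<omega> \<alpha> (tree_boundary M \<omega>) = 0"
  shows "hausdorff_dim (code_tree_fractal M R T \<omega> a) \<le> ereal \<alpha>"
proof (rule hausdorff_dim_le[OF hausdorff_measure_eq_0I \<alpha>(1)])
  fix \<delta> :: real assume \<delta>: "0 < \<delta>"
  let ?D = "DIM('a)" and ?A = "code_tree_fractal M R T \<omega> a"
  obtain B where B: "\<And>c. c \<in> map_indices M // R \<Longrightarrow> norm (a c) \<le> B" using translations_bounded[of a] by blast
  \<comment> \<open>A radius for the points of all subtrees at once, since the bound on the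
    translations is common to them; \<open>max B 1\<close> makes it positive.\<close>
  define \<rho> where "\<rho> = max B 1 / (1 - \<sigma>)"
  have \<rho>: "0 < \<rho>" using sigma by (auto simp: \<rho>_def)
  have point: "norm (tree_point R T \<omega>' a x) \<le> \<rho>" if "x \<in> tree_boundary M \<omega>'" for \<omega>' x
    unfolding \<rho>_def using that B by (intro norm_tree_point_le) (auto intro: max.coboundedI1)
  define C where "C = 3 ^ ?D * (sqrt (real ?D) * \<rho>) powr \<alpha>"
  have C: "0 < C" using \<rho> by (simp add: C_def)
  \<comment> \<open>Words of length at least \<open>j\<close> yield sets of diameter at most
    \<delta>.\<close>
  obtain j where "\<sigma> ^ j < \<delta> / (sqrt (real ?D) * \<rho>)"
    using real_arch_pow_inv[of "\<delta> / (sqrt (real ?D) * \<rho>)" \<sigma>] sigma \<delta> \<rho> by auto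
  then have j: "sqrt (real ?D) * \<rho> * \<sigma> ^ j \<le> \<delta>" using \<rho> by (simp add: field_simps)
  have "hausdorff_premeasure \<alpha> \<delta> ?A * ennreal (1 / C) \<le> affinity_premeasure M T \<omega> \<alpha> j (tree_boundary M \<omega>)"
    unfolding affinity_premeasure_def
  proof (rule Inf_greatest, clarify)
    fix J assume J: "J \<subseteq> tree_words M \<omega>" "tree_boundary M \<omega> \<subseteq> (\<Union>w\<in>J. cylinder M \<omega> w)" "\<forall>w\<in>J. j \<le> length w"
    \<comment> \<open>Collects the output of \<open>image_ball_cover\<close>, so that family, size
      and count can be chosen for all words at once.\<close>
    define P where "P w \<U> b N \<longleftrightarrow> finite \<U> \<and> real (card \<U>) \<le> N \<and>
      (\<lambda>y. tree_comp (tree_map R T a) \<omega> w 0 + tree_comp T \<omega> w y) ` cball 0 \<rho> \<subseteq> \<Union>\<U> \<and>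
      (\<forall>U\<in>\<U>. \<forall>x\<in>U. \<forall>y\<in>U. dist x y \<le> b) \<and> 0 < b \<and> b \<le> sqrt (real ?D) * \<rho> * \<sigma> ^ length w \<and>
      N * b powr \<alpha> = C * sv_function \<alpha> (tree_comp T \<omega> w)" for w \<U> b N
    have "\<forall>w\<in>J. \<exists>\<U> b N. P w \<U> b N"
    proof
      fix w assume "w \<in> J"
      then have w: "w \<in> tree_words M \<omega>" using J(1) by blast
      note Tw = tree_comp_linear_bound[OF w]
      show "\<exists>\<U> b N. P w \<U> b N"
        by (rule image_ball_cover[OF Tw(1) bij_is_inj[OF Tw(2)] Tw(3) \<alpha> \<rho>,
              where p="tree_comp (tree_map R T a) \<omega> w 0"]) (unfold P_def C_def, blast)
    qed
    then obtain \<U> b N where P: "\<And>w. w \<in> J \<Longrightarrow> P w (\<U> w) (b w) (N w)" by metis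
    have "?A \<subseteq> (\<Union>w\<in>J. \<Union>(\<U> w))"
    proof
      fix p assume "p \<in> ?A"
      then obtain x where x: "x \<in> tree_boundary M \<omega>" "p = tree_point R T \<omega> a x"
        by (auto simp: code_tree_fractal_def)
      then obtain w where w: "w \<in> J" "prefix_word x (length w) = w" using J(2) by (auto simp: cylinder_def)
      let ?y = "tree_point R T (\<lambda>u. \<omega> (w @ u)) a (\<lambda>i. x (length w + i))"
      have "norm ?y \<le> \<rho>" using tree_boundary_shift[OF x(1), of "length w"] w(2) by (intro point) simp
      moreover have "p = tree_comp (tree_map R T a) \<omega> w 0 + tree_comp T \<omega> w ?y"
        using tree_point_shift[OF x(1), of a "length w"] w(2) x(2) by simp
      ultimately have "p \<in> (\<lambda>y. tree_comp (tree_map R T a) \<omega> w 0 + tree_comp T \<omega> w y) ` cball 0 \<rho>" by auto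
      then have "p \<in> \<Union>(\<U> w)" using P[OF w(1)] unfolding P_def by blast
      then show "p \<in> (\<Union>w\<in>J. \<Union>(\<U> w))" using w(1) by blast
    qed
    then have "hausdorff_premeasure \<alpha> \<delta> ?A \<le> (\<integral>\<^sup>+w. ennreal (N w * b w powr \<alpha>) \<partial>count_space J)"
    proof (rule hausdorff_premeasure_le_cover)
      fix w assume w: "w \<in> J"
      show "b w \<le> \<delta>"
      proof -
        have "\<sigma> ^ length w \<le> \<sigma> ^ j" using J(3) w sigma by (intro power_decreasing) auto
        then have "sqrt (real ?D) * \<rho> * \<sigma> ^ length w \<le> sqrt (real ?D) * \<rho> * \<sigma> ^ j"
          using \<rho> by (intro mult_left_mono) auto
        then show ?thesis using P[OF w] j unfolding P_def by linarith
      qed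
    qed (use P \<delta> \<alpha> in \<open>auto simp: P_def\<close>)
    also have "\<dots> = (\<integral>\<^sup>+w. ennreal C * ennreal (sv_function \<alpha> (tree_comp T \<omega> w)) \<partial>count_space J)"
    proof (rule nn_integral_cong)
      fix w assume "w \<in> space (count_space J)"
      then have "N w * b w powr \<alpha> = C * sv_function \<alpha> (tree_comp T \<omega> w)" using P by (simp add: P_def)
      then show "ennreal (N w * b w powr \<alpha>) = ennreal C * ennreal (sv_function \<alpha> (tree_comp T \<omega> w))"
        using C by (simp add: ennreal_mult')
    qed
    also have "\<dots> = ennreal C * (\<integral>\<^sup>+w. ennreal (sv_function \<alpha> (tree_comp T \<omega> w)) \<partial>count_space J)"
      by (rule nn_integral_cmult) simp
    also have "\<dots> \<le> ennreal C * (\<Sum>\<^sub>\<infinity>w\<in>J. ennreal (sv_function \<alpha> (tree_comp T \<omega> w)))"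
      by (intro mult_left_mono nn_integral_count_space_le_infsum) simp
    finally have "hausdorff_premeasure \<alpha> \<delta> ?A * ennreal (1 / C) \<le>
        ennreal C * (\<Sum>\<^sub>\<infinity>w\<in>J. ennreal (sv_function \<alpha> (tree_comp T \<omega> w))) * ennreal (1 / C)"
      by (rule mult_right_mono) simp
    also have "\<dots> = (ennreal C * ennreal (1 / C)) * (\<Sum>\<^sub>\<infinity>w\<in>J. ennreal (sv_function \<alpha> (tree_comp T \<omega> w)))"
      by (simp add: ac_simps)
    also have "ennreal C * ennreal (1 / C) = 1" using C by (simp add: ennreal_mult[symmetric])
    finally show "hausdorff_premeasure \<alpha> \<delta> ?A * ennreal (1 / C) \<le>
        (\<Sum>\<^sub>\<infinity>w\<in>J. ennreal (sv_function \<alpha> (tree_comp T \<omega> w)))" by simp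
  qed
  also have "\<dots> \<le> affinity_measure M T \<omega> \<alpha> (tree_boundary M \<omega>)"
    unfolding affinity_measure_eq_SUP by (rule SUP_upper) simp
  finally have "hausdorff_premeasure \<alpha> \<delta> ?A * ennreal (1 / C) = 0" using zero by simp
  then show "hausdorff_premeasure \<alpha> \<delta> ?A = 0" using C by simp
qed

lemma hausdorff_dim_le_min:
  "hausdorff_dim (code_tree_fractal M R T \<omega> a) \<le> min (ereal (real DIM('a))) (affinity_dim M T \<omega>)"
proof (rule min.boundedI)
  show D: "hausdorff_dim (code_tree_fractal M R T \<omega> a) \<le> ereal (real DIM('a))"
    by (intro hausdorff_dim_bounded_le code_tree_fractal_bounded)
  show "hausdorff_dim (code_tree_fractal M R T \<omega> a) \<le> affinity_dim M T \<omega>"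
    unfolding affinity_dim_def
  proof (rule Inf_greatest, clarify)
    fix \<alpha> :: real assume "0 \<le> \<alpha>" "affinity_measure M T \<omega> \<alpha> (tree_boundary M \<omega>) = 0"
    \<comment> \<open>Once \<alpha> reaches the dimension of the space, the bound \<open>D\<close>
      already suffices.\<close>
    then show "hausdorff_dim (code_tree_fractal M R T \<omega> a) \<le> ereal \<alpha>"
      using hausdorff_dim_le_affinity order_trans[OF D] by (cases "\<alpha> < real DIM('a)") auto
  qed
qed

end

section \<open>Measure of near collisions\<close>

text \<open>Interpolation: a minimum of a and b is at most a^\<kappa> b^(1 - \<kappa>) for \<kappa>
  in [0,1]. With \<kappa> = \<open>sv_exponent t i\<close> in the i-th factor, the exponents of
  \<open>r\<close> add up to \<open>t\<close> and the singular values collect into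
  \<open>sv_function t T\<close>.\<close>

lemma prod_min_le_sv_function:
  fixes T :: "'a::euclidean_space \<Rightarrow> 'a"
  assumes T: "linear T" "inj T" and t: "0 \<le> t" "t < real DIM('a)" and r: "0 < r" "0 < r'"
  shows "(\<Prod>i=1..DIM('a). min (r / singular_value T i) r') \<le>
    r powr t / sv_function t T * r' powr (real DIM('a) - t)"
proof -
  let ?D = "DIM('a)"
  have pos: "0 < singular_value T i" if "i \<in> {1..?D}" for i by (rule singular_value_pos[OF T that])
  have "(\<Prod>i=1..?D. min (r / singular_value T i) r') \<le>
    (\<Prod>i=1..?D. r powr sv_exponent t i / singular_value T i powr sv_exponent t i * r' powr (1 - sv_exponent t i))"
  proof (rule prod_mono, safe)
    fix i assume i: "i \<in> {1..?D}"
    let ?a = "r / singular_value T i" and ?k = "sv_exponent t i"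
    have a: "0 < ?a" using pos[OF i] r by simp
    then show "0 \<le> min ?a r'" using r by simp
    have "min ?a r' = min ?a r' powr ?k * min ?a r' powr (1 - ?k)"
      using a r by (simp add: powr_add[symmetric])
    also have "\<dots> \<le> ?a powr ?k * r' powr (1 - ?k)"
      using a r sv_exponent_bounds[of t i] by (intro mult_mono powr_mono2) auto
    also have "?a powr ?k = r powr ?k / singular_value T i powr ?k"
      using pos[OF i] r by (simp add: powr_divide)
    finally show "min ?a r' \<le> r powr ?k / singular_value T i powr ?k * r' powr (1 - ?k)" .
  qed
  also have "\<dots> = (\<Prod>i=1..?D. r powr sv_exponent t i) / (\<Prod>i=1..?D. singular_value T i powr sv_exponent t i) *
      (\<Prod>i=1..?D. r' powr (1 - sv_exponent t i))"
    unfolding prod.distrib prod_dividef ..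
  also have "(\<Prod>i=1..?D. r powr sv_exponent t i) = r powr t"
    using r sum_sv_exponent[OF t refl] by (subst powr_sum[symmetric]) auto
  also have "(\<Prod>i=1..?D. r' powr (1 - sv_exponent t i)) = r' powr (real ?D - t)"
    using r sum_sv_exponent[OF t refl] by (subst powr_sum[symmetric]) (auto simp: sum_subtractf)
  finally show ?thesis unfolding sv_function_eq_prod[OF T t] .
qed

text \<open>An expanding map pulls a set of diameter d back into a ball of radius d / \<eta>. The
  two conditions put \<open>h z\<close> into a box with half-sides
  \<open>min (r / ?sv i) r'\<close>; it is cut into cubes, and their preimages are enclosed in such
  balls. This replaces a change of variables and gives a Borel set \<open>S\<close> whatever the
  preimage looks like.\<close>

lemma expanding_preimage_small:
  fixes T h :: "'a::euclidean_space \<Rightarrow> 'a"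
  assumes T: "linear T" "inj T" and t: "0 \<le> t" "t < real DIM('a)" and r: "0 < r" "0 < r'"
    and \<eta>: "0 < \<eta>" "\<And>z z'. \<eta> * norm (z - z') \<le> norm (h z - h z')"
  obtains S where "S \<in> sets borel" "{z. norm (h z) \<le> r' \<and> norm (T (h z)) \<le> r} \<subseteq> S"
    "emeasure lborel S \<le> ennreal ((3 * sqrt (real DIM('a)) / \<eta>) ^ DIM('a) * unit_ball_vol (real DIM('a)) *
       (r powr t / sv_function t T * r' powr (real DIM('a) - t)))"
proof -
  let ?D = "DIM('a)" and ?sv = "singular_value T"
  have sv: "0 < ?sv i" if "i \<in> {1..?D}" for i by (rule singular_value_pos[OF T that])
  have D1: "1 \<in> {1..?D}" by simp
  obtain e where e: "orthonormal_family e"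
    and Te: "\<And>i j. i \<in> {1..?D} \<Longrightarrow> j \<in> {1..?D} \<Longrightarrow> T (e i) \<bullet> T (e j) = (if i = j then (?sv i)\<^sup>2 else 0)"
    using singular_value_basis[OF T(1)] by blast
  have normT: "?sv i * \<bar>y \<bullet> e i\<bar> \<le> norm (T y)" if i: "i \<in> {1..?D}" for y i
  proof -
    have "T y = T (\<Sum>j=1..?D. (y \<bullet> e j) *\<^sub>R e j)" by (simp only: orthonormal_family_expand[OF e])
    also have "\<dots> = (\<Sum>j=1..?D. (y \<bullet> e j) *\<^sub>R T (e j))"
      using T(1) by (simp only: linear_sum linear_scale)
    finally have Ty: "T y = (\<Sum>j=1..?D. (y \<bullet> e j) *\<^sub>R T (e j))" .
    have "T y \<bullet> T (e i) = (\<Sum>j=1..?D. (y \<bullet> e j) * (T (e j) \<bullet> T (e i)))"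
      unfolding Ty by (simp only: inner_sum_left inner_scaleR_left)
    also have "\<dots> = (\<Sum>j=1..?D. if j = i then (y \<bullet> e i) * (?sv i)\<^sup>2 else 0)"
      using Te[OF _ i] by (intro sum.cong) auto
    also have "\<dots> = (y \<bullet> e i) * (?sv i)\<^sup>2" using i by simp
    finally have "\<bar>y \<bullet> e i\<bar> * (?sv i)\<^sup>2 = \<bar>T y \<bullet> T (e i)\<bar>" by (simp add: abs_mult)
    also have "\<dots> \<le> norm (T y) * norm (T (e i))" by (rule Cauchy_Schwarz_ineq2)
    also have "norm (T (e i)) = ?sv i" using Te[OF i i] sv[OF i] by (simp add: norm_eq_sqrt_inner)
    finally show ?thesis using sv[OF i] by (simp add: power2_eq_square mult_ac)
  qed
  define s where "s i = min (r / ?sv i) r'" for i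
  \<comment> \<open>The largest singular value gives the shortest side, so cubes of this side fit
    every axis.\<close>
  define \<epsilon> where "\<epsilon> = s 1"
  have \<epsilon>: "0 < \<epsilon>" using sv[OF D1] r by (simp add: \<epsilon>_def s_def)
  have s_ge: "\<epsilon> \<le> s i" if i: "i \<in> {1..?D}" for i
  proof -
    have "?sv i \<le> ?sv 1" using i by (intro singular_value_antimono[OF T(1)]) auto
    then have "r / ?sv 1 \<le> r / ?sv i" using sv[OF i] r by (intro divide_left_mono) auto
    then show ?thesis by (auto simp: \<epsilon>_def s_def)
  qed
  obtain \<U> where U: "finite \<U>" "real (card \<U>) \<le> (\<Prod>i=1..?D. 3 * s i / \<epsilon>)" "basis_box e (\<lambda>_. 0) s \<subseteq> \<Union>\<U>"
    "\<forall>U\<in>\<U>. \<forall>x\<in>U. \<forall>y\<in>U. dist x y \<le> sqrt (real ?D) * \<epsilon>"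
    by (rule basis_box_cover[OF e \<epsilon> s_ge, where p="\<lambda>_. 0"])
  define \<kappa> where "\<kappa> = sqrt (real ?D) * \<epsilon> / \<eta>"
  have \<kappa>: "0 \<le> \<kappa>" using \<epsilon> \<eta> by (simp add: \<kappa>_def)
  \<comment> \<open>A preimage point for each cube; a cube without one gets an arbitrary centre, and
    its ball only enlarges \<open>S\<close>.\<close>
  define z where "z U = (SOME z. h z \<in> U)" for U
  define S where "S = (\<Union>U\<in>\<U>. cball (z U) \<kappa>)"
  show ?thesis
  proof (rule that)
    show "S \<in> sets borel" unfolding S_def using U(1) by (intro sets.finite_UN) auto
    show "{z. norm (h z) \<le> r' \<and> norm (T (h z)) \<le> r} \<subseteq> S"
    proof safe
      fix v assume v: "norm (h v) \<le> r'" "norm (T (h v)) \<le> r"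
      have "\<bar>h v \<bullet> e i - 0\<bar> \<le> s i" if i: "i \<in> {1..?D}" for i
      proof -
        have "norm (e i) = 1" using orthonormal_family_inner[OF e i i] by (simp add: norm_eq_1)
        then have "\<bar>h v \<bullet> e i\<bar> \<le> r'" using Cauchy_Schwarz_ineq2[of "h v" "e i"] v by simp
        moreover have "?sv i * \<bar>h v \<bullet> e i\<bar> \<le> r" using normT[OF i, of "h v"] v by linarith
        then have "\<bar>h v \<bullet> e i\<bar> \<le> r / ?sv i" using sv[OF i] by (simp add: field_simps)
        ultimately show ?thesis by (simp add: s_def)
      qed
      then have "h v \<in> basis_box e (\<lambda>_. 0) s" by (simp add: basis_box_def)
      then obtain U where UU: "U \<in> \<U>" "h v \<in> U" using U(3) by blast
      then have "h (z U) \<in> U" unfolding z_def by (intro someI)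
      then have "norm (h (z U) - h v) \<le> sqrt (real ?D) * \<epsilon>" using U(4) UU by (auto simp: dist_norm)
      then have "\<eta> * norm (z U - v) \<le> sqrt (real ?D) * \<epsilon>" using \<eta>(2)[of "z U" v] by linarith
      then have "v \<in> cball (z U) \<kappa>" using \<eta>(1) by (simp add: \<kappa>_def dist_norm field_simps)
      then show "v \<in> S" using UU by (auto simp: S_def)
    qed
    have "emeasure lborel S \<le> (\<Sum>U\<in>\<U>. emeasure lborel (cball (z U) \<kappa>))"
      unfolding S_def using U(1) by (intro emeasure_subadditive_finite) auto
    also have "\<dots> = ennreal (real (card \<U>) * (unit_ball_vol (real ?D) * \<kappa> ^ ?D))"
      using \<kappa> by (simp add: emeasure_cball ennreal_mult ennreal_of_nat_eq_real_of_nat unit_ball_vol_nonneg)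
    also have "\<dots> \<le> ennreal ((3 * sqrt (real ?D) / \<eta>) ^ ?D * unit_ball_vol (real ?D) *
       (r powr t / sv_function t T * r' powr (real ?D - t)))"
    proof (rule ennreal_leI)
      have "real (card \<U>) * (unit_ball_vol (real ?D) * \<kappa> ^ ?D) \<le>
          (\<Prod>i=1..?D. 3 * s i / \<epsilon>) * (unit_ball_vol (real ?D) * \<kappa> ^ ?D)"
        using U(2) \<kappa> by (intro mult_right_mono mult_nonneg_nonneg) auto
      also have "(\<Prod>i=1..?D. 3 * s i / \<epsilon>) = (3 / \<epsilon>) ^ ?D * (\<Prod>i=1..?D. s i)"
        unfolding prod_dividef prod.distrib by (simp add: power_divide)
      \<comment> \<open>The side \<epsilon> cancels between the number of cubes and the volumes of
        the balls.\<close>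
      also have "(3 / \<epsilon>) ^ ?D * (\<Prod>i=1..?D. s i) * (unit_ball_vol (real ?D) * \<kappa> ^ ?D) =
          ((3 / \<epsilon>) * \<kappa>) ^ ?D * unit_ball_vol (real ?D) * (\<Prod>i=1..?D. s i)"
        unfolding power_mult_distrib by (simp only: mult_ac)
      also have "(3 / \<epsilon>) * \<kappa> = 3 * sqrt (real ?D) / \<eta>" using \<epsilon> by (simp add: \<kappa>_def)
      also have "(3 * sqrt (real ?D) / \<eta>) ^ ?D * unit_ball_vol (real ?D) * (\<Prod>i=1..?D. s i) \<le>
        (3 * sqrt (real ?D) / \<eta>) ^ ?D * unit_ball_vol (real ?D) *
         (r powr t / sv_function t T * r' powr (real ?D - t))"
        using \<eta> prod_min_le_sv_function[OF T t r] unfolding s_def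
        by (intro mult_left_mono mult_nonneg_nonneg) auto
      finally show "real (card \<U>) * (unit_ball_vol (real ?D) * \<kappa> ^ ?D) \<le> (3 * sqrt (real ?D) / \<eta>) ^ ?D *
         unit_ball_vol (real ?D) * (r powr t / sv_function t T * r' powr (real ?D - t))" .
    qed
    finally show "emeasure lborel S \<le> ennreal ((3 * sqrt (real ?D) / \<eta>) ^ ?D * unit_ball_vol (real ?D) *
       (r powr t / sv_function t T * r' powr (real ?D - t)))" .
  qed
qed

section \<open>Collisions of two points with a common prefix\<close>

context affine_code_tree
begin

abbreviation "classes \<equiv> map_indices M // R"

abbreviation "translation_space \<equiv> PiM classes (\<lambda>_. lborel :: 'a measure)"

lemma tree_comp_tree_map_measurable:
  "w \<in> tree_words M \<omega> \<Longrightarrow> (\<lambda>a. tree_comp (tree_map R T a) \<omega> w 0) \<in> borel_measurable translation_space"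
proof (induction w rule: rev_induct)
  case (snoc l w)
  then have w: "w \<in> tree_words M \<omega>" and l: "(\<omega> w, l) \<in> map_indices M"
    by (auto simp: tree_words_snoc_iff map_indices_def)
  let ?c = "R `` {(\<omega> w, l)}"
  have c: "?c \<in> classes" using l by (rule quotientI)
  have "tree_map R T a (\<omega> w) l 0 = a ?c" for a
    by (simp add: tree_map_def linear_0[OF T_linear[OF l]])
  then have eq: "tree_comp (tree_map R T a) \<omega> (w @ [l]) 0 =
      tree_comp (tree_map R T a) \<omega> w 0 + tree_comp T \<omega> w (a ?c)" for a
    using tree_comp_tree_map[OF w, of a "a ?c"] by (simp add: tree_comp_snoc)
  have [measurable]: "tree_comp T \<omega> w \<in> borel_measurable borel"
    by (intro borel_measurable_continuous_onI linear_continuous_on tree_comp_bounded_linear w)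
  have [measurable]: "(\<lambda>a. a ?c) \<in> borel_measurable translation_space"
    using measurable_component_singleton[OF c, of "\<lambda>_. lborel"] by simp
  note [measurable] = snoc.IH[OF w]
  show ?case unfolding eq by measurable
qed simp

lemma tree_point_LIMSEQ:
  "x \<in> tree_boundary M \<omega> \<Longrightarrow>
     (\<lambda>k. tree_comp (tree_map R T a) \<omega> (prefix_word x k) 0) \<longlonglongrightarrow> tree_point R T \<omega> a x"
  using tree_point_sums[of x \<omega> a] by (simp add: tree_comp_tree_map_prefix sums_def)

lemma tree_point_measurable:
  assumes x: "x \<in> tree_boundary M \<omega>"
  shows "(\<lambda>a. tree_point R T \<omega> a x) \<in> borel_measurable translation_space"
  by (rule borel_measurable_LIMSEQ_metric[OF tree_comp_tree_map_measurable[OF boundary_words[OF x]]])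
     (rule tree_point_LIMSEQ[OF x])

text \<open>The coordinate \<open>e\<close> given by transversality is integrated innermost, where
  \<open>expanding_preimage_small\<close> applies; each other coordinate ranges over a ball of
  volume \<open>V\<close>. Although \<open>e\<close> depends on the two points, \<open>K\<close>
  does not, since all the balls have the same radius.\<close>

lemma near_collision_measure:
  assumes \<rho>: "0 < \<rho>" and t: "0 \<le> t" "t < real DIM('a)"
  obtains K where "0 < K"
    "\<And>\<omega> x y n r. x \<in> tree_boundary M \<omega> \<Longrightarrow> y \<in> tree_boundary M \<omega> \<Longrightarrow>
       prefix_word x n = prefix_word y n \<Longrightarrow> x n \<noteq> y n \<Longrightarrow> 0 < r \<Longrightarrow>
       emeasure translation_space {a \<in> PiE classes (\<lambda>_. cball 0 \<rho>).
           dist (tree_point R T \<omega> a x) (tree_point R T \<omega> a y) \<le> r}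
       \<le> ennreal (K * r powr t / sv_function t (tree_comp T \<omega> (prefix_word x n)))"
proof -
  interpret product_sigma_finite "\<lambda>_. lborel :: 'a measure" ..
  let ?D = "DIM('a)"
  define \<eta> where "\<eta> = 1 - \<sigma> / (1 - \<sigma>)"
  have \<eta>: "0 < \<eta>" using sigma by (simp add: \<eta>_def field_simps)
  \<comment> \<open>Bounds the difference of two points of any subtree when all translations have
    norm at most \<rho>.\<close>
  define r' where "r' = 2 * \<rho> / (1 - \<sigma>)"
  have r': "0 < r'" using \<rho> sigma by (simp add: r'_def)
  define C where "C = (3 * sqrt (real ?D) / \<eta>) ^ ?D * unit_ball_vol (real ?D) * r' powr (real ?D - t)"
  have C: "0 < C" using \<eta> r' by (simp add: C_def unit_ball_vol_pos)
  define V where "V = unit_ball_vol (real ?D) * \<rho> ^ ?D"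
  have V: "0 < V" using \<rho> by (simp add: V_def)
  define K where "K = C * V ^ (card classes - 1)"
  have K: "0 < K" using C V by (simp add: K_def)
  show ?thesis
  proof (rule that[OF K])
    fix \<omega> x y n and r :: real
    assume x: "x \<in> tree_boundary M \<omega>" and y: "y \<in> tree_boundary M \<omega>"
      and pre: "prefix_word x n = prefix_word y n" and ne: "x n \<noteq> y n" and r: "0 < r"
    define w where "w = prefix_word x n"
    have w: "w \<in> tree_words M \<omega>" unfolding w_def by (rule boundary_words[OF x])
    note Tw = tree_comp_linear_bound[OF w]
    define \<omega>' where "\<omega>' u = \<omega> (w @ u)" for u
    define x' where "x' i = x (n + i)" for i
    define y' where "y' i = y (n + i)" for i
    have x': "x' \<in> tree_boundary M \<omega>'"
      using tree_boundary_shift[OF x, of n] by (simp add: x'_def[abs_def] \<omega>'_def[abs_def] w_def)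
    have y': "y' \<in> tree_boundary M \<omega>'"
      using tree_boundary_shift[OF y, of n] by (simp add: y'_def[abs_def] \<omega>'_def[abs_def] w_def pre)
    define Y where "Y a = tree_point R T \<omega>' a x' - tree_point R T \<omega>' a y'" for a
    have diff: "tree_point R T \<omega> a x - tree_point R T \<omega> a y = tree_comp T \<omega> w (Y a)" for a
      using tree_point_shift[OF x, of a n] tree_point_shift[OF y, of a n] pre
      by (simp add: Y_def linear_diff[OF Tw(1)[unfolded w_def pre]] x'_def[abs_def] y'_def[abs_def] \<omega>'_def[abs_def] w_def)
    have "x' 0 \<noteq> y' 0" using ne by (simp add: x'_def y'_def)
    then obtain e where e: "e \<in> classes"
      and expand: "\<And>a z z'. \<eta> * norm (z - z') \<le> norm (Y (a(e := z)) - Y (a(e := z')))"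
      using transversality[OF x' y'] unfolding \<eta>_def Y_def by blast
    let ?I = "classes - {e}"
    have I: "finite ?I" "e \<notin> ?I" "classes = insert e ?I" using classes_finite e by auto
    define A where "A = {a \<in> PiE classes (\<lambda>_. cball 0 \<rho>).
           dist (tree_point R T \<omega> a x) (tree_point R T \<omega> a y) \<le> r}"
    have box: "PiE classes (\<lambda>_. cball 0 \<rho>) \<in> sets translation_space"
      using classes_finite by (intro sets_PiM_I_finite) auto
    have A: "A \<in> sets translation_space"
    proof -
      note [measurable] = tree_point_measurable[OF x] tree_point_measurable[OF y] box
      have "{a \<in> space translation_space. a \<in> PiE classes (\<lambda>_. cball 0 \<rho>) \<and>
           dist (tree_point R T \<omega> a x) (tree_point R T \<omega> a y) \<le> r} \<in> sets translation_space"
        by measurable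
      moreover have "{a \<in> space translation_space. a \<in> PiE classes (\<lambda>_. cball 0 \<rho>) \<and>
           dist (tree_point R T \<omega> a x) (tree_point R T \<omega> a y) \<le> r} = A"
        using sets.sets_into_space[OF box] by (auto simp: A_def)
      ultimately show ?thesis by simp
    qed
    define L where "L = C * r powr t / sv_function t (tree_comp T \<omega> w)"
    have "0 < sv_function t (tree_comp T \<omega> w)" by (rule sv_function_pos[OF Tw(1) bij_is_inj[OF Tw(2)] t])
    then have L: "0 \<le> L" using C by (simp add: L_def)
    \<comment> \<open>For fixed other coordinates \<open>b\<close> this measures the admissible
      values of coordinate \<open>e\<close>; it vanishes unless \<open>b\<close> lies in its
      box.\<close>
    have inner: "(\<integral>\<^sup>+z. indicator A (b(e := z)) \<partial>lborel) \<le> ennreal L * indicator (PiE ?I (\<lambda>_. cball 0 \<rho>)) b"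
      if b: "b \<in> space (PiM ?I (\<lambda>_. lborel :: 'a measure))" for b
    proof (cases "b \<in> PiE ?I (\<lambda>_. cball 0 \<rho>)")
      case True
      obtain S where S: "S \<in> sets borel"
        "{z. norm (Y (b(e := z))) \<le> r' \<and> norm (tree_comp T \<omega> w (Y (b(e := z)))) \<le> r} \<subseteq> S"
        "emeasure lborel S \<le> ennreal ((3 * sqrt (real ?D) / \<eta>) ^ ?D * unit_ball_vol (real ?D) *
          (r powr t / sv_function t (tree_comp T \<omega> w) * r' powr (real ?D - t)))"
        by (rule expanding_preimage_small[OF Tw(1) bij_is_inj[OF Tw(2)] t r r' \<eta> expand[of _ _ b]])
      have AS: "b(e := z) \<in> A \<Longrightarrow> z \<in> S" for z
      proof -
        assume "b(e := z) \<in> A"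
        then have a: "\<And>c. c \<in> classes \<Longrightarrow> norm ((b(e := z)) c) \<le> \<rho>"
          and d: "norm (tree_comp T \<omega> w (Y (b(e := z)))) \<le> r"
          unfolding A_def by (auto simp: PiE_iff dist_norm diff simp del: fun_upd_apply)
        have "norm (Y (b(e := z))) \<le> \<rho> / (1 - \<sigma>) + \<rho> / (1 - \<sigma>)"
          unfolding Y_def by (intro norm_triangle_le_diff add_mono norm_tree_point_le x' y' a)
        then have "norm (Y (b(e := z))) \<le> r'" by (simp add: r'_def)
        then show "z \<in> S" using S(2) d by blast
      qed
      have "(\<integral>\<^sup>+z. indicator A (b(e := z)) \<partial>lborel) \<le> (\<integral>\<^sup>+z. indicator S z \<partial>lborel)"
        using AS by (intro nn_integral_mono) (auto simp: indicator_def)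
      also have "\<dots> = emeasure lborel S" using S(1) by (intro nn_integral_indicator) simp
      also have "\<dots> \<le> ennreal L" using S(3) by (simp add: L_def C_def mult_ac)
      finally show ?thesis using True by simp
    next
      case False
      have "b(e := z) \<notin> A" for z
      proof
        assume "b(e := z) \<in> A"
        then have a: "(b(e := z)) c \<in> cball 0 \<rho>" if "c \<in> classes" for c
          using that unfolding A_def PiE_iff by blast
        have "b c \<in> cball 0 \<rho>" if "c \<in> ?I" for c using a[of c] that by auto
        then have "b \<in> PiE ?I (\<lambda>_. cball 0 \<rho>)" using b by (auto simp: space_PiM PiE_iff)
        then show False using False by blast
      qed
      then show ?thesis by simp
    qed
    have boxI: "PiE ?I (\<lambda>_. cball 0 \<rho>) \<in> sets (PiM ?I (\<lambda>_. lborel :: 'a measure))"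
      using I by (intro sets_PiM_I_finite) auto
    have "emeasure translation_space A = (\<integral>\<^sup>+a. indicator A a \<partial>translation_space)" using A by simp
    also have "\<dots> = (\<integral>\<^sup>+a. indicator A a \<partial>PiM (insert e ?I) (\<lambda>_. lborel))" using I(3) by simp
    also have "\<dots> = (\<integral>\<^sup>+b. (\<integral>\<^sup>+z. indicator A (b(e := z)) \<partial>lborel) \<partial>PiM ?I (\<lambda>_. lborel))"
    proof (rule product_nn_integral_insert[OF I(1,2)])
      show "indicator A \<in> borel_measurable (PiM (insert e ?I) (\<lambda>_. lborel :: 'a measure))"
        using A unfolding I(3)[symmetric] by simp
    qed
    also have "\<dots> \<le> (\<integral>\<^sup>+b. ennreal L * indicator (PiE ?I (\<lambda>_. cball 0 \<rho>)) b \<partial>PiM ?I (\<lambda>_. lborel :: 'a measure))"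
      by (intro nn_integral_mono inner)
    also have "\<dots> = ennreal L * emeasure (PiM ?I (\<lambda>_. lborel)) (PiE ?I (\<lambda>_. cball (0::'a) \<rho>))"
      using boxI by (simp add: nn_integral_cmult)
    also have "emeasure (PiM ?I (\<lambda>_. lborel)) (PiE ?I (\<lambda>_. cball (0::'a) \<rho>)) = (\<Prod>c\<in>?I. ennreal V)"
      using I \<rho> by (subst emeasure_PiM) (auto simp: V_def emeasure_cball)
    also have "\<dots> = ennreal (V ^ (card classes - 1))" using V e classes_finite by (simp add: ennreal_power)
    also have "ennreal L * \<dots> = ennreal (K * r powr t / sv_function t (tree_comp T \<omega> w))"
      using L V by (simp add: ennreal_mult[symmetric] L_def K_def mult_ac)
    finally show "emeasure translation_space {a \<in> PiE classes (\<lambda>_. cball 0 \<rho>).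
           dist (tree_point R T \<omega> a x) (tree_point R T \<omega> a y) \<le> r}
       \<le> ennreal (K * r powr t / sv_function t (tree_comp T \<omega> (prefix_word x n)))"
      by (simp add: A_def w_def)
  qed
qed

end

section \<open>The lower bound\<close>

text \<open>Branching is bounded. In the Frostman construction this gives the capacities of short
  words a positive minimum.\<close>

lemma finite_short_tree_words:
  assumes "bdd_above (range M)"
  shows "finite {w \<in> tree_words M \<omega>. length w < j}"
proof -
  obtain m where m: "\<And>l. M l \<le> m" using assms by (auto simp: bdd_above_def)
  have "set w \<subseteq> {1..m}" if "w \<in> tree_words M \<omega>" for w
    using that
  proof (induction w rule: rev_induct)
    case (snoc l w)
    then show ?case using order_trans[OF _ m[of "\<omega> w"]] by (auto simp: tree_words_snoc_iff)
  qed simp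
  then have "{w \<in> tree_words M \<omega>. length w < j} \<subseteq> {w. set w \<subseteq> {1..m} \<and> length w \<le> j}" by auto
  then show ?thesis by (rule finite_subset) (rule finite_lists_length_le, simp)
qed

context affine_code_tree
begin

text \<open>The Frostman measure on the boundary of the tree is the image of \<open>N\<close> under \<open>\<xi>\<close>.\<close>

lemma frostman_measure_exists:
  assumes s: "0 \<le> s" "s < real DIM('a)"
    and nz: "affinity_measure M T \<omega> s (tree_boundary M \<omega>) \<noteq> 0"
  obtains N :: "real measure" and \<xi> :: "real \<Rightarrow> nat \<Rightarrow> nat" where
    "finite_measure N" "emeasure N (space N) > 0" "\<xi> ` space N \<subseteq> tree_boundary M \<omega>"
    "\<forall>n. (\<lambda>u. prefix_word (\<xi> u) n) \<in> measurable N (count_space UNIV)"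
    "\<forall>w\<in>tree_words M \<omega>.
       emeasure N {u \<in> space N. prefix_word (\<xi> u) (length w) = w} \<le> ennreal (sv_function s (tree_comp T \<omega> w))"
proof -
  define c where "c w = sv_function s (tree_comp T \<omega> w)" for w
  have c_pos: "0 < c w" if "w \<in> tree_words M \<omega>" for w
    unfolding c_def using tree_comp_linear_bound[OF that] s by (intro sv_function_pos) (auto intro: bij_is_inj)
  obtain j where j: "affinity_premeasure M T \<omega> s j (tree_boundary M \<omega>) \<noteq> 0"
  proof -
    have "\<exists>j. affinity_premeasure M T \<omega> s j (tree_boundary M \<omega>) \<noteq> 0"
      using nz unfolding affinity_measure_eq_SUP by (rule contrapos_np) simp
    then show ?thesis using that by blast
  qed
  \<comment> \<open>Truncated at 1, as the premeasure may be infinite.\<close>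
  define b where "b = enn2real (min 1 (affinity_premeasure M T \<omega> s j (tree_boundary M \<omega>)))"
  have b_eq: "ennreal b = min 1 (affinity_premeasure M T \<omega> s j (tree_boundary M \<omega>))"
    unfolding b_def by (intro ennreal_enn2real) (auto simp: min_def top_unique less_top[symmetric])
  have b: "0 < b"
  proof (rule ccontr)
    assume "\<not> 0 < b"
    then have "ennreal b = 0" by (simp add: ennreal_neg)
    then show False using j unfolding b_eq by (auto simp: min_def split: if_splits)
  qed
  define short where "short = {w \<in> tree_words M \<omega>. length w < j}"
  have fin: "finite short" unfolding short_def by (rule finite_short_tree_words[OF M_bdd])
  \<comment> \<open>A cut may use words shorter than \<open>j\<close>, about which the premeasure
    says nothing. One such word alone then costs at least the minimum over finitely many positive
    capacities.\<close>
  define \<beta> where "\<beta> = Min (insert b (c ` short))"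
  have \<beta>: "0 < \<beta>" unfolding \<beta>_def using fin b c_pos by (auto simp: short_def)
  have \<beta>_le: "\<beta> \<le> b" "\<And>w. w \<in> short \<Longrightarrow> \<beta> \<le> c w"
    unfolding \<beta>_def using fin by auto
  have cut: "\<beta> \<le> cut_value M \<omega> c n []" for n
  proof -
    have "\<exists>J. finite J \<and> J \<subseteq> tree_words M \<omega> \<and>
        tree_boundary M \<omega> \<subseteq> (\<Union>v\<in>J. cylinder M \<omega> v) \<and> sum c J \<le> cut_value M \<omega> c n []"
      unfolding cylinder_Nil[symmetric] by (rule cut_value_cover[OF _ tree_words.Nil]) (erule c_pos)
    then obtain J where J: "finite J" "J \<subseteq> tree_words M \<omega>" "tree_boundary M \<omega> \<subseteq> (\<Union>v\<in>J. cylinder M \<omega> v)"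
      "sum c J \<le> cut_value M \<omega> c n []"
      by blast
    have cJ: "0 \<le> c v" if "v \<in> J" for v using c_pos J(2) that by (auto intro: less_imp_le)
    have "\<beta> \<le> sum c J"
    proof (cases "\<forall>v\<in>J. j \<le> length v")
      case True
      have "ennreal b \<le> affinity_premeasure M T \<omega> s j (tree_boundary M \<omega>)" unfolding b_eq by simp
      also have "\<dots> \<le> (\<Sum>\<^sub>\<infinity>w\<in>J. ennreal (c w))"
        unfolding affinity_premeasure_def c_def using J True
        by (intro Inf_lower CollectI exI[of _ J] conjI refl) auto
      also have "\<dots> = ennreal (sum c J)" using J(1) cJ by (simp add: sum_ennreal)
      finally have "b \<le> sum c J" using cJ by (subst (asm) ennreal_le_iff) (auto intro: sum_nonneg)
      then show ?thesis using \<beta>_le by simp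
    next
      case False
      then obtain v where v: "v \<in> J" "length v < j" by (auto simp: not_le)
      then have "\<beta> \<le> c v" using J(2) by (intro \<beta>_le) (auto simp: short_def)
      also have "c v \<le> sum c J" using v J(1) cJ by (intro member_le_sum) auto
      finally show ?thesis .
    qed
    then show ?thesis using J(4) by simp
  qed
  have "\<exists>\<theta>. 0 < \<theta> [] \<and> (\<forall>w\<in>tree_words M \<omega>. 0 \<le> \<theta> w \<and> \<theta> w \<le> c w \<and>
      \<theta> w = (\<Sum>l=1..M (\<omega> w). \<theta> (w @ [l])))"
    by (rule tree_flow_exists[of M \<omega> c, OF _ \<beta> cut]) (erule c_pos, blast)
  then obtain \<theta> where \<theta>: "0 < \<theta> []" "\<And>w. w \<in> tree_words M \<omega> \<Longrightarrow> 0 \<le> \<theta> w"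
    "\<And>w. w \<in> tree_words M \<omega> \<Longrightarrow> \<theta> w \<le> c w"
    "\<And>w. w \<in> tree_words M \<omega> \<Longrightarrow> \<theta> w = (\<Sum>l=1..M (\<omega> w). \<theta> (w @ [l]))"
    by blast
  define N where "N = restrict_space lborel {0..<\<theta> []}"
  define \<xi> where "\<xi> = interval_point M \<omega> \<theta>"
  have spN: "space N = {0..<\<theta> []}" by (simp add: N_def space_restrict_space)
  have cyl: "{u \<in> space N. prefix_word (\<xi> u) (length w) = w} = word_interval \<theta> w" if "w \<in> tree_words M \<omega>" for w
    unfolding spN \<xi>_def
    by (rule interval_point_cylinder) (erule \<theta>(2), erule \<theta>(4), rule that)
  have sub: "word_interval \<theta> w \<subseteq> {0..<\<theta> []}" if "w \<in> tree_words M \<omega>" for w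
    using cyl[OF that] spN by auto
  have bnd: "\<xi> ` space N \<subseteq> tree_boundary M \<omega>"
  proof safe
    fix u assume "u \<in> space N"
    then show "\<xi> u \<in> tree_boundary M \<omega>"
      unfolding spN \<xi>_def by (rule interval_point_boundary[rotated 2]) (erule \<theta>(2), erule \<theta>(4))
  qed
  have emN: "emeasure N (word_interval \<theta> w) = ennreal (\<theta> w)" if "w \<in> tree_words M \<omega>" for w
    unfolding N_def using sub[OF that] \<theta>(2)[OF that]
    by (subst emeasure_restrict_space) (auto simp: word_interval_def)
  have setN: "word_interval \<theta> w \<in> sets N" if "w \<in> tree_words M \<omega>" for w
    unfolding N_def using sub[OF that] by (subst sets_restrict_space_iff) (auto simp: word_interval_def)
  show ?thesis
  proof (rule that[OF _ _ bnd])
    have em: "emeasure N (space N) = ennreal (\<theta> [])"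
      unfolding spN unfolding N_def using \<theta>(1) by (subst emeasure_restrict_space) auto
    then show "finite_measure N" by (intro finite_measureI) simp
    show "emeasure N (space N) > 0" using em \<theta>(1) by simp
    \<comment> \<open>There are countably many words, so preimages of single words suffice, and
      these are intervals or empty.\<close>
    show "\<forall>n. (\<lambda>u. prefix_word (\<xi> u) n) \<in> measurable N (count_space UNIV)"
    proof (intro allI, subst measurable_count_space_eq2_countable, intro conjI ballI)
      fix n and w :: "nat list"
      show "(\<lambda>u. prefix_word (\<xi> u) n) -` {w} \<inter> space N \<in> sets N"
      proof (cases "w \<in> tree_words M \<omega> \<and> length w = n")
        case True
        then have "(\<lambda>u. prefix_word (\<xi> u) n) -` {w} \<inter> space N = word_interval \<theta> w"
          using cyl[of w] by auto
        then show ?thesis using True setN by simp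
      next
        case False
        then have "(\<lambda>u. prefix_word (\<xi> u) n) -` {w} \<inter> space N = {}"
          using bnd boundary_words by fastforce
        then show ?thesis by simp
      qed
    qed auto
    show "\<forall>w\<in>tree_words M \<omega>.
       emeasure N {u \<in> space N. prefix_word (\<xi> u) (length w) = w} \<le> ennreal (sv_function s (tree_comp T \<omega> w))"
    proof
      fix w assume w: "w \<in> tree_words M \<omega>"
      show "emeasure N {u \<in> space N. prefix_word (\<xi> u) (length w) = w} \<le> ennreal (sv_function s (tree_comp T \<omega> w))"
        using \<theta>(3)[OF w] unfolding cyl[OF w] emN[OF w] c_def by (rule ennreal_leI)
    qed
  qed
qed

text \<open>Comparison with exponent 0, where the product is 1. In the energy estimate it makes the
  series over levels diverge for points with the same address.\<close>

lemma sv_function_le_1: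
  assumes "w \<in> tree_words M \<omega>" "0 \<le> t" "t < real DIM('a)"
  shows "sv_function t (tree_comp T \<omega> w) \<le> 1"
proof -
  note Tw = tree_comp_linear_bound[OF assms(1)]
  have q: "0 < \<sigma> ^ length w" "\<sigma> ^ length w \<le> 1" using sigma by (auto intro: power_le_one)
  have "sv_function t (tree_comp T \<omega> w) \<le> sv_function 0 (tree_comp T \<omega> w) * (\<sigma> ^ length w) powr (t - 0)"
    using assms q by (intro sv_function_le Tw bij_is_inj) auto
  also have "sv_function 0 (tree_comp T \<omega> w) = 1"
  proof -
    have one: "singular_value (tree_comp T \<omega> w) j powr sv_exponent 0 j = 1" if j: "j \<in> {1..DIM('a)}" for j
    proof -
      have "sv_exponent 0 j = 0" using j by (simp add: sv_exponent_def)
      then show ?thesis using singular_value_pos[OF Tw(1) bij_is_inj[OF Tw(2)] j] by simp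
    qed
    have "sv_function 0 (tree_comp T \<omega> w) =
        (\<Prod>j=1..DIM('a). singular_value (tree_comp T \<omega> w) j powr sv_exponent 0 j)"
      by (rule sv_function_eq_prod[OF Tw(1) bij_is_inj[OF Tw(2)]]) auto
    also have "\<dots> = 1" by (intro prod.neutral ballI one)
    finally show ?thesis .
  qed
  also have "1 * (\<sigma> ^ length w) powr (t - 0) \<le> 1" using q assms by (simp add: powr_le1)
  finally show ?thesis .
qed

lemma ennreal_le_suminf: "f n \<le> (\<Sum>n. f n)" for f :: "nat \<Rightarrow> ennreal"
  using sum_le_suminf[of f "{n}"] by simp

lemma ennreal_suminf_eq_top:
  fixes f :: "nat \<Rightarrow> ennreal"
  assumes "0 < c" "\<And>n. ennreal c \<le> f n"
  shows "(\<Sum>n. f n) = \<infinity>"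
proof (rule ccontr)
  assume "(\<Sum>n. f n) \<noteq> \<infinity>"
  then obtain S where S: "0 \<le> S" "(\<Sum>n. f n) = ennreal S" by (cases "\<Sum>n. f n") auto
  have "real m * c \<le> S" for m
  proof -
    have "ennreal (real m * c) = (\<Sum>n<m. ennreal c)"
      using assms(1) by (simp add: ennreal_mult ennreal_of_nat_eq_real_of_nat)
    also have "\<dots> \<le> (\<Sum>n<m. f n)" by (intro sum_mono assms(2))
    also have "\<dots> \<le> (\<Sum>n. f n)" by (rule sum_le_suminf) auto
    finally show ?thesis unfolding S(2) using S(1) by simp
  qed
  moreover obtain m where "S < real m * c" using reals_Archimedean3[OF assms(1)] by blast
  ultimately show False using not_le by blast
qed

lemma ennreal_suminf_geometric_finite:
  assumes "0 \<le> q" "q < 1" "0 \<le> c"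
  shows "(\<Sum>n. ennreal (c * q ^ n)) < \<infinity>"
proof -
  have "summable (\<lambda>n. c * q ^ n)" using assms by (intro summable_mult summable_geometric) auto
  then have "(\<Sum>n. ennreal (c * q ^ n)) = ennreal (\<Sum>n. c * q ^ n)"
    using assms by (intro suminf_ennreal2) auto
  then show ?thesis by simp
qed

section \<open>Energies of random points\<close>

context
  fixes \<omega> :: "nat list \<Rightarrow> 'l" and N :: "real measure" and \<xi> :: "real \<Rightarrow> nat \<Rightarrow> nat"
  assumes finN: "finite_measure N" and \<xi>: "\<xi> ` space N \<subseteq> tree_boundary M \<omega>"
    and pre: "\<And>n. (\<lambda>u. prefix_word (\<xi> u) n) \<in> measurable N (count_space UNIV)"
begin

text \<open>The partial compositions depend on the second variable only through one of countably
  many words, and for a fixed tree word they are measurable in \<open>a\<close>; the point is their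
  limit.\<close>

lemma random_tree_point_measurable:
  "(\<lambda>x. tree_point R T \<omega> (fst x) (\<xi> (snd x))) \<in> borel_measurable (translation_space \<Otimes>\<^sub>M N)"
proof (rule borel_measurable_LIMSEQ_metric)
  fix k
  \<comment> \<open>0 is a default off the tree, where measurability is not at hand; all prefixes
    that occur are tree words.\<close>
  let ?G = "\<lambda>w x. if w \<in> tree_words M \<omega> then tree_comp (tree_map R T (fst x)) \<omega> w 0 else 0"
  have G: "?G w \<in> borel_measurable (translation_space \<Otimes>\<^sub>M N)" for w
  proof (cases "w \<in> tree_words M \<omega>")
    case True
    have "(\<lambda>x. tree_comp (tree_map R T (fst x)) \<omega> w 0) \<in> borel_measurable (translation_space \<Otimes>\<^sub>M N)"
      by (rule measurable_compose[OF measurable_fst tree_comp_tree_map_measurable[OF True]])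
    then show ?thesis using True by simp
  qed simp
  have "(\<lambda>x. ?G (prefix_word (\<xi> (snd x)) k) x) \<in> borel_measurable (translation_space \<Otimes>\<^sub>M N)"
    by (rule measurable_compose_countable[OF G measurable_compose[OF measurable_snd pre]])
  then show "(\<lambda>x. tree_comp (tree_map R T (fst x)) \<omega> (prefix_word (\<xi> (snd x)) k) 0)
      \<in> borel_measurable (translation_space \<Otimes>\<^sub>M N)"
    by (rule measurable_cong[THEN iffD1, rotated])
       (use \<xi> boundary_words in \<open>auto simp: space_pair_measure\<close>)
next
  fix x assume "x \<in> space (translation_space \<Otimes>\<^sub>M N)"
  then show "(\<lambda>k. tree_comp (tree_map R T (fst x)) \<omega> (prefix_word (\<xi> (snd x)) k) 0)
      \<longlonglongrightarrow> tree_point R T \<omega> (fst x) (\<xi> (snd x))"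
    using \<xi> by (intro tree_point_LIMSEQ) (auto simp: space_pair_measure)
qed

text \<open>Integration over \<open>a\<close> comes first and turns near collisions into powers of
  the distance. At level n the Frostman bound offsets the singular value function in the denominator
  and leaves \<open>q ^ n\<close>; the sum over scales has ratio
  \<open>2 powr (t' - t)\<close>.\<close>

lemma energy_finite:
  assumes \<rho>: "0 < \<rho>" and ts: "0 < t'" "t' < t" "t < s" "s < real DIM('a)"
    and frost: "\<And>w. w \<in> tree_words M \<omega> \<Longrightarrow>
       emeasure N {u \<in> space N. prefix_word (\<xi> u) (length w) = w} \<le> ennreal (sv_function s (tree_comp T \<omega> w))"
  shows "AE a in translation_space. a \<in> PiE classes (\<lambda>_. cball 0 \<rho>) \<longrightarrow>
    (\<integral>\<^sup>+u. (\<Sum>k. ennreal (2 powr (real k * t')) *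
       emeasure N {v\<in>space N. dist (tree_point R T \<omega> a (\<xi> u)) (tree_point R T \<omega> a (\<xi> v)) \<le> (1/2)^k}) \<partial>N) < \<infinity>"
proof -
  interpret N: finite_measure N by (rule finN)
  interpret PS: product_sigma_finite "\<lambda>_. lborel :: 'a measure" ..
  interpret P: sigma_finite_measure translation_space by (rule PS.sigma_finite[OF classes_finite])
  interpret NN: pair_sigma_finite N N by unfold_locales
  interpret PN: pair_sigma_finite translation_space "N \<Otimes>\<^sub>M N"
    by (intro pair_sigma_finite.intro P.sigma_finite_measure_axioms NN.sigma_finite_measure_axioms)
  let ?B = "PiE classes (\<lambda>_. cball (0::'a) \<rho>)" and ?Z = "\<lambda>a u. tree_point R T \<omega> a (\<xi> u)"
  have t: "0 \<le> t" "t < real DIM('a)" using ts by auto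
  obtain K where K: "0 < K"
    "\<And>\<omega> x y n r. x \<in> tree_boundary M \<omega> \<Longrightarrow> y \<in> tree_boundary M \<omega> \<Longrightarrow>
       prefix_word x n = prefix_word y n \<Longrightarrow> x n \<noteq> y n \<Longrightarrow> 0 < r \<Longrightarrow>
       emeasure translation_space {a \<in> PiE classes (\<lambda>_. cball 0 \<rho>).
           dist (tree_point R T \<omega> a x) (tree_point R T \<omega> a y) \<le> r}
       \<le> ennreal (K * r powr t / sv_function t (tree_comp T \<omega> (prefix_word x n)))"
    using near_collision_measure[OF \<rho> t] by blast
  have box[measurable]: "?B \<in> sets translation_space"
    using classes_finite by (intro sets_PiM_I_finite) auto
  define f where "f k a p = (indicator {x \<in> space (translation_space \<Otimes>\<^sub>M (N \<Otimes>\<^sub>M N)). fst x \<in> ?B \<and>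
      dist (?Z (fst x) (fst (snd x))) (?Z (fst x) (snd (snd x))) \<le> (1/2)^k} (a, p) :: ennreal)"
    for k :: nat and a p
  have f [measurable]: "(\<lambda>x. f k (fst x) (snd x)) \<in> borel_measurable (translation_space \<Otimes>\<^sub>M (N \<Otimes>\<^sub>M N))" for k
  proof -
    have [measurable]: "(\<lambda>x. ?Z (fst x) (fst (snd x))) \<in> borel_measurable (translation_space \<Otimes>\<^sub>M (N \<Otimes>\<^sub>M N))"
      using measurable_compose[OF _ random_tree_point_measurable,
          of "\<lambda>x. (fst x, fst (snd x))" "translation_space \<Otimes>\<^sub>M (N \<Otimes>\<^sub>M N)"] by simp
    have [measurable]: "(\<lambda>x. ?Z (fst x) (snd (snd x))) \<in> borel_measurable (translation_space \<Otimes>\<^sub>M (N \<Otimes>\<^sub>M N))"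
      using measurable_compose[OF _ random_tree_point_measurable,
          of "\<lambda>x. (fst x, snd (snd x))" "translation_space \<Otimes>\<^sub>M (N \<Otimes>\<^sub>M N)"] by simp
    show ?thesis unfolding f_def by simp
  qed
  have f_eq: "f k a (u, v) = indicator ?B a * indicator {v \<in> space N. dist (?Z a u) (?Z a v) \<le> (1/2)^k} v"
    if "a \<in> space translation_space" "u \<in> space N" "v \<in> space N" for k a u v
    using that by (auto simp: f_def space_pair_measure indicator_def)
  define \<Phi> where "\<Phi> n u = sv_function t (tree_comp T \<omega> (prefix_word (\<xi> u) n))" for n u
  have word: "prefix_word (\<xi> u) n \<in> tree_words M \<omega>" if "u \<in> space N" for u n
    using that \<xi> by (intro boundary_words) auto
  have \<Phi>: "0 < \<Phi> n u" "\<Phi> n u \<le> 1" if "u \<in> space N" for n u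
    unfolding \<Phi>_def using tree_comp_linear_bound[OF word[OF that]] t
    by (auto intro!: sv_function_pos sv_function_le_1 word[OF that] bij_is_inj)
  define r where "r k = (1/2 :: real) ^ k" for k
  have r: "0 < r k" for k by (simp add: r_def)
  \<comment> \<open>Summing over all common prefixes, not only the longest one, gives a sum of
    cylinder indicators, which are measurable and obey the Frostman bound.\<close>
  have pair: "(\<integral>\<^sup>+a. f k a (u, v) \<partial>translation_space) \<le>
      (\<Sum>n. ennreal (K * r k powr t / \<Phi> n u) * indicator {v \<in> space N. prefix_word (\<xi> v) n = prefix_word (\<xi> u) n} v)"
    if u: "u \<in> space N" and v: "v \<in> space N" for u v k
  proof (cases "\<xi> u = \<xi> v")
    case True
    \<comment> \<open>For equal addresses no term is below \<open>K * r k powr t\<close>, so the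
      right side is infinite and the bound is trivial. Its integral is nevertheless finite, which
      takes care of the diagonal.\<close>
    have "K * r k powr t \<le> K * r k powr t / \<Phi> n u" for n
      using \<Phi>[OF u, of n] K(1) by (simp add: le_divide_eq mult_left_le)
    then have "(\<Sum>n. ennreal (K * r k powr t / \<Phi> n u) *
        indicator {v \<in> space N. prefix_word (\<xi> v) n = prefix_word (\<xi> u) n} v) = \<infinity>"
      using True v K(1) r[of k] by (intro ennreal_suminf_eq_top[of "K * r k powr t"]) (auto intro: ennreal_leI)
    then show ?thesis by simp
  next
    case False
    then have ex: "\<exists>n. \<xi> u n \<noteq> \<xi> v n" by auto
    define n where "n = (LEAST n. \<xi> u n \<noteq> \<xi> v n)"
    have n: "\<xi> u n \<noteq> \<xi> v n" unfolding n_def using ex by (rule LeastI_ex)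
    have "\<xi> u i = \<xi> v i" if "i < n" for i using not_less_Least[of i "\<lambda>n. \<xi> u n \<noteq> \<xi> v n"] that by (simp add: n_def)
    then have pre_eq: "prefix_word (\<xi> u) n = prefix_word (\<xi> v) n" by (simp add: prefix_word_cong)
    have "(\<integral>\<^sup>+a. f k a (u, v) \<partial>translation_space) =
        (\<integral>\<^sup>+a. indicator {a \<in> ?B. dist (?Z a u) (?Z a v) \<le> r k} a \<partial>translation_space)"
      using u v by (intro nn_integral_cong) (auto simp: f_eq r_def indicator_def)
    also have "\<dots> = emeasure translation_space {a \<in> ?B. dist (?Z a u) (?Z a v) \<le> r k}"
    proof (rule nn_integral_indicator)
      have \<xi>u: "\<xi> u \<in> tree_boundary M \<omega>" "\<xi> v \<in> tree_boundary M \<omega>" using \<xi> u v by auto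
      note [measurable] = tree_point_measurable[OF \<xi>u(1)] tree_point_measurable[OF \<xi>u(2)]
      have "{a \<in> space translation_space. a \<in> ?B \<and> dist (?Z a u) (?Z a v) \<le> r k} \<in> sets translation_space" by measurable
      moreover have "{a \<in> space translation_space. a \<in> ?B \<and> dist (?Z a u) (?Z a v) \<le> r k} =
          {a \<in> ?B. dist (?Z a u) (?Z a v) \<le> r k}" using sets.sets_into_space[OF box] by auto
      ultimately show "{a \<in> ?B. dist (?Z a u) (?Z a v) \<le> r k} \<in> sets translation_space" by simp
    qed
    also have "\<dots> \<le> ennreal (K * r k powr t / \<Phi> n u)"
      unfolding \<Phi>_def using \<xi> u v by (intro K(2) pre_eq n r) auto
    also have "\<dots> = ennreal (K * r k powr t / \<Phi> n u) * indicator {v \<in> space N. prefix_word (\<xi> v) n = prefix_word (\<xi> u) n} v"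
      using v pre_eq by simp
    also have "\<dots> \<le> (\<Sum>n. ennreal (K * r k powr t / \<Phi> n u) * indicator {v \<in> space N. prefix_word (\<xi> v) n = prefix_word (\<xi> u) n} v)"
      by (rule ennreal_le_suminf[of "\<lambda>n. ennreal (K * r k powr t / \<Phi> n u) *
          indicator {v \<in> space N. prefix_word (\<xi> v) n = prefix_word (\<xi> u) n} v" n])
    finally show ?thesis .
  qed
  \<comment> \<open>The contraction gained per letter when the exponent drops from \<open>s\<close>
    to \<open>t\<close>.\<close>
  define q where "q = \<sigma> powr (s - t)"
  have q: "0 \<le> q" "q < 1" using sigma ts powr_less_mono2[of "s - t" \<sigma> 1] by (auto simp: q_def)
  define L where "L = (\<Sum>n. ennreal (K * q ^ n)) * emeasure N (space N)"
  have L: "L < \<infinity>"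
  proof -
    have "emeasure N (space N) < top" using N.emeasure_finite[of "space N"] by (simp only: less_top[symmetric]) simp
    then show ?thesis
      unfolding L_def using ennreal_suminf_geometric_finite[OF q, of K] K(1)
      by (simp add: ennreal_mult_less_top)
  qed
  have cylN: "{v \<in> space N. prefix_word (\<xi> v) n = w} \<in> sets N" for n w
  proof -
    note [measurable] = pre[of n]
    show ?thesis by measurable
  qed
  have bound: "(\<integral>\<^sup>+a. (\<integral>\<^sup>+p. f k a p \<partial>(N \<Otimes>\<^sub>M N)) \<partial>translation_space) \<le> ennreal (r k powr t) * L" for k
  proof -
    have "(\<integral>\<^sup>+a. (\<integral>\<^sup>+p. f k a p \<partial>(N \<Otimes>\<^sub>M N)) \<partial>translation_space) =
        (\<integral>\<^sup>+p. (\<integral>\<^sup>+a. f k a p \<partial>translation_space) \<partial>(N \<Otimes>\<^sub>M N))"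
      using f[of k] by (intro PN.Fubini'[symmetric]) (simp add: split_beta')
    also have "\<dots> = (\<integral>\<^sup>+u. (\<integral>\<^sup>+v. (\<integral>\<^sup>+a. f k a (u, v) \<partial>translation_space) \<partial>N) \<partial>N)"
    proof (rule N.nn_integral_fst[symmetric])
      have "(\<lambda>x. f k (snd x) (fst x)) \<in> borel_measurable ((N \<Otimes>\<^sub>M N) \<Otimes>\<^sub>M translation_space)"
        using measurable_compose[OF measurable_pair_swap' f[of k]] by (simp add: split_beta' comp_def)
      then show "(\<lambda>p. \<integral>\<^sup>+a. f k a p \<partial>translation_space) \<in> borel_measurable (N \<Otimes>\<^sub>M N)"
        by (intro P.borel_measurable_nn_integral) (simp add: split_beta')
    qed
    also have "\<dots> \<le> (\<integral>\<^sup>+u. ennreal (r k powr t) * (\<Sum>n. ennreal (K * q ^ n)) \<partial>N)"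
    proof (rule nn_integral_mono)
      fix u assume u: "u \<in> space N"
      have "(\<integral>\<^sup>+v. (\<integral>\<^sup>+a. f k a (u, v) \<partial>translation_space) \<partial>N) \<le>
        (\<integral>\<^sup>+v. (\<Sum>n. ennreal (K * r k powr t / \<Phi> n u) * indicator {v \<in> space N. prefix_word (\<xi> v) n = prefix_word (\<xi> u) n} v) \<partial>N)"
        by (intro nn_integral_mono pair u)
      also have "\<dots> = (\<Sum>n. \<integral>\<^sup>+v. ennreal (K * r k powr t / \<Phi> n u) * indicator {v \<in> space N. prefix_word (\<xi> v) n = prefix_word (\<xi> u) n} v \<partial>N)"
        by (intro nn_integral_suminf borel_measurable_times_ennreal borel_measurable_const borel_measurable_indicator cylN)
      also have "\<dots> = (\<Sum>n. ennreal (K * r k powr t / \<Phi> n u) * emeasure N {v \<in> space N. prefix_word (\<xi> v) n = prefix_word (\<xi> u) n})"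
        using cylN by (simp add: nn_integral_cmult_indicator)
      also have "\<dots> \<le> (\<Sum>n. ennreal (r k powr t) * ennreal (K * q ^ n))"
      proof (rule suminf_le)
        fix n
        let ?w = "prefix_word (\<xi> u) n"
        note Tw = tree_comp_linear_bound[OF word[OF u, of n]]
        have "emeasure N {v \<in> space N. prefix_word (\<xi> v) n = ?w} \<le> ennreal (sv_function s (tree_comp T \<omega> ?w))"
          using frost[OF word[OF u, of n]] by simp
        also have "\<dots> \<le> ennreal (\<Phi> n u * q ^ n)"
        proof (rule ennreal_leI)
          have "sv_function s (tree_comp T \<omega> ?w) \<le> sv_function t (tree_comp T \<omega> ?w) * (\<sigma> ^ n) powr (s - t)"
            using Tw ts t sigma by (intro sv_function_le bij_is_inj) auto
          also have "(\<sigma> ^ n) powr (s - t) = q ^ n"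
            using sigma by (simp add: q_def powr_power powr_realpow[symmetric] powr_powr mult.commute)
          finally show "sv_function s (tree_comp T \<omega> ?w) \<le> \<Phi> n u * q ^ n" by (simp add: \<Phi>_def)
        qed
        finally have "ennreal (K * r k powr t / \<Phi> n u) * emeasure N {v \<in> space N. prefix_word (\<xi> v) n = ?w}
            \<le> ennreal (K * r k powr t / \<Phi> n u) * ennreal (\<Phi> n u * q ^ n)" by (rule mult_left_mono) simp
        also have "\<dots> = ennreal (r k powr t) * ennreal (K * q ^ n)"
          using \<Phi>(1)[OF u, of n] K(1) q by (simp add: ennreal_mult[symmetric] mult_ac)
        finally show "ennreal (K * r k powr t / \<Phi> n u) * emeasure N {v \<in> space N. prefix_word (\<xi> v) n = ?w}
            \<le> ennreal (r k powr t) * ennreal (K * q ^ n)" .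
      qed auto
      also have "\<dots> = ennreal (r k powr t) * (\<Sum>n. ennreal (K * q ^ n))" by simp
      finally show "(\<integral>\<^sup>+v. (\<integral>\<^sup>+a. f k a (u, v) \<partial>translation_space) \<partial>N) \<le> ennreal (r k powr t) * (\<Sum>n. ennreal (K * q ^ n))" .
    qed
    also have "\<dots> = ennreal (r k powr t) * L" by (simp add: L_def mult.assoc)
    finally show ?thesis .
  qed
  have Gm: "(\<lambda>a. \<integral>\<^sup>+p. f k a p \<partial>(N \<Otimes>\<^sub>M N)) \<in> borel_measurable translation_space" for k
    using f[of k] by (intro NN.borel_measurable_nn_integral) (simp add: split_beta')
  define E where "E a = (\<Sum>k. ennreal (2 powr (real k * t')) * (\<integral>\<^sup>+p. f k a p \<partial>(N \<Otimes>\<^sub>M N)))" for a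
  have E [measurable]: "E \<in> borel_measurable translation_space"
    unfolding E_def[abs_def] using Gm[measurable] by measurable
  have "(\<integral>\<^sup>+a. E a \<partial>translation_space) =
      (\<Sum>k. \<integral>\<^sup>+a. ennreal (2 powr (real k * t')) * (\<integral>\<^sup>+p. f k a p \<partial>(N \<Otimes>\<^sub>M N)) \<partial>translation_space)"
    unfolding E_def by (intro nn_integral_suminf borel_measurable_times_ennreal borel_measurable_const Gm)
  also have "\<dots> = (\<Sum>k. ennreal (2 powr (real k * t')) * (\<integral>\<^sup>+a. (\<integral>\<^sup>+p. f k a p \<partial>(N \<Otimes>\<^sub>M N)) \<partial>translation_space))"
    using Gm by (simp add: nn_integral_cmult)
  also have "\<dots> \<le> (\<Sum>k. ennreal (1 * (2 powr (t' - t)) ^ k) * L)"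
  proof (rule suminf_le)
    fix k
    have "ennreal (2 powr (real k * t')) * (\<integral>\<^sup>+a. (\<integral>\<^sup>+p. f k a p \<partial>(N \<Otimes>\<^sub>M N)) \<partial>translation_space) \<le>
        ennreal (2 powr (real k * t')) * (ennreal (r k powr t) * L)"
      by (intro mult_left_mono bound) simp
    also have "\<dots> = ennreal (2 powr (real k * t') * r k powr t) * L"
      by (simp add: ennreal_mult mult.assoc)
    also have "r k = 2 powr (- real k)"
      by (simp add: r_def powr_minus powr_realpow power_one_over inverse_eq_divide)
    then have "2 powr (real k * t') * r k powr t = 1 * (2 powr (t' - t)) ^ k"
      by (simp add: powr_powr powr_power powr_add[symmetric] algebra_simps)
    finally show "ennreal (2 powr (real k * t')) * (\<integral>\<^sup>+a. (\<integral>\<^sup>+p. f k a p \<partial>(N \<Otimes>\<^sub>M N)) \<partial>translation_space) \<le>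
        ennreal (1 * (2 powr (t' - t)) ^ k) * L" .
  qed auto
  also have "\<dots> = (\<Sum>k. ennreal (1 * (2 powr (t' - t)) ^ k)) * L" by (rule ennreal_suminf_multc)
  also have "\<dots> < \<infinity>"
  proof -
    have "(\<Sum>k. ennreal (1 * (2 powr (t' - t)) ^ k)) < \<infinity>"
      using ts by (intro ennreal_suminf_geometric_finite) (auto simp: powr_less_one)
    then show ?thesis using L by (simp add: ennreal_mult_less_top)
  qed
  finally have "AE a in translation_space. E a \<noteq> \<infinity>" by (intro nn_integral_PInf_AE E) auto
  then show ?thesis
  proof (rule AE_mp, intro AE_I2 impI)
    fix a assume a: "a \<in> space translation_space" and Ea: "E a \<noteq> \<infinity>" and aB: "a \<in> ?B"
    have g [measurable]: "?Z a \<in> borel_measurable N"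
      using measurable_compose[OF measurable_Pair1'[OF a] random_tree_point_measurable] by simp
    have emm: "(\<lambda>u. emeasure N {v\<in>space N. dist (?Z a u) (?Z a v) \<le> (1/2)^k}) \<in> borel_measurable N" for k
    proof -
      have "{x \<in> space (N \<Otimes>\<^sub>M N). dist (?Z a (fst x)) (?Z a (snd x)) \<le> (1/2)^k} \<in> sets (N \<Otimes>\<^sub>M N)" by measurable
      from N.measurable_emeasure_Pair[OF this] show ?thesis
        by (rule measurable_cong[THEN iffD1, rotated])
           (auto simp: space_pair_measure intro!: arg_cong[where f="emeasure N"])
    qed
    \<comment> \<open>Inside the box the factor \<open>indicator ?B a\<close> is 1, so the double
      integral over \<open>N\<close> is the integral of the ball masses.\<close>
    have inner: "(\<integral>\<^sup>+p. f k a p \<partial>(N \<Otimes>\<^sub>M N)) =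
        (\<integral>\<^sup>+u. emeasure N {v\<in>space N. dist (?Z a u) (?Z a v) \<le> (1/2)^k} \<partial>N)" for k
    proof -
      have "(\<integral>\<^sup>+p. f k a p \<partial>(N \<Otimes>\<^sub>M N)) = (\<integral>\<^sup>+u. \<integral>\<^sup>+v. f k a (u, v) \<partial>N \<partial>N)"
        using measurable_compose[OF measurable_Pair1'[OF a] f[of k]]
        by (intro N.nn_integral_fst[symmetric]) simp
      also have "\<dots> = (\<integral>\<^sup>+u. emeasure N {v\<in>space N. dist (?Z a u) (?Z a v) \<le> (1/2)^k} \<partial>N)"
      proof (rule nn_integral_cong)
        fix u assume u: "u \<in> space N"
        have "(\<integral>\<^sup>+v. f k a (u, v) \<partial>N) = (\<integral>\<^sup>+v. indicator {v\<in>space N. dist (?Z a u) (?Z a v) \<le> (1/2)^k} v \<partial>N)"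
          using a u aB by (intro nn_integral_cong) (simp add: f_eq)
        then show "(\<integral>\<^sup>+v. f k a (u, v) \<partial>N) = emeasure N {v\<in>space N. dist (?Z a u) (?Z a v) \<le> (1/2)^k}"
          by (simp add: nn_integral_indicator)
      qed
      finally show ?thesis .
    qed
    have "(\<integral>\<^sup>+u. (\<Sum>k. ennreal (2 powr (real k * t')) *
       emeasure N {v\<in>space N. dist (?Z a u) (?Z a v) \<le> (1/2)^k}) \<partial>N) = E a"
      unfolding E_def inner using emm
      by (subst nn_integral_suminf) (auto simp: nn_integral_cmult)
    then show "(\<integral>\<^sup>+u. (\<Sum>k. ennreal (2 powr (real k * t')) *
       emeasure N {v\<in>space N. dist (?Z a u) (?Z a v) \<le> (1/2)^k}) \<partial>N) < \<infinity>"
      using Ea by (simp add: less_top)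
  qed
qed

end

section \<open>Almost sure dimension\<close>

lemma hausdorff_dim_ge_AE:
  assumes t': "0 < t'" "ereal t' < min (ereal (real DIM('a))) (affinity_dim M T \<omega>)"
  shows "AE a in translation_space. ereal t' \<le> hausdorff_dim (code_tree_fractal M R T \<omega> a)"
proof -
  obtain s where s: "ereal t' < ereal s" "ereal s < min (ereal (real DIM('a))) (affinity_dim M T \<omega>)"
    using ereal_dense2[OF t'(2)] by blast
  then have s': "t' < s" "0 \<le> s" "s < real DIM('a)" "ereal s < affinity_dim M T \<omega>" using t'(1) by auto
  \<comment> \<open>Leaves room on both sides: \<open>t < s\<close> for the sum over words,
    \<open>t' < t\<close> for the sum over scales.\<close>
  define t where "t = (t' + s) / 2"
  have t: "t' < t" "t < s" using s'(1) by (auto simp: t_def)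
  have "affinity_measure M T \<omega> s (tree_boundary M \<omega>) \<noteq> 0"
  proof
    assume "affinity_measure M T \<omega> s (tree_boundary M \<omega>) = 0"
    then have "affinity_dim M T \<omega> \<le> ereal s"
      unfolding affinity_dim_def using s'(2) by (intro Inf_lower) auto
    then show False using s'(4) by simp
  qed
  then obtain N :: "real measure" and \<xi> :: "real \<Rightarrow> nat \<Rightarrow> nat" where N:
    "finite_measure N" "emeasure N (space N) > 0" "\<xi> ` space N \<subseteq> tree_boundary M \<omega>"
    "\<forall>n. (\<lambda>u. prefix_word (\<xi> u) n) \<in> measurable N (count_space UNIV)"
    "\<forall>w\<in>tree_words M \<omega>.
       emeasure N {u \<in> space N. prefix_word (\<xi> u) (length w) = w} \<le> ennreal (sv_function s (tree_comp T \<omega> w))"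
    by (rule frostman_measure_exists[OF s'(2,3)])
  interpret N: finite_measure N by (rule N(1))
  note pre = N(4)[rule_format] and frost = N(5)[rule_format]
  \<comment> \<open>The boxes of radius \<open>Suc m\<close> exhaust the translation vectors, and
    countably many null sets are combined; \<open>Suc\<close> keeps the radius positive.\<close>
  have "AE a in translation_space. \<forall>m::nat. a \<in> PiE classes (\<lambda>_. cball 0 (real (Suc m))) \<longrightarrow>
    (\<integral>\<^sup>+u. (\<Sum>k. ennreal (2 powr (real k * t')) *
       emeasure N {v\<in>space N. dist (tree_point R T \<omega> a (\<xi> u)) (tree_point R T \<omega> a (\<xi> v)) \<le> (1/2)^k}) \<partial>N) < \<infinity>"
    unfolding AE_all_countable by (intro allI energy_finite[OF N(1,3) pre _ t'(1) t s'(3) frost]) auto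
  then show ?thesis
  proof (rule AE_mp, intro AE_I2 impI)
    fix a assume a: "a \<in> space translation_space"
      and fin: "\<forall>m::nat. a \<in> PiE classes (\<lambda>_. cball 0 (real (Suc m))) \<longrightarrow>
    (\<integral>\<^sup>+u. (\<Sum>k. ennreal (2 powr (real k * t')) *
       emeasure N {v\<in>space N. dist (tree_point R T \<omega> a (\<xi> u)) (tree_point R T \<omega> a (\<xi> v)) \<le> (1/2)^k}) \<partial>N) < \<infinity>"
    obtain B where B: "\<And>c. c \<in> classes \<Longrightarrow> norm (a c) \<le> B" using translations_bounded[of a] by blast
    obtain m :: nat where "B \<le> real m" using real_arch_simple by blast
    have "norm (a c) \<le> real (Suc m)" if "c \<in> classes" for c
      using B[OF that] \<open>B \<le> real m\<close> by simp
    moreover have "a \<in> extensional classes" using a by (simp add: space_PiM PiE_def)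
    ultimately have "a \<in> PiE classes (\<lambda>_. cball 0 (real (Suc m)))"
      by (simp add: PiE_iff)
    then have "(\<integral>\<^sup>+u. (\<Sum>k. ennreal (2 powr (real k * t')) *
       emeasure N {v\<in>space N. dist (tree_point R T \<omega> a (\<xi> u)) (tree_point R T \<omega> a (\<xi> v)) \<le> (1/2)^k}) \<partial>N) < \<infinity>"
      using fin by blast
    moreover have "(\<lambda>u. tree_point R T \<omega> a (\<xi> u)) \<in> borel_measurable N"
      using measurable_compose[OF measurable_Pair1'[OF a] random_tree_point_measurable[OF N(1,3) pre]] by simp
    moreover have "(\<lambda>u. tree_point R T \<omega> a (\<xi> u)) ` space N \<subseteq> code_tree_fractal M R T \<omega> a"
      using N(3) by (auto simp: code_tree_fractal_def)
    ultimately show "ereal t' \<le> hausdorff_dim (code_tree_fractal M R T \<omega> a)"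
      using t'(1) N(2) by (intro N.hausdorff_dim_ge_energy)
  qed
qed

text \<open>The exceptional null set depends on the exponent, so the lower bounds are combined over
  rational exponents only; these are dense.\<close>

theorem hausdorff_dim_code_tree_fractal:
  "AE a in translation_measure M R.
     hausdorff_dim (code_tree_fractal M R T \<omega> a) = min (ereal (real DIM('a))) (affinity_dim M T \<omega>)"
proof -
  let ?m = "min (ereal (real DIM('a))) (affinity_dim M T \<omega>)"
  have "AE a in translation_space. \<forall>q::rat. 0 < q \<and> ereal (of_rat q) < ?m \<longrightarrow>
      ereal (of_rat q) \<le> hausdorff_dim (code_tree_fractal M R T \<omega> a)"
    unfolding AE_all_countable
  proof
    fix q :: rat
    show "AE a in translation_space. 0 < q \<and> ereal (of_rat q) < ?m \<longrightarrow>
      ereal (of_rat q) \<le> hausdorff_dim (code_tree_fractal M R T \<omega> a)"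
    proof (cases "0 < q \<and> ereal (of_rat q) < ?m")
      case True
      then show ?thesis using hausdorff_dim_ge_AE[of "of_rat q" \<omega>] by (auto elim: AE_mp)
    next
      case False
      then show ?thesis by (intro AE_I2) blast
    qed
  qed
  then show ?thesis
    unfolding translation_measure_def
  proof (rule AE_mp, intro AE_I2 impI antisym hausdorff_dim_le_min)
    fix a
    let ?d = "hausdorff_dim (code_tree_fractal M R T \<omega> a)"
    assume q: "\<forall>q::rat. 0 < q \<and> ereal (of_rat q) < ?m \<longrightarrow> ereal (of_rat q) \<le> ?d"
    show "?m \<le> ?d"
    proof (rule ccontr)
      assume "\<not> ?m \<le> ?d"
      then obtain q :: rat where "?d < ereal (of_rat q)" "ereal (of_rat q) < ?m"
        using ereal_dense3[of ?d ?m] by (auto simp: not_le)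
      \<comment> \<open>The dimension is nonnegative, so the restriction to positive exponents loses
        nothing.\<close>
      moreover have "0 < q"
        using le_less_trans[OF hausdorff_dim_nonneg \<open>?d < ereal (of_rat q)\<close>] by simp
      ultimately show False using q by (meson not_le)
    qed
  qed
qed

end

theorem theorem3p2:
  fixes M :: "'l \<Rightarrow> nat"
    and T :: "'l \<Rightarrow> nat \<Rightarrow> real ^ 'd \<Rightarrow> real ^ 'd"
    and R :: "('l \<times> nat) rel"
    and \<omega> :: "nat list \<Rightarrow> 'l"
    and \<sigma> :: real
  assumes "\<And>l. 1 \<le> M l" and "bdd_above (range M)"
    and "\<And>l i. (l, i) \<in> map_indices M \<Longrightarrow> linear (T l i)"
    and "\<And>l i. (l, i) \<in> map_indices M \<Longrightarrow> bij (T l i)"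
    and "\<And>l i. (l, i) \<in> map_indices M \<Longrightarrow> onorm (T l i) \<le> \<sigma>"
    and "0 < \<sigma>" and "\<sigma> < 1 / 2"
    and "equiv (map_indices M) R" and "finite (map_indices M // R)"
    and "\<And>l i j. (l, i) \<in> map_indices M \<Longrightarrow> (l, j) \<in> map_indices M \<Longrightarrow>
           ((l, i), (l, j)) \<in> R \<longleftrightarrow> i = j"
    and "\<omega> \<in> code_trees M"
  shows "AE a in translation_measure M R.
           hausdorff_dim (code_tree_fractal M R T \<omega> a)
             = min (ereal (real CARD('d))) (affinity_dim M T \<omega>)"
proof -
  interpret affine_code_tree M T R \<sigma> by (rule affine_code_tree.intro) (fact assms)+
  show ?thesis using hausdorff_dim_code_tree_fractal[of \<omega>] by simp
qed

end
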